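(* Let $n\ge 1$, $0<p\le1$, $\delta>n/p-(n+1)/2$ and let $w\in A_1$ be a weight on $\mathbb R^n$. Suppose that $\delta-(n-1)/2$ is not a positive integer. Then there exists a constant $C>0$ such that for every $f\in WH^p_w(\mathbb R^n)$ and every $0<R<\infty$, $$\big\|T^\delta_R(f)\big\|_{WH^p_w}\le C\,\|f\|_{WH^p_w},$$ where $C$ is independent of $f$ and $R$.
   Context: **Bochner-Riesz operators.** For $\delta>0$ and $0<R<\infty$, $T^\delta_R$ is defined initially for Schwartz functions $f$ on $\mathbb R^n$ by $\widehat{T^\delta_R f}(\xi)=\big(1-|\xi|^2/R^2\big)^\delta_+\,\hat f(\xi)$, where $\hat f(\xi)=\int f(x)e^{-2\pi i x\cdot\xi}\,dx$. Equivalently $T^\delta_R f=\phi_{1/R}*f$, where $\phi$ is the Fourier transform of $\xi\mapsto(1-|\xi|^2)^\delta_+$ and $\phi_{1/R}(x)=R^n\phi(Rx)$; explicitly $\phi(x)=\pi^{-\delta}\Gamma(\delta+1)|x|^{-(n/2+\delta)}J_{n/2+\delta}(2\pi|x|)$, with $J_\mu$ the Bessel function. For a tempered distribution $f\in WH^p_w(\mathbb R^n)$ (defined below), the function $T^\delta_R f=\phi_{1/R}*f$ is understood as the convolution $\phi_{1/R}*(\psi*f)$ of functions, where $\psi\in\mathscr S(\mathbb R^n)$ is any Schwartz function with $\hat\psi=1$ on a neighbourhood of $\{|\xi|\le R\}$. **Weights.** A weight $w$ is a nonnegative locally integrable function on $\mathbb R^n$; cubes have sides parallel to the coordinate axes.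 $w\in A_q$ ($1<q<\infty$) means that there is a constant $C$ with $\big(\frac1{|Q|}\int_Q w\big)\big(\frac1{|Q|}\int_Q w^{-1/(q-1)}\big)^{q-1}\le C$ for every cube $Q$. $w\in A_1$ means that there is a constant $C$ with $\frac1{|Q|}\int_Q w\,dx\le C\,\operatorname{ess\,inf}_{x\in Q}w(x)$ for every cube $Q$. $A_\infty=\bigcup_{1<q<\infty}A_q$, and $q_w=\inf\{q>1:w\in A_q\}$ (so $q_w=1$ if $w\in A_1$). For measurable $E$, $w(E)=\int_E w(x)\,dx$. **Weak Lebesgue space.** $\|g\|_{WL^p_w}=\sup_{\lambda>0}\lambda\, w(\{x\in\mathbb R^n:|g(x)|>\lambda\})^{1/p}$, and $WL^p_w(\mathbb R^n)$ is the set of measurable $g$ for which this is finite. **Weighted weak Hardy space.** Let $w\in A_\infty$, $0<p\le1$, and fix an integer $N\ge[n(q_w/p-1)]$ ($[\cdot]$ is the integer part). Put $$\mathscr A_{N,w}=\Big\{\varphi\in\mathscr S(\mathbb R^n):\sup_{x\in\mathbb R^n}\sup_{|\alpha|\le N+1}(1+|x|)^{N+n+1}|D^\alpha\varphi(x)|\le1\Big\},$$ and $\varphi_t(x)=t^{-n}\varphi(x/t)$. For $f\in\mathscr S'(\mathbb R^n)$ let $G_wf(x)=\sup_{\varphi\in\mathscr A_{N,w}}\sup_{|y-x|<t}|(\varphi_t*f)(y)|$. Then $WH^p_w(\mathbb R^n)=\{f\in\mathscr S'(\mathbb R^n):G_wf\in WL^p_w(\mathbb R^n)\}$ with $\|f\|_{WH^p_w}=\|G_wf\|_{WL^p_w}$.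 The same space, with an equivalent quasi-norm, is obtained by replacing $G_w f$ by the radial grand maximal function $G^+_wf(x)=\sup_{\varphi\in\mathscr A_{N,w}}\sup_{t>0}|(\varphi_t*f)(x)|$. *)

theory Defs
  imports "HOL-Analysis.Analysis"
begin

section \<open>Schwartz functions and tempered distributions\<close>

text \<open>
  Derivatives are indexed by lists of coordinates instead of multi-indices: the order
  \<open>|\<alpha>|\<close> is the length of the list. For smooth functions partial derivatives commute, so
  the lists of length \<open>k\<close> give exactly the \<open>D\<^sup>\<alpha>\<close> with \<open>|\<alpha>| = k\<close>.
\<close>

definition partial_deriv :: "'n \<Rightarrow> (real ^ 'n \<Rightarrow> complex) \<Rightarrow> real ^ 'n::finite \<Rightarrow> complex" where
  "partial_deriv i f x = frechet_derivative f (at x) (axis i 1)"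

fun iter_deriv :: "'n list \<Rightarrow> (real ^ 'n \<Rightarrow> complex) \<Rightarrow> real ^ 'n::finite \<Rightarrow> complex" where
  "iter_deriv [] f = f"
| "iter_deriv (i # is) f = partial_deriv i (iter_deriv is f)"

text \<open>Differentiability of all iterated partial derivatives makes each of them continuous, hence
  \<open>smooth\<close> is \<open>C\<^sup>\<infinity>\<close>.\<close>

definition smooth :: "(real ^ 'n::finite \<Rightarrow> complex) \<Rightarrow> bool" where
  "smooth f \<longleftrightarrow> (\<forall>is x. iter_deriv is f differentiable (at x))"

definition schwartz :: "(real ^ 'n::finite \<Rightarrow> complex) set" where
  "schwartz = {\<phi>. smooth \<phi> \<and>
     (\<forall>k is. \<exists>B. \<forall>x. (1 + norm x) ^ k * norm (iter_deriv is \<phi> x) \<le> B)}"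

definition schwartz_norm :: "nat \<Rightarrow> (real ^ 'n::finite \<Rightarrow> complex) \<Rightarrow> real" where
  "schwartz_norm k \<phi> =
     (SUP (is, x) \<in> {is. length is \<le> k} \<times> UNIV. (1 + norm x) ^ k * norm (iter_deriv is \<phi> x))"

text \<open>A distribution is a functional on functions of which only the values on \<open>schwartz\<close> matter.\<close>

definition tempered_distributions :: "((real ^ 'n::finite \<Rightarrow> complex) \<Rightarrow> complex) set" where
  "tempered_distributions = {f.
     (\<forall>\<phi>\<in>schwartz. \<forall>\<psi>\<in>schwartz. \<forall>a b. f (\<lambda>x. a * \<phi> x + b * \<psi> x) = a * f \<phi> + b * f \<psi>) \<and>
     (\<exists>C k. \<forall>\<phi>\<in>schwartz. norm (f \<phi>) \<le> C * schwartz_norm k \<phi>)}"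

definition distr_of :: "(real ^ 'n::finite \<Rightarrow> complex) \<Rightarrow> (real ^ 'n \<Rightarrow> complex) \<Rightarrow> complex" where
  "distr_of u \<phi> = (LINT x|lborel. u x * \<phi> x)"

definition conv_distr ::
  "(real ^ 'n::finite \<Rightarrow> complex) \<Rightarrow> ((real ^ 'n \<Rightarrow> complex) \<Rightarrow> complex) \<Rightarrow> real ^ 'n \<Rightarrow> complex" where
  "conv_distr \<phi> f y = f (\<lambda>z. \<phi> (y - z))"

definition dilate :: "real \<Rightarrow> (real ^ 'n::finite \<Rightarrow> complex) \<Rightarrow> real ^ 'n \<Rightarrow> complex" where
  "dilate t \<phi> x = \<phi> (x /\<^sub>R t) / of_real (t ^ CARD('n))"

definition fourier :: "(real ^ 'n::finite \<Rightarrow> complex) \<Rightarrow> real ^ 'n \<Rightarrow> complex" where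
  "fourier f \<xi> = (LINT x|lborel. f x * exp (- 2 * of_real pi * \<i> * of_real (x \<bullet> \<xi>)))"


section \<open>Bochner-Riesz operators\<close>

definition br_kernel :: "real \<Rightarrow> real ^ 'n::finite \<Rightarrow> complex" where
  "br_kernel \<delta> = fourier (\<lambda>\<xi>. of_real (max 0 (1 - (norm \<xi>)\<^sup>2) powr \<delta>))"

definition spectral_cutoff :: "real \<Rightarrow> (real ^ 'n::finite \<Rightarrow> complex) \<Rightarrow> bool" where
  "spectral_cutoff R \<psi> \<longleftrightarrow> \<psi> \<in> schwartz \<and> (\<exists>U. open U \<and> cball 0 R \<subseteq> U \<and> (\<forall>\<xi>\<in>U. fourier \<psi> \<xi> = 1))"

definition br_integrand ::
  "real \<Rightarrow> real \<Rightarrow> (real ^ 'n::finite \<Rightarrow> complex) \<Rightarrow> ((real ^ 'n \<Rightarrow> complex) \<Rightarrow> complex)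
    \<Rightarrow> real ^ 'n \<Rightarrow> real ^ 'n \<Rightarrow> complex" where
  "br_integrand \<delta> R \<psi> f x y = dilate (1 / R) (br_kernel \<delta>) (x - y) * conv_distr \<psi> f y"

text \<open>\<open>T\<^sup>\<delta>\<^sub>R f = \<phi>\<^bsub>1/R\<^esub> * (\<psi> * f)\<close>, computed with the cutoff \<open>\<psi>\<close>.\<close>

definition bochner_riesz ::
  "real \<Rightarrow> real \<Rightarrow> (real ^ 'n::finite \<Rightarrow> complex) \<Rightarrow> ((real ^ 'n \<Rightarrow> complex) \<Rightarrow> complex)
    \<Rightarrow> real ^ 'n \<Rightarrow> complex" where
  "bochner_riesz \<delta> R \<psi> f x = (LINT y|lborel. br_integrand \<delta> R \<psi> f x y)"


section \<open>Muckenhoupt weights\<close>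

definition cubes :: "(real ^ 'n::finite) set set" where
  "cubes = {cbox a (\<chi> i. a $ i + l) | a l. l > 0}"

definition average :: "(real ^ 'n::finite) set \<Rightarrow> (real ^ 'n \<Rightarrow> real) \<Rightarrow> real" where
  "average Q g = (LINT x:Q|lebesgue. g x) / measure lebesgue Q"

definition ess_inf_on :: "(real ^ 'n::finite) set \<Rightarrow> (real ^ 'n \<Rightarrow> real) \<Rightarrow> real" where
  "ess_inf_on Q g = Sup {c. AE x in lebesgue. x \<in> Q \<longrightarrow> c \<le> g x}"

text \<open>
  Positivity almost everywhere makes the negative powers in the \<open>A\<^sub>q\<close> condition meaningful. A
  nonnegative function satisfying the \<open>A\<^sub>1\<close> inequality is either positive almost everywhere
  or zero almost everywhere, so within \<open>A\<^sub>1\<close> only the trivial weight is excluded. For the trivial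
  weight the weak Hardy space would be all of \<open>S'\<close>, where the Bochner-Riesz convolution need
  not converge.
\<close>

definition weight :: "(real ^ 'n::finite \<Rightarrow> real) \<Rightarrow> bool" where
  "weight w \<longleftrightarrow> (\<forall>x. 0 \<le> w x) \<and> (AE x in lebesgue. 0 < w x) \<and>
     (\<forall>K. compact K \<longrightarrow> w absolutely_integrable_on K)"

definition A_class :: "real \<Rightarrow> (real ^ 'n::finite \<Rightarrow> real) set" where
  "A_class q = {w. weight w \<and> (\<exists>C. \<forall>Q\<in>cubes.
     (\<lambda>x. w x powr (- 1 / (q - 1))) absolutely_integrable_on Q \<and>
     average Q w * average Q (\<lambda>x. w x powr (- 1 / (q - 1))) powr (q - 1) \<le> C)}"

definition A1_class :: "(real ^ 'n::finite \<Rightarrow> real) set" where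
  "A1_class = {w. weight w \<and> (\<exists>C. \<forall>Q\<in>cubes. average Q w \<le> C * ess_inf_on Q w)}"

definition critical_index :: "(real ^ 'n::finite \<Rightarrow> real) \<Rightarrow> real" where
  "critical_index w = Inf {q. 1 < q \<and> w \<in> A_class q}"

definition weighted_measure :: "(real ^ 'n::finite \<Rightarrow> real) \<Rightarrow> (real ^ 'n) set \<Rightarrow> ennreal" where
  "weighted_measure w E = (\<integral>\<^sup>+x\<in>E. ennreal (w x) \<partial>lebesgue)"


section \<open>Weak Lebesgue and weak Hardy spaces\<close>

text \<open>Real powers with positive exponent on \<open>[0, \<infinity>]\<close>.\<close>

definition ennreal_powr :: "ennreal \<Rightarrow> real \<Rightarrow> ennreal" where
  "ennreal_powr x a = (if x = top then top else ennreal (enn2real x powr a))"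

text \<open>The weak spaces are set up for \<open>[0, \<infinity>]\<close>-valued functions, as needed for maximal functions.\<close>

definition weak_L_norm :: "real \<Rightarrow> (real ^ 'n::finite \<Rightarrow> real) \<Rightarrow> (real ^ 'n \<Rightarrow> ennreal) \<Rightarrow> ennreal" where
  "weak_L_norm p w g =
     (SUP s\<in>{0<..}. ennreal s * ennreal_powr (weighted_measure w {x. g x > ennreal s}) (1 / p))"

definition weak_L :: "real \<Rightarrow> (real ^ 'n::finite \<Rightarrow> real) \<Rightarrow> (real ^ 'n \<Rightarrow> ennreal) set" where
  "weak_L p w = {g. g \<in> borel_measurable lebesgue \<and> weak_L_norm p w g < top}"

definition test_class :: "nat \<Rightarrow> (real ^ 'n::finite \<Rightarrow> complex) set" where
  "test_class N = {\<phi>\<in>schwartz. \<forall>x is. length is \<le> N + 1 \<longrightarrow>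
     (1 + norm x) ^ (N + CARD('n) + 1) * norm (iter_deriv is \<phi> x) \<le> 1}"

definition grand_maximal ::
  "nat \<Rightarrow> ((real ^ 'n::finite \<Rightarrow> complex) \<Rightarrow> complex) \<Rightarrow> real ^ 'n \<Rightarrow> ennreal" where
  "grand_maximal N f x =
     (SUP \<phi>\<in>test_class N. SUP (y, t)\<in>{(y, t). norm (y - x) < t}.
        ennreal (norm (conv_distr (dilate t \<phi>) f y)))"

definition weak_H_norm ::
  "nat \<Rightarrow> real \<Rightarrow> (real ^ 'n::finite \<Rightarrow> real) \<Rightarrow> ((real ^ 'n \<Rightarrow> complex) \<Rightarrow> complex) \<Rightarrow> ennreal" where
  "weak_H_norm N p w f = weak_L_norm p w (grand_maximal N f)"

definition weak_H ::
  "nat \<Rightarrow> real \<Rightarrow> (real ^ 'n::finite \<Rightarrow> real) \<Rightarrow> ((real ^ 'n \<Rightarrow> complex) \<Rightarrow> complex) set" where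
  "weak_H N p w = {f \<in> tempered_distributions. grand_maximal N f \<in> weak_L p w}"

end

theory Submission
  imports Defs
begin

text \<open>
  The proof avoids atomic decompositions. Put \<open>\<sigma> = \<delta> + (n + 1) / 2\<close>, so that the kernel decays like
  \<open>|x|\<^sup>-\<^sup>\<sigma>\<close> with \<open>\<sigma> > n / p\<close>, let \<open>K\<^sub>r\<close> be the kernel dilated to the scale \<open>r = 1 / R\<close>, and let
  \<open>\<psi>\<^sub>r\<close> be a fixed spectral cutoff dilated to the same scale. For a test function \<open>\<phi>\<close>,
  \<open>\<phi>\<^sub>t * T f = K\<^sub>r * (\<phi>\<^sub>t * \<psi>\<^sub>r * f)\<close>, and \<open>\<phi>\<^sub>t * \<psi>\<^sub>r\<close> is a bounded multiple of a test function at scale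
  \<open>m = max t r\<close>. Hence \<open>F = \<phi>\<^sub>t * \<psi>\<^sub>r * f\<close> satisfies \<open>|F v| \<le> C G f z\<close> whenever \<open>|z - v| < m\<close>, where \<open>G\<close> is the
  grand maximal function. For \<open>n / \<sigma> < s < p\<close> this local constancy yields the pointwise bound
  \<open>G (T f) \<le> C (M ((G f)\<^sup>s))\<^sup>1\<^sup>/\<^sup>s\<close> with the Hardy-Littlewood maximal function \<open>M\<close>, which for \<open>A\<^sub>1\<close> weights
  is bounded on weak \<open>L\<^sup>p\<^sup>/\<^sup>s\<close>.
\<close>

section \<open>Integrals over Euclidean space\<close>

text \<open>Averaging |F| itself against the kernel would only give a bound by M (G f), which is of
  no use: for p \<le> 1 a function in weak L^p need not even be locally integrable. Passing to s-th
  powers puts (G f)^s into weak L^q with q = p / s > 1, where truncation and the weak-type (1,1)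
  inequality suffice; that inequality, with the same weight on both sides, is where A_1 enters. The
  price is that the kernel is raised to the power s as well, so \<sigma> * s > n is needed. The
  lower bound on \<delta> says \<sigma> > n / p, which leaves room for such an s below p. The second
  obstacle is that the kernel decays only like a fixed power, while a tempered distribution smoothed
  by \<psi> may grow like any polynomial. Convergence of the defining integral, independence of
  \<psi> and the exchanges of convolutions therefore rest on integrability of \<psi> * f against (1
  + |x|)^(-\<sigma>). This is drawn from finiteness of the maximal function at a single point, which
  in turn comes from the weak-type bound and the positivity of the weight.\<close>

lemma nn_integral_lborel_affine:
  fixes t :: "'a::euclidean_space"
  assumes [measurable]: "f \<in> borel_measurable borel" and c: "c \<noteq> 0"
  shows "(\<integral>\<^sup>+x. f x \<partial>lborel) = ennreal (\<bar>c\<bar> ^ DIM('a)) * (\<integral>\<^sup>+x. f (t + c *\<^sub>R x) \<partial>lborel)"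
  by (subst lborel_affine[OF c, of t]) (simp add: nn_integral_density nn_integral_distr nn_integral_cmult)

lemma integrable_lborel_affine_iff:
  fixes t :: "'a::euclidean_space" and f :: "'a \<Rightarrow> 'b::{banach, second_countable_topology}"
  assumes c: "c \<noteq> 0"
  shows "integrable lborel (\<lambda>x. f (t + c *\<^sub>R x)) \<longleftrightarrow> integrable lborel f"
proof -
  have *: "integrable lborel (\<lambda>x. g (s + d *\<^sub>R x))" if g: "integrable lborel g" and d: "d \<noteq> 0"
    for g :: "'a \<Rightarrow> 'b" and s d
  proof (rule integrableI_bounded)
    have [measurable]: "g \<in> borel_measurable borel" using g by auto
    show "(\<lambda>x. g (s + d *\<^sub>R x)) \<in> borel_measurable lborel" by measurable
    have "ennreal (\<bar>d\<bar> ^ DIM('a)) * (\<integral>\<^sup>+x. norm (g (s + d *\<^sub>R x)) \<partial>lborel) < \<infinity>"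
      using g d by (subst nn_integral_lborel_affine[symmetric]) (auto simp: integrable_iff_bounded)
    then show "(\<integral>\<^sup>+x. norm (g (s + d *\<^sub>R x)) \<partial>lborel) < \<infinity>"
      using d by (auto simp: ennreal_mult_less_top)
  qed
  show ?thesis
  proof
    assume "integrable lborel (\<lambda>x. f (t + c *\<^sub>R x))"
    from *[OF this, of "1 / c" "- (t /\<^sub>R c)"] show "integrable lborel f"
      using c by (simp add: algebra_simps divide_inverse_commute[symmetric])
  qed (use * c in blast)
qed

lemma integral_lborel_affine:
  fixes t :: "'a::euclidean_space" and f :: "'a \<Rightarrow> 'b::{banach, second_countable_topology}"
  assumes c: "c \<noteq> 0"
  shows "(LINT x|lborel. f x) = \<bar>c\<bar> ^ DIM('a) *\<^sub>R (LINT x|lborel. f (t + c *\<^sub>R x))"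
proof (cases "integrable lborel f")
  case True
  then have [measurable]: "f \<in> borel_measurable borel" by auto
  show ?thesis
    by (subst lborel_affine[OF c, of t]) (simp add: integral_density integral_distr)
next
  \<comment> \<open>Integrability is invariant under affine maps, so both integrals are the default
    value 0 here.\<close>
  case False
  then show ?thesis using integrable_lborel_affine_iff[OF c, of f t]
    by (simp add: not_integrable_integral_eq)
qed

lemma nn_integral_lborel_reflect:
  fixes t :: "'a::euclidean_space"
  assumes "f \<in> borel_measurable borel"
  shows "(\<integral>\<^sup>+x. f (t - x) \<partial>lborel) = (\<integral>\<^sup>+x. f x \<partial>lborel)"
  using nn_integral_lborel_affine[OF assms, of "-1" t] by simp

lemma nn_integral_lborel_translate:
  fixes t :: "'a::euclidean_space"
  assumes "f \<in> borel_measurable borel"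
  shows "(\<integral>\<^sup>+x. f (t + x) \<partial>lborel) = (\<integral>\<^sup>+x. f x \<partial>lborel)"
  using nn_integral_lborel_affine[OF assms, of 1 t] by simp

lemma integral_lborel_reflect:
  fixes t :: "'a::euclidean_space" and f :: "'a \<Rightarrow> 'b::{banach, second_countable_topology}"
  shows "(LINT x|lborel. f (t - x)) = (LINT x|lborel. f x)"
  using integral_lborel_affine[of "-1" f t] by simp

lemma integrable_lborel_reflect:
  fixes t :: "'a::euclidean_space" and f :: "'a \<Rightarrow> 'b::{banach, second_countable_topology}"
  shows "integrable lborel (\<lambda>x. f (t - x)) \<longleftrightarrow> integrable lborel f"
  using integrable_lborel_affine_iff[of "-1" f t] by simp

text \<open>Source of every inequality of Peetre type below: the weight \<open>1 + norm x\<close> is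
  submultiplicative under addition of arguments, because the product only adds the nonnegative term
  \<open>p * q\<close>.\<close>

lemma one_plus_le_mult:
  fixes d p q :: real
  assumes "d \<le> p + q" "0 \<le> p" "0 \<le> q"
  shows "1 + d \<le> (1 + p) * (1 + q)"
proof -
  have "(1 + p) * (1 + q) = 1 + p + q + p * q" by (simp add: algebra_simps)
  moreover have "0 \<le> p * q" using assms by simp
  ultimately show ?thesis using assms(1) by linarith
qed

lemma powr_neg_double: "t > 0 \<Longrightarrow> t powr (- a) = 2 powr a * (2 * t) powr (- a :: real)"
  by (simp add: powr_mult powr_minus)

text \<open>Peetre's inequality with a negative exponent. It recentres a decaying weight at the cost
  of a factor that depends only on the displacement.\<close>

lemma powr_neg_add_le:
  fixes a b \<beta> :: real
  assumes "a \<ge> 0" "b \<ge> 0" "\<beta> \<ge> 0"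
  shows "(1 + a) powr (- \<beta>) \<le> (1 + b) powr (- \<beta>) * (1 + \<bar>a - b\<bar>) powr \<beta>"
proof -
  have "1 + b \<le> (1 + a) * (1 + \<bar>a - b\<bar>)"
    using assms by (intro one_plus_le_mult) auto
  then have "(1 + b) powr \<beta> \<le> ((1 + a) * (1 + \<bar>a - b\<bar>)) powr \<beta>"
    using assms by (intro powr_mono2) auto
  also have "\<dots> = (1 + a) powr \<beta> * (1 + \<bar>a - b\<bar>) powr \<beta>"
    using assms by (intro powr_mult)
  finally show ?thesis using assms by (simp add: powr_minus field_simps)
qed

text \<open>
  The library has this only for well-ordered index types. Here translation invariance turns
  \<open>\<integral>\<integral> 1\<^sub>A(T x) g(y)\<close> into \<open>\<integral>\<integral> 1\<^sub>A(y) g(T x)\<close>, which is applied to the indicator \<open>g\<close> of the unit ball.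
\<close>

lemma lborel_distr_orthogonal:
  fixes T :: "real ^ 'n::finite \<Rightarrow> real ^ 'n"
  assumes T: "orthogonal_transformation T"
  shows "distr lborel borel T = lborel"
proof -
  have [measurable]: "T \<in> borel_measurable borel"
    using T by (intro borel_measurable_continuous_onI linear_continuous_on)
      (simp add: orthogonal_transformation_linear linear_conv_bounded_linear[symmetric])
  define S where "S = inv T"
  have TS: "T (S x) = x" for x
    using orthogonal_transformation_surj[OF T] by (simp add: S_def surj_f_inv_f)
  have Tplus: "T (x - S y) = T x - y" for x y
    using linear_diff[OF orthogonal_transformation_linear[OF T]] by (simp add: TS)
  show ?thesis
  proof (rule measure_eqI)
    fix A :: "(real ^ 'n) set" assume "A \<in> sets (distr lborel borel T)"
    then have [measurable]: "A \<in> sets borel" by simp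
    define a :: "real ^ 'n \<Rightarrow> ennreal" where "a = indicator A"
    define g :: "real ^ 'n \<Rightarrow> ennreal" where "g = indicator (ball 0 1)"
    have [measurable]: "a \<in> borel_measurable borel" "g \<in> borel_measurable borel"
      by (auto simp: a_def g_def intro!: borel_measurable_indicator)
    let ?v = "\<integral>\<^sup>+y. g y \<partial>lborel"
    \<comment> \<open>Invariance of the unit ball is the only place where \<open>T\<close> counts as
      an isometry and not merely as a linear bijection.\<close>
    have gT: "g (T x) = g x" for x
      using orthogonal_transformation_norm[OF T] by (simp add: g_def indicator_def)
    have "(\<integral>\<^sup>+x. a (T x) \<partial>lborel) * ?v = (\<integral>\<^sup>+x. a (T x) * ?v \<partial>lborel)"
      by (simp add: nn_integral_multc)
    also have "\<dots> = (\<integral>\<^sup>+x. \<integral>\<^sup>+y. a (T x) * g (T x + y) \<partial>lborel \<partial>lborel)"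
      by (simp add: nn_integral_cmult nn_integral_lborel_translate)
    also have "\<dots> = (\<integral>\<^sup>+y. \<integral>\<^sup>+x. a (T x) * g (T x + y) \<partial>lborel \<partial>lborel)"
      by (rule lborel_pair.Fubini'[symmetric]) measurable
    also have "\<dots> = (\<integral>\<^sup>+y. \<integral>\<^sup>+x. a (T x - y) * g x \<partial>lborel \<partial>lborel)"
    proof (rule nn_integral_cong)
      fix y
      show "(\<integral>\<^sup>+x. a (T x) * g (T x + y) \<partial>lborel) = (\<integral>\<^sup>+x. a (T x - y) * g x \<partial>lborel)"
        using nn_integral_lborel_translate[of "\<lambda>x. a (T x) * g (T x + y)" "- S y"]
        by (simp add: gT Tplus)
    qed
    also have "\<dots> = (\<integral>\<^sup>+x. \<integral>\<^sup>+y. a (T x - y) * g x \<partial>lborel \<partial>lborel)"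
      by (rule lborel_pair.Fubini') measurable
    also have "\<dots> = (\<integral>\<^sup>+y. a y \<partial>lborel) * ?v"
      by (simp add: nn_integral_multc nn_integral_cmult nn_integral_lborel_reflect)
    finally have "(\<integral>\<^sup>+x. a (T x) \<partial>lborel) * ?v = (\<integral>\<^sup>+y. a y \<partial>lborel) * ?v" .
    moreover have "?v = emeasure lborel (ball 0 1 :: (real ^ 'n) set)" by (simp add: g_def)
    then have "?v \<noteq> 0" "?v < top"
      using unit_ball_vol_pos[of "real CARD('n)"]
      by (simp_all add: emeasure_lborel_ball_finite emeasure_ball less_imp_neq[THEN not_sym] del: unit_ball_vol_pos)
    ultimately have "(\<integral>\<^sup>+x. a (T x) \<partial>lborel) = (\<integral>\<^sup>+y. a y \<partial>lborel)"
      by (metis ennreal_mult_cancel_left mult.commute less_top)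
    moreover have "(\<integral>\<^sup>+x. a (T x) \<partial>lborel) = emeasure (distr lborel borel T) A"
      by (subst nn_integral_distr[symmetric, of T lborel borel a]) (simp_all add: a_def)
    ultimately show "emeasure (distr lborel borel T) A = emeasure lborel A"
      by (simp add: a_def)
  qed simp
qed

section \<open>Decay of the Bochner-Riesz kernel\<close>

text \<open>Differentiation under the integral sign. The factor \<open>F\<close> is general because
  it is instantiated twice: with the weight itself and, for the second derivative, with
  \<open>- u\<close> times the weight.\<close>

lemma osc_field_derivative:
  fixes F :: "real \<Rightarrow> real"
  assumes F: "continuous_on {-1..1} F"
  shows "((\<lambda>s. integral {-1..1} (\<lambda>u. F u * cos (s * u))) has_field_derivative
            integral {-1..1} (\<lambda>u. - (u * F u) * sin (s * u))) (at s)"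
    and "((\<lambda>s. integral {-1..1} (\<lambda>u. F u * sin (s * u))) has_field_derivative
            integral {-1..1} (\<lambda>u. (u * F u) * cos (s * u))) (at s)"
proof -
  have F': "continuous_on (UNIV \<times> cbox (-1) 1) (\<lambda>x. F (snd x))"
    by (rule continuous_on_compose2[OF F]) (auto intro!: continuous_intros)
  have int: "(\<lambda>u. F u * cos (t * u)) integrable_on cbox (-1) 1"
       "(\<lambda>u. F u * sin (t * u)) integrable_on cbox (-1) 1" for t
    using F by (auto intro!: integrable_continuous_interval continuous_intros)
  have "((\<lambda>s. integral (cbox (-1) 1) (\<lambda>u. F u * cos (s * u))) has_field_derivative
            integral (cbox (-1) 1) (\<lambda>u. - (u * F u) * sin (s * u))) (at s within UNIV)"
    by (rule leibniz_rule_field_derivative)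
       (use int F' in \<open>auto intro!: derivative_eq_intros continuous_intros simp: case_prod_beta\<close>)
  then show "((\<lambda>s. integral {-1..1} (\<lambda>u. F u * cos (s * u))) has_field_derivative
            integral {-1..1} (\<lambda>u. - (u * F u) * sin (s * u))) (at s)"
    by (simp add: cbox_interval)
  have "((\<lambda>s. integral (cbox (-1) 1) (\<lambda>u. F u * sin (s * u))) has_field_derivative
            integral (cbox (-1) 1) (\<lambda>u. (u * F u) * cos (s * u))) (at s within UNIV)"
    by (rule leibniz_rule_field_derivative)
       (use int F' in \<open>auto intro!: derivative_eq_intros continuous_intros simp: case_prod_beta\<close>)
  then show "((\<lambda>s. integral {-1..1} (\<lambda>u. F u * sin (s * u))) has_field_derivative
            integral {-1..1} (\<lambda>u. (u * F u) * cos (s * u))) (at s)"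
    by (simp add: cbox_interval)
qed

text \<open>Poisson's integral for Bessel functions: up to a constant this is s^(-(\<mu> + 1/2))
  times the Bessel function of order \<mu> + 1/2 at s.\<close>

definition osc_cos :: "real \<Rightarrow> real \<Rightarrow> real" where
  "osc_cos \<mu> s = integral {-1..1} (\<lambda>u. (1 - u\<^sup>2) powr \<mu> * cos (s * u))"

lemma osc_weight_continuous:
  assumes "\<mu> > 0" shows "continuous_on {-1..1} (\<lambda>u::real. (1 - u\<^sup>2) powr \<mu>)"
proof (rule continuous_on_powr')
  show "\<forall>u\<in>{-1..1::real}. 0 \<le> 1 - u\<^sup>2 \<and> (1 - u\<^sup>2 = 0 \<longrightarrow> 0 < \<mu>)"
    using assms by (auto simp: abs_square_le_1 abs_le_iff)
qed (auto intro!: continuous_intros)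

text \<open>The primitive \<open>?G\<close> vanishes at both endpoints. It is differentiated only in
  the open interval, where the base of the power is positive. This identity is what turns the
  derivatives of \<open>osc_cos\<close> into a differential equation.\<close>

lemma osc_by_parts:
  fixes \<mu> s :: real
  assumes "\<mu> > 0"
  shows "s * integral {-1..1} (\<lambda>u. (1 - u\<^sup>2) powr (\<mu> + 1) * cos (s * u))
       = 2 * (\<mu> + 1) * integral {-1..1} (\<lambda>u. u * (1 - u\<^sup>2) powr \<mu> * sin (s * u))"
proof -
  let ?G = "\<lambda>u::real. (1 - u\<^sup>2) powr (\<mu> + 1) * sin (s * u)"
  let ?A = "\<lambda>u::real. (1 - u\<^sup>2) powr (\<mu> + 1) * cos (s * u)"
  let ?B = "\<lambda>u::real. u * (1 - u\<^sup>2) powr \<mu> * sin (s * u)"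
  have cont: "continuous_on {-1..1} (\<lambda>u::real. (1 - u\<^sup>2) powr \<mu>)"
     "continuous_on {-1..1} (\<lambda>u::real. (1 - u\<^sup>2) powr (\<mu>+1))"
    using assms by (auto intro!: osc_weight_continuous)
  have "((\<lambda>u. s * ?A u - 2 * (\<mu> + 1) * ?B u) has_integral (?G 1 - ?G (-1))) {-1..1}"
  proof (rule fundamental_theorem_of_calculus_interior)
    show "continuous_on {-1..1} ?G" by (intro continuous_intros cont)
    fix u :: real assume u: "u \<in> {-1<..<1}"
    hence "1 - u\<^sup>2 > 0" by (simp add: abs_square_less_1 abs_less_iff)
    then have "(?G has_real_derivative s * ?A u - 2 * (\<mu> + 1) * ?B u) (at u)"
      by (auto intro!: derivative_eq_intros simp: algebra_simps powr_diff)
    then show "(?G has_vector_derivative s * ?A u - 2 * (\<mu> + 1) * ?B u) (at u)"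
      by (simp add: has_real_derivative_iff_has_vector_derivative)
  qed simp
  then have "integral {-1..1} (\<lambda>u. s * ?A u - 2 * (\<mu> + 1) * ?B u) = 0"
    by (auto dest!: integral_unique)
  moreover have "integral {-1..1} (\<lambda>u. s * ?A u - 2 * (\<mu> + 1) * ?B u)
     = integral {-1..1} (\<lambda>u. s * ?A u) - integral {-1..1} (\<lambda>u. 2 * (\<mu> + 1) * ?B u)"
    by (intro integral_diff integrable_continuous_interval continuous_intros cont)
  ultimately show ?thesis by (simp add: mult.assoc)
qed

text \<open>
  \<open>z s = s\<^sup>\<mu>\<^sup>+\<^sup>1 * osc_cos \<mu> s\<close> solves \<open>z'' + (1 - \<mu> (\<mu> + 1) / s\<^sup>2) z = 0\<close> (Bessel's equation), whose
  energy \<open>z'\<^sup>2 + z\<^sup>2\<close> stays bounded because \<open>1 / s\<^sup>2\<close> is integrable at infinity.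
\<close>

lemma osc_cos_decay:
  assumes mu: "\<mu> > 0"
  shows "\<exists>C. \<forall>s\<ge>1. \<bar>osc_cos \<mu> s\<bar> \<le> C * s powr (- (\<mu> + 1))"
proof -
  let ?F = "\<lambda>u::real. (1 - u\<^sup>2) powr \<mu>"
  have cont: "continuous_on {-1..1} ?F"
    using assms by (rule osc_weight_continuous)
  define y1 where "y1 s = integral {-1..1} (\<lambda>u. - (u * ?F u) * sin (s * u))" for s
  define y2 where "y2 s = integral {-1..1} (\<lambda>u. - (u * (u * ?F u)) * cos (s * u))" for s
  have d0: "(osc_cos \<mu> has_field_derivative y1 s) (at s)" for s
    using osc_field_derivative(1)[OF cont] unfolding osc_cos_def[abs_def] y1_def .
  have "continuous_on {-1..1} (\<lambda>u. - (u * ?F u))" by (intro continuous_intros cont)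
  from osc_field_derivative(2)[OF this]
  have d1: "(y1 has_field_derivative y2 s) (at s)" for s
    unfolding y1_def[abs_def] y2_def by (simp add: mult.assoc)
  \<comment> \<open>Adding the second derivative multiplies the integrand by
    \<open>1 - u\<^sup>2\<close>, which raises the exponent to \<open>\<mu> + 1\<close>; integration
    by parts turns that integral back into the first derivative.\<close>
  have ode: "s * (y2 s + osc_cos \<mu> s) = - 2 * (\<mu> + 1) * y1 s" for s
  proof -
    have "osc_cos \<mu> s + y2 s = integral {-1..1} (\<lambda>u. ?F u * cos (s * u) + - (u * (u * ?F u)) * cos (s * u))"
      unfolding osc_cos_def y2_def
      by (intro integral_add[symmetric] integrable_continuous_interval continuous_intros cont)
    also have "\<dots> = integral {-1..1} (\<lambda>u. (1 - u\<^sup>2) powr (\<mu> + 1) * cos (s * u))"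
    proof (rule integral_cong)
      fix u :: real assume "u \<in> {-1..1}"
      then have "0 \<le> 1 - u\<^sup>2" by (simp add: abs_square_le_1 abs_le_iff)
      then have "(1 - u\<^sup>2) powr (\<mu> + 1) = (1 - u\<^sup>2) * (1 - u\<^sup>2) powr \<mu>"
        using mu by (auto simp: powr_add)
      then show "?F u * cos (s * u) + - (u * (u * ?F u)) * cos (s * u)
         = (1 - u\<^sup>2) powr (\<mu> + 1) * cos (s * u)"
        by (simp only:) (simp add: algebra_simps power2_eq_square)
    qed
    finally have "s * (y2 s + osc_cos \<mu> s) =
        2 * (\<mu> + 1) * integral {-1..1} (\<lambda>u. u * (1 - u\<^sup>2) powr \<mu> * sin (s * u))"
      using osc_by_parts[OF mu, of s] by (simp add: add.commute)
    moreover have "y1 s = - integral {-1..1} (\<lambda>u. u * (1 - u\<^sup>2) powr \<mu> * sin (s * u))"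
      by (simp add: y1_def)
    ultimately show ?thesis by (simp only: minus_mult_minus)
  qed
  \<comment> \<open>The power of s removes the first-order term of the equation and leaves a unit
    oscillator perturbed by \<open>c / s\<^sup>2\<close>.\<close>
  define z where "z s = s powr (\<mu> + 1) * osc_cos \<mu> s" for s
  define z1 where "z1 s = (\<mu> + 1) * s powr \<mu> * osc_cos \<mu> s + s powr (\<mu> + 1) * y1 s" for s
  define c where "c = \<mu> * (\<mu> + 1)"
  have c: "c > 0" using mu by (simp add: c_def)
  have dz: "(z has_field_derivative z1 s) (at s)" if "s > 0" for s
    unfolding z_def[abs_def] z1_def using that
    by (auto intro!: derivative_eq_intros d0)
  have dz1: "(z1 has_field_derivative (c / s\<^sup>2 - 1) * z s) (at s)" if s: "s > 0" for s
  proof -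
    have "(z1 has_field_derivative (\<mu>+1) * (\<mu> * s powr (\<mu> - 1)) * osc_cos \<mu> s
         + 2 * (\<mu>+1) * s powr \<mu> * y1 s + s powr (\<mu> + 1) * y2 s) (at s)"
      unfolding z1_def[abs_def] using that
      by (auto intro!: derivative_eq_intros d0 d1 simp: algebra_simps)
    also have eq: "s powr (\<mu> + 1) * y2 s = - 2 * (\<mu> + 1) * s powr \<mu> * y1 s - s powr (\<mu> + 1) * osc_cos \<mu> s"
    proof -
      have "s powr (\<mu> + 1) * y2 s = s powr \<mu> * (s * (y2 s + osc_cos \<mu> s)) - s powr (\<mu> + 1) * osc_cos \<mu> s"
        using s by (simp add: powr_add algebra_simps)
      then show ?thesis unfolding ode by simp
    qed
    also have "s powr (\<mu> - 1) = s powr (\<mu> + 1) / s\<^sup>2"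
      using s by (simp add: powr_add powr_diff power2_eq_square field_simps)
    finally show ?thesis
      by (simp add: z_def c_def algebra_simps)
  qed
  \<comment> \<open>The derivative of the plain energy is 2 c z z' / s^2. The factor
    \<open>exp (c / s)\<close> has logarithmic derivative - c / s^2, so that 2 z z' \<le> z^2 + z'^2
    makes the product nonincreasing.\<close>
  define E where "E s = ((z1 s)\<^sup>2 + (z s)\<^sup>2) * exp (c / s)" for s
  have E_le: "E s \<le> E 1" if "s \<ge> 1" for s
  proof (rule DERIV_nonpos_imp_nonincreasing[OF that])
    fix t :: real assume t: "1 \<le> t" "t \<le> s"
    let ?D = "exp (c / t) * (c / t\<^sup>2) * (2 * z t * z1 t - ((z1 t)\<^sup>2 + (z t)\<^sup>2))"
    have "(E has_field_derivative ?D) (at t)"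
      unfolding E_def[abs_def] using t
      by (auto intro!: derivative_eq_intros dz dz1 simp: field_simps power2_eq_square)
    moreover have "2 * z t * z1 t \<le> (z1 t)\<^sup>2 + (z t)\<^sup>2"
      using sum_squares_bound[of "z1 t" "z t"] by (simp add: mult_ac)
    then have "?D \<le> 0" using c by (intro mult_nonneg_nonpos) auto
    ultimately show "\<exists>y. (E has_real_derivative y) (at t) \<and> y \<le> 0" by blast
  qed
  have "\<bar>osc_cos \<mu> s\<bar> \<le> sqrt (E 1) * s powr (- (\<mu> + 1))" if s: "s \<ge> 1" for s
  proof -
    have "(z s)\<^sup>2 * 1 \<le> E s" unfolding E_def using s c
      by (intro mult_mono) auto
    with E_le[OF s] have "\<bar>z s\<bar> \<le> sqrt (E 1)"
      by (intro real_le_rsqrt) auto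
    moreover have "\<bar>osc_cos \<mu> s\<bar> = \<bar>z s\<bar> * s powr (- (\<mu> + 1))"
      using s unfolding z_def abs_mult powr_minus by simp
    ultimately show ?thesis by (simp add: mult_right_mono)
  qed
  then show ?thesis by blast
qed

section \<open>Slicing the multiplier: reduction of its Fourier transform to one dimension\<close>

text \<open>The substitution y = sqrt b * y shows that integrating out one coordinate raises the
  exponent by 1/2. With the truncation at 0 this is valid for every real b, so b may itself be of
  the form b - y^2 and the step can be iterated.\<close>

lemma nn_integral_radial_power_real:
  fixes \<delta> :: real
  assumes "\<delta> > 0"
  shows "\<exists>c\<ge>0. \<forall>b. (\<integral>\<^sup>+y. ennreal (max 0 (b - y\<^sup>2) powr \<delta>) \<partial>lborel) = ennreal (c * max 0 b powr (\<delta> + 1 / 2))"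
proof -
  let ?I = "\<integral>\<^sup>+y. ennreal (max 0 (1 - y\<^sup>2) powr \<delta>) \<partial>lborel"
  have "?I \<le> (\<integral>\<^sup>+y. indicator {-1..1::real} y \<partial>lborel)"
  proof (intro nn_integral_mono)
    fix y :: real
    show "ennreal (max 0 (1 - y\<^sup>2) powr \<delta>) \<le> indicator {-1..1} y"
    proof (cases "\<bar>y\<bar> \<le> 1")
      case True
      then have "max 0 (1 - y\<^sup>2) powr \<delta> \<le> 1" using assms by (intro powr_le1) (auto simp: abs_square_le_1)
      with True show ?thesis by (auto simp: indicator_def abs_le_iff)
    next
      case False
      then have "1 - y\<^sup>2 \<le> 0" using abs_square_le_1[of y] by linarith
      then show ?thesis by (simp add: max_def)
    qed
  qed
  also have "\<dots> = emeasure lborel {-1..1::real}" by (rule nn_integral_indicator) simp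
  also have "\<dots> < top" by (simp only: emeasure_lborel_Icc_eq) simp
  finally have fin: "?I < top" .
  have "(\<integral>\<^sup>+y. ennreal (max 0 (b - y\<^sup>2) powr \<delta>) \<partial>lborel) = ennreal (enn2real ?I * max 0 b powr (\<delta> + 1 / 2))" for b
  proof (cases "b > 0")
    case True
    have "(\<integral>\<^sup>+y. ennreal (max 0 (b - y\<^sup>2) powr \<delta>) \<partial>lborel)
       = \<bar>sqrt b\<bar> * (\<integral>\<^sup>+y. ennreal (max 0 (b - (0 + sqrt b * y)\<^sup>2) powr \<delta>) \<partial>lborel)"
      using True by (intro nn_integral_real_affine) auto
    also have "(\<lambda>y. max 0 (b - (0 + sqrt b * y)\<^sup>2) powr \<delta>) = (\<lambda>y. b powr \<delta> * max 0 (1 - y\<^sup>2) powr \<delta>)"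
    proof
      fix y
      have "b - (0 + sqrt b * y)\<^sup>2 = b * (1 - y\<^sup>2)"
        using True by (simp add: power_mult_distrib right_diff_distrib)
      moreover have "max 0 (b * t) = b * max 0 t" for t
        using True by (auto simp: max_def zero_le_mult_iff)
      ultimately have "max 0 (b - (0 + sqrt b * y)\<^sup>2) = b * max 0 (1 - y\<^sup>2)"
        by simp
      then show "max 0 (b - (0 + sqrt b * y)\<^sup>2) powr \<delta> = b powr \<delta> * max 0 (1 - y\<^sup>2) powr \<delta>"
        using True by (simp add: powr_mult)
    qed
    also have "(\<integral>\<^sup>+y. ennreal (b powr \<delta> * max 0 (1 - y\<^sup>2) powr \<delta>) \<partial>lborel) = ennreal (b powr \<delta>) * ?I"
      by (simp add: ennreal_mult nn_integral_cmult)
    also have "ennreal \<bar>sqrt b\<bar> * (ennreal (b powr \<delta>) * ?I) = ennreal (sqrt b * b powr \<delta>) * ?I"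
      using True by (simp add: ennreal_mult mult.assoc)
    also have "sqrt b * b powr \<delta> = b powr (\<delta> + 1 / 2)"
      using True by (simp add: powr_add powr_half_sqrt)
    also have "?I = ennreal (enn2real ?I)" using fin by simp
    finally show ?thesis using True by (simp add: ennreal_mult mult.commute)
  next
    case False
    then have "max 0 (b - y\<^sup>2) powr \<delta> = 0" for y :: real
      using zero_le_power2[of y] by (subst max_absorb1) (linarith, simp)
    moreover have "max 0 b powr (\<delta> + 1 / 2) = 0" using False by simp
    ultimately show ?thesis by simp
  qed
  then show ?thesis by (intro exI[of _ "enn2real ?I"] conjI allI enn2real_nonneg)
qed

text \<open>Induction on the set of coordinates: the coordinates already integrated out have raised
  the exponent to \<open>\<delta> + real (card A) / 2\<close>, and the one-dimensional integral is
  applied at that exponent.\<close>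

lemma nn_integral_radial_power_Pi:
  fixes \<delta> :: real
  assumes "finite A" "\<delta> > 0"
  shows "\<exists>c\<ge>0. \<forall>b. (\<integral>\<^sup>+x. ennreal (max 0 (b - (\<Sum>i\<in>A. (x i)\<^sup>2)) powr \<delta>) \<partial>Pi\<^sub>M A (\<lambda>_. lborel))
            = ennreal (c * max 0 b powr (\<delta> + real (card A) / 2))"
  using assms(1)
proof (induction A)
  case empty
  interpret product_sigma_finite "\<lambda>_. lborel" by standard
  show ?case by (intro exI[of _ 1]) (simp add: nn_integral_empty space_PiM_empty)
next
  case (insert i A)
  interpret product_sigma_finite "\<lambda>_. lborel" by standard
  from insert.IH obtain c where c: "c \<ge> 0"
    "\<And>b. (\<integral>\<^sup>+x. ennreal (max 0 (b - (\<Sum>i\<in>A. (x i)\<^sup>2)) powr \<delta>) \<partial>Pi\<^sub>M A (\<lambda>_. lborel))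
            = ennreal (c * max 0 b powr (\<delta> + real (card A) / 2))" by blast
  have "\<delta> + real (card A) / 2 > 0" using assms(2) by (simp add: add_pos_nonneg)
  from nn_integral_radial_power_real[OF this] obtain d where d: "d \<ge> 0"
    "\<And>b. (\<integral>\<^sup>+y. ennreal (max 0 (b - y\<^sup>2) powr (\<delta> + real (card A) / 2)) \<partial>lborel)
      = ennreal (d * max 0 b powr (\<delta> + real (card A) / 2 + 1 / 2))" by blast
  have "(\<integral>\<^sup>+x. ennreal (max 0 (b - (\<Sum>i\<in>insert i A. (x i)\<^sup>2)) powr \<delta>) \<partial>Pi\<^sub>M (insert i A) (\<lambda>_. lborel))
      = ennreal (c * d * max 0 b powr (\<delta> + real (card (insert i A)) / 2))" for b
  proof -
    have "(\<integral>\<^sup>+x. ennreal (max 0 (b - (\<Sum>i\<in>insert i A. (x i)\<^sup>2)) powr \<delta>) \<partial>Pi\<^sub>M (insert i A) (\<lambda>_. lborel))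
      = (\<integral>\<^sup>+y. \<integral>\<^sup>+x. ennreal (max 0 (b - (\<Sum>j\<in>insert i A. ((x(i := y)) j)\<^sup>2)) powr \<delta>)
          \<partial>Pi\<^sub>M A (\<lambda>_. lborel) \<partial>lborel)"
      using insert.hyps by (intro product_nn_integral_insert_rev) auto
    also have "(\<lambda>y x. \<Sum>j\<in>insert i A. ((x(i := y)) j)\<^sup>2) = (\<lambda>(y::real) x. y\<^sup>2 + (\<Sum>j\<in>A. (x j)\<^sup>2))"
    proof (intro ext)
      fix y :: real and x
      have "(\<Sum>j\<in>A. ((x(i := y)) j)\<^sup>2) = (\<Sum>j\<in>A. (x j)\<^sup>2)"
        using insert.hyps by (intro sum.cong) auto
      then show "(\<Sum>j\<in>insert i A. ((x(i := y)) j)\<^sup>2) = y\<^sup>2 + (\<Sum>j\<in>A. (x j)\<^sup>2)"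
        using insert.hyps by simp
    qed
    also have "(\<integral>\<^sup>+y. \<integral>\<^sup>+x. ennreal (max 0 (b - (y\<^sup>2 + (\<Sum>j\<in>A. (x j)\<^sup>2))) powr \<delta>)
          \<partial>Pi\<^sub>M A (\<lambda>_. lborel) \<partial>lborel) =
         (\<integral>\<^sup>+y. ennreal (c * max 0 (b - y\<^sup>2) powr (\<delta> + real (card A) / 2)) \<partial>lborel)"
      by (subst c(2)[symmetric]) (simp add: diff_diff_eq)
    also have "\<dots> = ennreal c * ennreal (d * max 0 b powr (\<delta> + real (card A) / 2 + 1 / 2))"
      using c(1) by (simp add: ennreal_mult nn_integral_cmult d(2)[symmetric])
    finally show ?thesis using insert.hyps c d
      by (simp add: ennreal_mult[symmetric] add_divide_distrib algebra_simps)
  qed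
  then show ?case using c d by (intro exI[of _ "c * d"]) auto
qed

text \<open>Defined on any normed space so that one notion covers the multiplier on the whole space
  and its marginal on the real line.\<close>

definition ball_power :: "real \<Rightarrow> 'a::real_normed_vector \<Rightarrow> real" where
  "ball_power \<delta> x = max 0 (1 - (norm x)\<^sup>2) powr \<delta>"

lemma ball_power_nonneg [simp]: "0 \<le> ball_power \<delta> x"
  by (simp add: ball_power_def)

lemma ball_power_eq_0: "norm x \<ge> 1 \<Longrightarrow> ball_power \<delta> x = 0"
  by (simp add: ball_power_def max_absorb1)

lemma ball_power_le_1: "\<delta> \<ge> 0 \<Longrightarrow> ball_power \<delta> x \<le> 1"
  unfolding ball_power_def by (rule powr_le1) auto

lemma ball_power_measurable [measurable]:
  "ball_power \<delta> \<in> borel_measurable (borel :: 'a::euclidean_space measure)"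
  unfolding ball_power_def[abs_def] by measurable

lemma ball_power_integrable:
  assumes "\<delta> \<ge> 0"
  shows "integrable lborel (ball_power \<delta> :: 'a::euclidean_space \<Rightarrow> real)"
proof (rule Bochner_Integration.integrable_bound[of _ "indicator (cball 0 1)"])
  show "integrable lborel (indicator (cball 0 1 :: 'a set) :: 'a \<Rightarrow> real)"
    by (intro integrable_real_indicator) (simp_all only: emeasure_lborel_cball_finite, simp)
  have "norm (ball_power \<delta> (x :: 'a)) \<le> norm (indicator (cball 0 1) x :: real)" for x
    using ball_power_le_1[OF assms, of x] ball_power_eq_0[of x \<delta>] by (cases "norm x \<le> 1") auto
  then show "AE x in lborel. norm (ball_power \<delta> (x :: 'a)) \<le> norm (indicator (cball 0 1) x :: real)"
    by simp
qed measurable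

text \<open>Fubini along the k-th coordinate: for fixed u the other coordinates see a ball power
  with b = 1 - u^2, so the marginal of the multiplier is again a ball power, with exponent raised by
  (n - 1) / 2.\<close>

lemma nn_integral_ball_power_axis:
  assumes "\<delta> > 0"
  shows "\<exists>c\<ge>0. \<forall>g \<in> borel_measurable borel.
    (\<integral>\<^sup>+\<xi>. ennreal (ball_power \<delta> \<xi>) * g (\<xi> $ k) \<partial>(lborel :: (real ^ 'n::finite) measure))
     = (\<integral>\<^sup>+u. ennreal (c * ball_power (\<delta> + (real CARD('n) - 1) / 2) u) * g u \<partial>lborel)"
proof -
  let ?e = "axis k 1 :: real ^ 'n"
  let ?B = "Basis - {?e} :: (real ^ 'n) set"
  interpret product_sigma_finite "\<lambda>_::real ^ 'n. lborel :: real measure" by standard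
  have B: "Basis = insert ?e ?B" by (auto simp: axis_in_Basis_iff)
  have cardB: "card ?B = CARD('n) - 1" by (simp add: axis_in_Basis_iff)
  have "card ?B + 1 = CARD('n)" unfolding cardB using zero_less_card_finite[where 'a='n] by linarith
  then have cardB': "real (card ?B) = real CARD('n) - 1" by linarith
  obtain c where c: "c \<ge> 0"
    "\<And>b. (\<integral>\<^sup>+x. ennreal (max 0 (b - (\<Sum>i\<in>?B. (x i)\<^sup>2)) powr \<delta>) \<partial>Pi\<^sub>M ?B (\<lambda>_. lborel))
            = ennreal (c * max 0 b powr (\<delta> + real (card ?B) / 2))"
    using nn_integral_radial_power_Pi[of ?B \<delta>] assms by auto
  have "(\<integral>\<^sup>+\<xi>. ennreal (ball_power \<delta> \<xi>) * g (\<xi> $ k) \<partial>(lborel :: (real ^ 'n::finite) measure))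
     = (\<integral>\<^sup>+u. ennreal (c * ball_power (\<delta> + (real CARD('n) - 1) / 2) u) * g u \<partial>lborel)"
    if [measurable]: "g \<in> borel_measurable borel" for g
  proof -
    let ?J = "\<lambda>f. ennreal (max 0 (1 - (\<Sum>b\<in>insert ?e ?B. (f b)\<^sup>2)) powr \<delta>) * g (f ?e)"
    have "(\<integral>\<^sup>+\<xi>. ennreal (ball_power \<delta> \<xi>) * g (\<xi> $ k) \<partial>(lborel :: (real ^ 'n) measure)) =
       (\<integral>\<^sup>+f. ennreal (ball_power \<delta> (\<Sum>b\<in>Basis. f b *\<^sub>R b :: real ^ 'n)) * g ((\<Sum>b\<in>Basis. f b *\<^sub>R b :: real ^ 'n) $ k)
           \<partial>Pi\<^sub>M Basis (\<lambda>_. lborel))"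
      by (subst lborel_eq, subst nn_integral_distr) measurable
    also have "\<dots> = (\<integral>\<^sup>+f. ?J f \<partial>Pi\<^sub>M (insert ?e ?B) (\<lambda>_. lborel))"
    proof -
      have "(norm (\<Sum>b\<in>Basis. f b *\<^sub>R b :: real ^ 'n))\<^sup>2 = (\<Sum>b\<in>Basis. (f b)\<^sup>2)" for f
        by (subst power2_norm_eq_inner, subst euclidean_inner) (simp add: inner_sum_left_Basis power2_eq_square)
      moreover have "(\<Sum>b\<in>Basis. f b *\<^sub>R b :: real ^ 'n) $ k = f ?e" for f
        by (subst cart_eq_inner_axis) (simp add: inner_sum_left_Basis axis_in_Basis_iff)
      ultimately show ?thesis unfolding ball_power_def B[symmetric] by simp
    qed
    also have "\<dots> = (\<integral>\<^sup>+u. \<integral>\<^sup>+x. ?J (x(?e := u)) \<partial>Pi\<^sub>M ?B (\<lambda>_. lborel) \<partial>lborel)"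
      by (rule product_nn_integral_insert_rev) auto
    also have "\<dots> = (\<integral>\<^sup>+u. \<integral>\<^sup>+x. ennreal (max 0 ((1 - u\<^sup>2) - (\<Sum>b\<in>?B. (x b)\<^sup>2)) powr \<delta>) * g u
                     \<partial>Pi\<^sub>M ?B (\<lambda>_. lborel) \<partial>lborel)"
    proof -
      have "(\<Sum>b\<in>?B. ((x(?e := u)) b)\<^sup>2) = (\<Sum>b\<in>?B. (x b)\<^sup>2)" for x and u :: real
        by (intro sum.cong) auto
      then have "1 - (\<Sum>b\<in>insert ?e ?B. ((x(?e := u)) b)\<^sup>2) = (1 - u\<^sup>2) - (\<Sum>b\<in>?B. (x b)\<^sup>2)" for x and u :: real
        by (subst sum.insert) auto
      then show ?thesis by (simp only: fun_upd_same)
    qed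
    also have "\<dots> = (\<integral>\<^sup>+u. ennreal (c * max 0 (1 - u\<^sup>2) powr (\<delta> + real (card ?B) / 2)) * g u \<partial>lborel)"
      by (simp only: c(2)[symmetric]) (subst nn_integral_multc, measurable)
    finally show ?thesis unfolding cardB' ball_power_def by simp
  qed
  with c(1) show ?thesis by blast
qed

text \<open>The nonnegative version identifies an image measure, the marginal along coordinate k.
  Complex integrands are then transferred through that measure, including non-integrable ones, for
  which both sides are 0.\<close>

lemma integral_ball_power_axis:
  assumes "\<delta> > 0"
  shows "\<exists>c\<ge>0. \<forall>g \<in> borel_measurable borel.
    (LINT \<xi>|(lborel :: (real ^ 'n::finite) measure). complex_of_real (ball_power \<delta> \<xi>) * g (\<xi> $ k))
     = (LINT u|lborel. complex_of_real (c * ball_power (\<delta> + (real CARD('n) - 1) / 2) u) * g u)"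
proof -
  from nn_integral_ball_power_axis[OF assms] obtain c where c: "c \<ge> 0"
    "\<And>g. g \<in> borel_measurable borel \<Longrightarrow>
       (\<integral>\<^sup>+\<xi>. ennreal (ball_power \<delta> \<xi>) * g (\<xi> $ k) \<partial>(lborel :: (real ^ 'n) measure))
     = (\<integral>\<^sup>+u. ennreal (c * ball_power (\<delta> + (real CARD('n) - 1) / 2) u) * g u \<partial>lborel)" by blast
  let ?M = "density (lborel :: (real ^ 'n) measure) (ball_power \<delta>)"
  let ?N = "density lborel (\<lambda>u. c * ball_power (\<delta> + (real CARD('n) - 1) / 2) u) :: real measure"
  have eq: "distr ?M borel (\<lambda>\<xi>. \<xi> $ k) = ?N"
  proof (rule measure_eqI)
    fix A :: "real set" assume "A \<in> sets (distr ?M borel (\<lambda>\<xi>. \<xi> $ k))"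
    then have [measurable]: "A \<in> sets borel" by simp
    have "emeasure (distr ?M borel (\<lambda>\<xi>. \<xi> $ k)) A =
       (\<integral>\<^sup>+\<xi>. ennreal (ball_power \<delta> \<xi>) * indicator A (\<xi> $ k) \<partial>(lborel :: (real ^ 'n) measure))"
      by (simp add: nn_integral_indicator[symmetric] nn_integral_distr nn_integral_density del: nn_integral_indicator)
    also have "\<dots> = emeasure ?N A"
      by (subst c(2)) (simp_all add: nn_integral_indicator[symmetric] nn_integral_density del: nn_integral_indicator)
    finally show "emeasure (distr ?M borel (\<lambda>\<xi>. \<xi> $ k)) A = emeasure ?N A" .
  qed simp
  have "(LINT \<xi>|(lborel :: (real ^ 'n) measure). complex_of_real (ball_power \<delta> \<xi>) * g (\<xi> $ k))
     = (LINT u|lborel. complex_of_real (c * ball_power (\<delta> + (real CARD('n) - 1) / 2) u) * g u)"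
    if [measurable]: "g \<in> borel_measurable borel" for g
  proof -
    have "(LINT \<xi>|(lborel :: (real ^ 'n) measure). complex_of_real (ball_power \<delta> \<xi>) * g (\<xi> $ k))
       = (LINT \<xi>|?M. g (\<xi> $ k))"
      by (subst integral_density) (auto simp: scaleR_conv_of_real)
    also have "\<dots> = (LINT u|?N. g u)"
      unfolding eq[symmetric] by (subst integral_distr) auto
    also have "\<dots> = (LINT u|lborel. complex_of_real (c * ball_power (\<delta> + (real CARD('n) - 1) / 2) u) * g u)"
      by (subst integral_density) (auto simp: scaleR_conv_of_real c(1))
    finally show ?thesis .
  qed
  with c(1) show ?thesis by blast
qed

text \<open>The weight is even, so averaging the integral with its reflection cancels the sine
  part.\<close>

lemma integral_ball_power_exp:
  assumes "\<mu> > 0"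
  shows "(LINT u|lborel. complex_of_real (ball_power \<mu> (u::real)) * exp (- \<i> * of_real (s * u)))
    = complex_of_real (osc_cos \<mu> s)"
proof -
  let ?F = "\<lambda>u::real. complex_of_real (ball_power \<mu> u)"
  have int: "integrable lborel (\<lambda>u. ?F u * exp (\<i> * of_real (t * u)))" for t
  proof (rule Bochner_Integration.integrable_bound)
    show "integrable lborel (ball_power \<mu> :: real \<Rightarrow> real)" using assms by (intro ball_power_integrable) simp
    show "AE u in lborel. norm (?F u * exp (\<i> * of_real (t * u))) \<le> norm (ball_power \<mu> u)"
      by (simp add: norm_mult)
  qed measurable
  have even: "(LINT u|lborel. ?F u * exp (- \<i> * of_real (s * u))) = (LINT u|lborel. ?F u * exp (\<i> * of_real (s * u)))"
    by (subst integral_lborel_reflect[of _ 0, symmetric]) (simp add: ball_power_def)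
  have int': "integrable lborel (\<lambda>u. ?F u * exp (- \<i> * of_real (s * u)))" using int[of "- s"] by simp
  have "2 * (LINT u|lborel. ?F u * exp (- \<i> * of_real (s * u))) =
     (LINT u|lborel. ?F u * exp (\<i> * of_real (s * u))) + (LINT u|lborel. ?F u * exp (- \<i> * of_real (s * u)))"
    by (simp only: even mult_2)
  also have "\<dots> = (LINT u|lborel. ?F u * exp (\<i> * of_real (s * u)) + ?F u * exp (- \<i> * of_real (s * u)))"
    by (rule Bochner_Integration.integral_add[symmetric, OF int int'])
  also have "\<dots> = (LINT u|lborel. complex_of_real (2 * (ball_power \<mu> u * cos (s * u))))"
    by (intro Bochner_Integration.integral_cong refl)
      (simp add: complex_eq_iff exp_eq_polar cis.ctr Re_exp Im_exp)
  also have "\<dots> = complex_of_real (2 * (LINT u|lborel. ball_power \<mu> u * cos (s * u)))"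
    by (simp only: integral_complex_of_real integral_mult_right_zero)
  also have "(LINT u|lborel. ball_power \<mu> u * cos (s * u)) = (LINT u:{-1..1}|lborel. (1 - u\<^sup>2) powr \<mu> * cos (s * u))"
    unfolding set_lebesgue_integral_def
  proof (intro Bochner_Integration.integral_cong refl)
    fix u :: real
    show "ball_power \<mu> u * cos (s * u) = indicat_real {-1..1} u *\<^sub>R ((1 - u\<^sup>2) powr \<mu> * cos (s * u))"
    proof (cases "\<bar>u\<bar> \<le> 1")
      case True
      then have "0 \<le> 1 - u\<^sup>2" using abs_square_le_1[of u] by linarith
      with True show ?thesis by (auto simp: ball_power_def indicator_def abs_le_iff)
    next
      case False
      then show ?thesis by (auto simp: ball_power_eq_0 indicator_def)
    qed
  qed
  also have "\<dots> = osc_cos \<mu> s"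
    unfolding osc_cos_def
    by (intro set_borel_integral_eq_integral(2) borel_integrable_atLeastAtMost'
        continuous_on_mult[OF osc_weight_continuous[OF assms]] continuous_on_cos continuous_on_mult_left continuous_on_id)
  finally show ?thesis by simp
qed

text \<open>Some orthogonal map carries the k-th axis to the ray through x, and both Lebesgue
  measure and the multiplier are invariant under it.\<close>

lemma fourier_ball_power_axis:
  fixes k :: "'n::finite"
  shows "fourier (\<lambda>\<xi>. complex_of_real (ball_power \<delta> \<xi>)) (x :: real ^ 'n)
     = fourier (\<lambda>\<xi>. complex_of_real (ball_power \<delta> \<xi>)) (axis k (norm x))"
proof -
  obtain T where T: "orthogonal_transformation T" and "2 \<le> CARD('n) \<Longrightarrow> det (matrix T) = 1"
    and Tx: "T (norm x *\<^sub>R axis k 1) = x"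
    using rotation_rightward_line[of x k thesis] by blast
  have [measurable]: "T \<in> borel_measurable borel"
    using T by (intro borel_measurable_continuous_onI linear_continuous_on)
      (simp add: orthogonal_transformation_linear linear_conv_bounded_linear[symmetric])
  have ax: "norm x *\<^sub>R axis k 1 = (axis k (norm x) :: real ^ 'n)"
    by (simp add: vec_eq_iff axis_def)
  have inner_T: "T \<eta> \<bullet> x = \<eta> \<bullet> axis k (norm x)" for \<eta>
    using T Tx ax unfolding orthogonal_transformation_def by metis
  show ?thesis unfolding fourier_def
    by (subst lborel_distr_orthogonal[OF T, symmetric], subst integral_distr)
      (simp_all add: inner_T ball_power_def orthogonal_transformation_norm[OF T])
qed

text \<open>The transform at x is a constant times \<open>osc_cos \<mu>\<close> at 2 pi |x|, where
  \<mu> + 1 is the claimed exponent. Away from the origin the decay of \<open>osc_cos\<close>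
  applies; near the origin the trivial bound by the integral of the multiplier is enough.\<close>

lemma fourier_ball_power_decay:
  assumes "\<delta> > 0"
  shows "\<exists>C>0. \<forall>x :: real ^ 'n::finite.
    norm (fourier (\<lambda>\<xi>. complex_of_real (ball_power \<delta> \<xi>)) x) \<le> C * (1 + norm x) powr (- (\<delta> + (real CARD('n) + 1) / 2))"
proof -
  \<comment> \<open>Any coordinate may serve as the axis.\<close>
  obtain k :: 'n where True by simp
  define \<mu> where "\<mu> = \<delta> + (real CARD('n) - 1) / 2"
  have mu: "\<mu> > 0" and mu': "\<delta> + (real CARD('n) + 1) / 2 = \<mu> + 1"
  proof -
    have "1 \<le> CARD('n)" by (simp add: Suc_le_eq)
    then have "1 \<le> real CARD('n)" by linarith
    then have "0 \<le> (real CARD('n) - 1) / 2" by simp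
    with assms show "\<mu> > 0" unfolding \<mu>_def by linarith
    show "\<delta> + (real CARD('n) + 1) / 2 = \<mu> + 1" by (simp add: \<mu>_def field_simps)
  qed
  let ?K = "fourier (\<lambda>\<xi>. complex_of_real (ball_power \<delta> \<xi>)) :: real ^ 'n \<Rightarrow> complex"
  from integral_ball_power_axis[OF assms, of k] obtain c where c: "c \<ge> 0"
    "\<And>g. g \<in> borel_measurable borel \<Longrightarrow>
       (LINT \<xi>|(lborel :: (real ^ 'n::finite) measure). complex_of_real (ball_power \<delta> \<xi>) * g (\<xi> $ k))
     = (LINT u|lborel. complex_of_real (c * ball_power \<mu> u) * g u)" unfolding \<mu>_def by blast
  have K: "?K x = of_real (c * osc_cos \<mu> (2 * pi * norm x))" for x
  proof -
    have "?K x = (LINT \<xi>|lborel. complex_of_real (ball_power \<delta> \<xi>) *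
             exp (- \<i> * of_real (2 * pi * norm x * ((\<xi> :: real ^ 'n) $ k))))"
      unfolding fourier_ball_power_axis[of \<delta> x k] by (simp add: fourier_def inner_axis mult_ac)
    also have "\<dots> = (LINT u|lborel. of_real c * (complex_of_real (ball_power \<mu> u) * exp (- \<i> * of_real (2 * pi * norm x * u))))"
      by (subst c(2)) (auto simp: mult.assoc)
    also have "\<dots> = of_real (c * osc_cos \<mu> (2 * pi * norm x))"
      by (simp only: integral_mult_right_zero integral_ball_power_exp[OF mu]) simp
    finally show ?thesis .
  qed
  obtain C where C: "\<And>s. s \<ge> 1 \<Longrightarrow> \<bar>osc_cos \<mu> s\<bar> \<le> C * s powr (- (\<mu> + 1))"
    using osc_cos_decay[OF mu] by blast
  have "C \<ge> 0" using C[of 1] by simp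
  define D where "D = (LINT \<xi>|lborel. ball_power \<delta> (\<xi> :: real ^ 'n))"
  have D: "norm (?K x) \<le> D" for x
    unfolding fourier_def D_def
  proof (rule Bochner_Integration.integral_norm_bound_integral)
    show int: "integrable lborel (ball_power \<delta> :: real ^ 'n \<Rightarrow> real)"
      using assms by (intro ball_power_integrable) simp
    show "integrable lborel (\<lambda>\<xi>. complex_of_real (ball_power \<delta> \<xi>) *
         exp (- 2 * complex_of_real pi * \<i> * complex_of_real (\<xi> \<bullet> x)))"
      by (rule Bochner_Integration.integrable_bound[OF int]) (auto simp: norm_mult)
  qed (simp add: norm_mult)
  have "D \<ge> 0" using D[of 0] norm_ge_zero order_trans by blast
  \<comment> \<open>The power of 2 pays for replacing 2 pi |x| by 1 + |x| when |x| \<ge> 1, and for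
    1 + |x| \<le> 2 otherwise. The final 1 makes the constant positive.\<close>
  define C' where "C' = (c * C + D) * 2 powr (\<mu> + 1) + 1"
  have "C' > 0" using \<open>C \<ge> 0\<close> \<open>D \<ge> 0\<close> c(1) by (simp add: C'_def add_nonneg_pos)
  moreover have "norm (?K x) \<le> C' * (1 + norm x) powr (- (\<mu> + 1))" for x
  proof (cases "norm x \<ge> 1")
    case True
    have "1 + norm x \<le> 2 * (2 * pi * norm x)" using True pi_gt3 by (simp add: mult_le_cancel_right1 order_trans[of _ "2 * norm x"])
    then have "(2 * (2 * pi * norm x)) powr (- (\<mu> + 1)) \<le> (1 + norm x) powr (- (\<mu> + 1))"
      using True mu by (intro powr_mono2') auto
    then have *: "(2 * pi * norm x) powr (- (\<mu> + 1)) \<le> 2 powr (\<mu> + 1) * (1 + norm x) powr (- (\<mu> + 1))"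
    proof (subst powr_neg_double)
      have "norm x > 0" using True by linarith
      then show "0 < 2 * pi * norm x" by simp
    qed (intro mult_left_mono, auto)
    have "1 \<le> 2 * pi * norm x" using mult_mono[of 1 "2 * pi" 1 "norm x"] True pi_gt3 by simp
    have "norm (?K x) = c * \<bar>osc_cos \<mu> (2 * pi * norm x)\<bar>"
      unfolding K norm_of_real abs_mult using c(1) by simp
    also have "\<dots> \<le> c * (C * (2 powr (\<mu> + 1) * (1 + norm x) powr (- (\<mu> + 1))))"
      using C[OF \<open>1 \<le> 2 * pi * norm x\<close>] * \<open>C \<ge> 0\<close> c(1)
      by (intro mult_left_mono) (auto intro: order_trans mult_left_mono)
    also have "\<dots> = (c * C) * 2 powr (\<mu> + 1) * (1 + norm x) powr (- (\<mu> + 1))" by simp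
    also have "\<dots> \<le> C' * (1 + norm x) powr (- (\<mu> + 1))"
      unfolding C'_def using \<open>C \<ge> 0\<close> \<open>D \<ge> 0\<close> c(1)
      by (intro mult_right_mono) (auto simp: algebra_simps add_increasing)
    finally show ?thesis .
  next
    case False
    then have "2 powr (- (\<mu> + 1)) \<le> (1 + norm x) powr (- (\<mu> + 1))"
      using mu by (intro powr_mono2') (auto simp: add_pos_nonneg)
    then have "2 powr (\<mu> + 1) * 2 powr (- (\<mu> + 1)) \<le> 2 powr (\<mu> + 1) * (1 + norm x) powr (- (\<mu> + 1))"
      by (rule mult_left_mono) simp
    moreover have "2 powr (\<mu> + 1) * 2 powr (- (\<mu> + 1)) = 1"
      using powr_neg_double[of 1 "\<mu> + 1"] by simp
    ultimately have *: "1 \<le> 2 powr (\<mu> + 1) * (1 + norm x) powr (- (\<mu> + 1))"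
      by (simp only:)
    have "norm (?K x) \<le> D * 1" using D by simp
    also have "\<dots> \<le> D * (2 powr (\<mu> + 1) * (1 + norm x) powr (- (\<mu> + 1)))"
      using * \<open>D \<ge> 0\<close> by (intro mult_left_mono) auto
    also have "\<dots> \<le> C' * (1 + norm x) powr (- (\<mu> + 1))"
      unfolding C'_def mult.assoc[symmetric] using \<open>C \<ge> 0\<close> \<open>D \<ge> 0\<close> c(1)
      by (intro mult_right_mono) (auto simp: algebra_simps add_increasing)
    finally show ?thesis .
  qed
  ultimately show ?thesis unfolding mu' by blast
qed

section \<open>The maximal function and \<open>A\<^sub>1\<close> weights\<close>

text \<open>Local integrability gives measurability of each restriction to a ball of radius j, and
  at every point these restrictions are eventually equal to w.\<close>

lemma weight_measurable:
  fixes w :: "real ^ 'n::finite \<Rightarrow> real"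
  assumes "weight w"
  shows "w \<in> borel_measurable lebesgue"
proof (rule borel_measurable_LIMSEQ_real)
  fix x :: "real ^ 'n"
  show "(\<lambda>j. indicator (cball 0 (real j)) x *\<^sub>R w x) \<longlonglongrightarrow> w x"
  proof (rule tendsto_eventually)
    obtain k where "norm x \<le> real k" using real_arch_simple by blast
    then show "\<forall>\<^sub>F j in sequentially. indicator (cball 0 (real j)) x *\<^sub>R w x = w x"
      by (intro eventually_sequentiallyI[of k]) (auto simp: indicator_def)
  qed
next
  fix j :: nat
  have "w absolutely_integrable_on cball 0 (real j)" using assms by (simp add: weight_def)
  then show "(\<lambda>x. indicator (cball 0 (real j)) x *\<^sub>R w x) \<in> borel_measurable lebesgue"
    unfolding set_integrable_def by (rule borel_measurable_integrable)
qed

lemma weight_nonneg: "weight w \<Longrightarrow> 0 \<le> w x"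
  by (simp add: weight_def)

lemma weighted_measure_mono: "E \<subseteq> E' \<Longrightarrow> weighted_measure w E \<le> weighted_measure w E'"
  unfolding weighted_measure_def by (intro nn_integral_mono) (auto simp: indicator_def)

lemma weighted_measure_eq_emeasure:
  assumes "weight w" "E \<in> sets lebesgue"
  shows "weighted_measure w E = emeasure (density lebesgue w) E"
  using weight_measurable[OF assms(1)] assms(2)
  by (simp add: weighted_measure_def emeasure_density)

text \<open>\<open>ess_inf_on\<close> is a supremum of real numbers and is meaningful only for a
  nonempty set that is bounded above. The set contains 0, and it is bounded because Q has positive
  measure: otherwise w \<ge> k almost everywhere on Q for all k. The supremum is itself a lower
  bound almost everywhere by way of the countably many bounds 1 / (k + 1) below it.\<close>

lemma ess_inf_on_le:
  assumes w: "\<And>x. 0 \<le> w x" and Q: "Q \<in> sets lebesgue" "emeasure lebesgue Q > 0"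
  shows "AE x in lebesgue. x \<in> Q \<longrightarrow> ess_inf_on Q w \<le> w x" and "0 \<le> ess_inf_on Q w"
proof -
  define S where "S = {c. AE x in lebesgue. x \<in> Q \<longrightarrow> c \<le> w x}"
  have S0: "0 \<in> S" using w by (simp add: S_def)
  have down: "c \<in> S" if "d \<in> S" "c \<le> d" for c d
    using that unfolding S_def by (auto elim: eventually_mono order_trans)
  have bdd: "bdd_above S"
  proof (rule ccontr)
    assume nb: "\<not> bdd_above S"
    have "real k \<in> S" for k :: nat
      using nb down unfolding bdd_above_def by (meson linear)
    then have "AE x in lebesgue. \<forall>k::nat. x \<in> Q \<longrightarrow> real k \<le> w x"
      by (subst AE_all_countable) (auto simp: S_def)
    then have "AE x in lebesgue. x \<notin> Q"
    proof (rule eventually_mono)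
      fix x assume "\<forall>k::nat. x \<in> Q \<longrightarrow> real k \<le> w x"
      then show "x \<notin> Q" using reals_Archimedean2[of "w x"] by (auto simp: not_le[symmetric])
    qed
    then have "Q \<in> null_sets lebesgue" using Q(1) by (subst (asm) AE_iff_null_sets[symmetric]) auto
    with Q(2) show False by auto
  qed
  show "0 \<le> ess_inf_on Q w" unfolding ess_inf_on_def S_def[symmetric]
    using S0 bdd by (rule cSup_upper)
  have "ess_inf_on Q w - inverse (real (Suc k)) \<in> S" for k
  proof -
    have "ess_inf_on Q w - inverse (real (Suc k)) < Sup S" by (simp add: ess_inf_on_def S_def)
    then obtain d where "d \<in> S" "ess_inf_on Q w - inverse (real (Suc k)) < d"
      using less_cSup_iff[OF _ bdd] S0 by blast
    then show ?thesis using down by (meson less_imp_le)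
  qed
  then have "AE x in lebesgue. \<forall>k. x \<in> Q \<longrightarrow> ess_inf_on Q w - inverse (real (Suc k)) \<le> w x"
    by (subst AE_all_countable) (auto simp: S_def)
  then show "AE x in lebesgue. x \<in> Q \<longrightarrow> ess_inf_on Q w \<le> w x"
  proof (rule eventually_mono, intro impI)
    fix x assume *: "\<forall>k. x \<in> Q \<longrightarrow> ess_inf_on Q w - inverse (real (Suc k)) \<le> w x" and "x \<in> Q"
    show "ess_inf_on Q w \<le> w x"
    proof (rule LIMSEQ_le_const2)
      show "(\<lambda>k. ess_inf_on Q w - inverse (real (Suc k))) \<longlonglongrightarrow> ess_inf_on Q w"
        using tendsto_diff[OF tendsto_const LIMSEQ_inverse_real_of_nat] by simp
    qed (use * \<open>x \<in> Q\<close> in auto)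
  qed
qed

text \<open>Circumscribing the cube of side \<open>2 * \<rho>\<close> passes from cubes to balls.
  The essential infimum is replaced by a statement for almost every x, the form that can be
  multiplied by a function and integrated.\<close>

lemma A1_weighted_measure_ball:
  fixes w :: "real ^ 'n::finite \<Rightarrow> real"
  assumes "w \<in> A1_class"
  shows "\<exists>C>0. \<forall>c. \<forall>\<rho>>0. AE x in lebesgue. x \<in> ball c \<rho> \<longrightarrow>
            weighted_measure w (ball c \<rho>) \<le> ennreal (C * \<rho> ^ CARD('n)) * ennreal (w x)"
proof -
  from assms obtain C where w: "weight w" and C: "\<And>Q. Q \<in> cubes \<Longrightarrow> average Q w \<le> C * ess_inf_on Q w"
    by (auto simp: A1_class_def)
  \<comment> \<open>The absolute value and the 1 make the constant positive without inspecting
    \<open>C\<close>; the power of 2 comes from the side length \<open>2 * \<rho>\<close>.\<close>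
  let ?C = "(\<bar>C\<bar> + 1) * 2 ^ CARD('n)"
  have "AE x in lebesgue. x \<in> ball c \<rho> \<longrightarrow>
            weighted_measure w (ball c \<rho>) \<le> ennreal (?C * \<rho> ^ CARD('n)) * ennreal (w x)"
     if rho: "\<rho> > 0" for c :: "real ^ 'n" and \<rho>
  proof -
    define a where "a = c - (\<chi> i. \<rho>)"
    define Q where "Q = cbox a (\<chi> i. a $ i + 2 * \<rho>)"
    have Qc: "Q \<in> cubes" using rho unfolding cubes_def Q_def by (auto intro!: exI[of _ "2 * \<rho>"])
    have sub: "ball c \<rho> \<subseteq> Q"
    proof
      fix x assume "x \<in> ball c \<rho>"
      then have "\<bar>(c - x) $ i\<bar> < \<rho>" for i
        using component_le_norm_cart[of "c - x" i] by (simp add: dist_norm)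
      then have "\<bar>c $ i - x $ i\<bar> < \<rho>" for i by simp
      then show "x \<in> Q" unfolding Q_def a_def mem_box_cart by (auto simp: abs_less_iff) (smt (verit))+
    qed
    have mQ: "measure lebesgue Q = (2 * \<rho>) ^ CARD('n)"
      unfolding Q_def using rho by (subst measure_completion) (simp_all add: content_cbox_cart interval_ne_empty_cart)
    have Qs: "Q \<in> sets lebesgue" by (simp add: Q_def)
    have Qpos: "emeasure lebesgue Q > 0"
      using mQ rho by (metis measure_def enn2real_0 not_gr_zero power_not_zero mult_pos_pos zero_less_numeral less_irrefl)
    have int: "w absolutely_integrable_on Q" using w compact_cbox by (auto simp: weight_def Q_def)
    have eq: "weighted_measure w Q = ennreal (LINT x:Q|lebesgue. w x)"
    proof -
      have "weighted_measure w Q = (\<integral>\<^sup>+x. ennreal (indicator Q x *\<^sub>R w x) \<partial>lebesgue)"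
        unfolding weighted_measure_def by (intro nn_integral_cong) (auto simp: indicator_def)
      also have "\<dots> = ennreal (LINT x:Q|lebesgue. w x)"
        unfolding set_lebesgue_integral_def using int weight_nonneg[OF w]
        by (intro nn_integral_eq_integral) (auto simp: set_integrable_def)
      finally show ?thesis .
    qed
    have "(LINT x:Q|lebesgue. w x) = average Q w * (2 * \<rho>) ^ CARD('n)"
      using rho by (simp add: average_def mQ)
    also have "\<dots> \<le> ((\<bar>C\<bar> + 1) * ess_inf_on Q w) * (2 * \<rho>) ^ CARD('n)"
    proof (intro mult_right_mono)
      have "average Q w \<le> C * ess_inf_on Q w" by (rule C[OF Qc])
      also have "\<dots> \<le> (\<bar>C\<bar> + 1) * ess_inf_on Q w"
        using ess_inf_on_le(2)[OF weight_nonneg[OF w] Qs Qpos] by (intro mult_right_mono) auto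
      finally show "average Q w \<le> (\<bar>C\<bar> + 1) * ess_inf_on Q w" .
    qed (use rho in auto)
    also have "\<dots> = ?C * \<rho> ^ CARD('n) * ess_inf_on Q w" by (simp add: power_mult_distrib)
    finally have le: "weighted_measure w Q \<le> ennreal (?C * \<rho> ^ CARD('n) * ess_inf_on Q w)"
      unfolding eq by (rule ennreal_leI)
    show ?thesis using ess_inf_on_le(1)[OF weight_nonneg[OF w] Qs Qpos]
    proof (rule eventually_mono, intro impI)
      fix x assume *: "x \<in> Q \<longrightarrow> ess_inf_on Q w \<le> w x" "x \<in> ball c \<rho>"
      have "weighted_measure w (ball c \<rho>) \<le> weighted_measure w Q" by (rule weighted_measure_mono[OF sub])
      also note le
      also have "ennreal (?C * \<rho> ^ CARD('n) * ess_inf_on Q w) \<le> ennreal (?C * \<rho> ^ CARD('n) * w x)"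
        using * sub rho by (intro ennreal_leI mult_left_mono) auto
      also have "\<dots> = ennreal (?C * \<rho> ^ CARD('n)) * ennreal (w x)"
        using rho weight_nonneg[OF w] by (intro ennreal_mult) auto
      finally show "weighted_measure w (ball c \<rho>) \<le> ennreal (?C * \<rho> ^ CARD('n)) * ennreal (w x)" .
    qed
  qed
  moreover have "?C > 0" by simp
  ultimately show ?thesis by blast
qed

section \<open>The uncentred maximal function and its weighted weak-type (1,1) inequality\<close>

lemma ennreal_divide_leD:
  assumes "X / ennreal a \<le> Y" "a > 0"
  shows "X \<le> ennreal a * Y"
proof -
  have "X = X / ennreal a * ennreal a"
    using assms(2) by (simp add: ennreal_divide_times)
  also have "\<dots> \<le> Y * ennreal a" by (rule mult_right_mono[OF assms(1)]) simp
  finally show ?thesis by (simp add: mult.commute)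
qed

lemma ennreal_mult_le_cancel:
  assumes "X * ennreal a \<le> ennreal b * Y" "a > 0" "b \<ge> 0"
  shows "X \<le> ennreal (b / a) * Y"
proof -
  have "X = X * ennreal a * ennreal (1 / a)"
    using assms(2) by (simp add: mult.assoc ennreal_mult[symmetric])
  also have "\<dots> \<le> ennreal b * Y * ennreal (1 / a)"
    by (rule mult_right_mono[OF assms(1)]) simp
  also have "\<dots> = ennreal (b / a) * Y"
    using ennreal_mult[of b "1 / a"] assms by (simp add: mult_ac)
  finally show ?thesis .
qed

text \<open>Uncentred, which makes superlevel sets unions of open balls, and normalised by
  \<open>\<rho> ^ CARD('n)\<close> instead of the volume; the two differ by the factor
  \<open>unit_ball_vol\<close>, which reappears in \<open>maximal_fun_const_le\<close>. Membership
  of x in the ball already excludes nonpositive radii.\<close>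

definition maximal_fun :: "(real ^ 'n::finite \<Rightarrow> ennreal) \<Rightarrow> real ^ 'n \<Rightarrow> ennreal" where
  "maximal_fun h x = (SUP (c, \<rho>) \<in> {(c, \<rho>). x \<in> ball c \<rho>}.
      (\<integral>\<^sup>+y\<in>ball c \<rho>. h y \<partial>lebesgue) / ennreal (\<rho> ^ CARD('n)))"

lemma maximal_fun_upper:
  fixes h :: "real ^ 'n::finite \<Rightarrow> ennreal"
  assumes "x \<in> ball c \<rho>"
  shows "(\<integral>\<^sup>+y\<in>ball c \<rho>. h y \<partial>lebesgue) \<le> ennreal (\<rho> ^ CARD('n)) * maximal_fun h x"
proof -
  from assms have "dist c x < \<rho>" by simp
  then have "\<rho> > 0" using zero_le_dist[of c x] by linarith
  have "(\<integral>\<^sup>+y\<in>ball c \<rho>. h y \<partial>lebesgue) / ennreal (\<rho> ^ CARD('n)) \<le> maximal_fun h x"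
    unfolding maximal_fun_def by (rule SUP_upper2[of "(c, \<rho>)"]) (use assms in auto)
  then show ?thesis using \<open>\<rho> > 0\<close> by (intro ennreal_divide_leD) auto
qed

lemma maximal_fun_add_le:
  fixes h1 h2 :: "real ^ 'n::finite \<Rightarrow> ennreal"
  assumes "h1 \<in> borel_measurable lebesgue" "h2 \<in> borel_measurable lebesgue"
  shows "maximal_fun (\<lambda>y. h1 y + h2 y) x \<le> maximal_fun h1 x + maximal_fun h2 x"
  unfolding maximal_fun_def[of "\<lambda>y. h1 y + h2 y"]
proof (rule SUP_least, clarify)
  fix c \<rho> assume x: "x \<in> ball c \<rho>"
  have "(\<integral>\<^sup>+y\<in>ball c \<rho>. (h1 y + h2 y) \<partial>lebesgue) / ennreal (\<rho> ^ CARD('n))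
     = (\<integral>\<^sup>+y\<in>ball c \<rho>. h1 y \<partial>lebesgue) / ennreal (\<rho> ^ CARD('n)) + (\<integral>\<^sup>+y\<in>ball c \<rho>. h2 y \<partial>lebesgue) / ennreal (\<rho> ^ CARD('n))"
    using assms unfolding distrib_right
    by (subst nn_integral_add) (auto simp: add_divide_distrib_ennreal intro!: borel_measurable_times_ennreal borel_measurable_indicator)
  also have "\<dots> \<le> maximal_fun h1 x + maximal_fun h2 x"
    unfolding maximal_fun_def
    by (intro add_mono SUP_upper2[of "(c, \<rho>)"]) (use x in auto)
  finally show "(\<integral>\<^sup>+y\<in>ball c \<rho>. (h1 y + h2 y) \<partial>lebesgue) / ennreal (\<rho> ^ CARD('n)) \<le> maximal_fun h1 x + maximal_fun h2 x" .
qed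

text \<open>The A_1 bound on the fivefold ball is multiplied by h and integrated over the small
  ball, so that w is moved inside the integral; the lower bound on the average of h then cancels the
  volume. The factor 5 is the one produced by Vitali's covering lemma.\<close>

lemma A1_maximal_ball:
  fixes w :: "real ^ 'n::finite \<Rightarrow> real"
  assumes "w \<in> A1_class"
  shows "\<exists>C>0. \<forall>h \<in> borel_measurable lebesgue. \<forall>c \<rho> \<alpha>. 0 < \<rho> \<longrightarrow> 0 < \<alpha> \<longrightarrow>
     ennreal (\<alpha> * \<rho> ^ CARD('n)) \<le> (\<integral>\<^sup>+y\<in>ball c \<rho>. h y \<partial>lebesgue) \<longrightarrow>
     weighted_measure w (ball c (5 * \<rho>)) \<le> ennreal (C / \<alpha>) * (\<integral>\<^sup>+y\<in>ball c \<rho>. h y * ennreal (w y) \<partial>lebesgue)"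
proof -
  from assms have w: "weight w" by (simp add: A1_class_def)
  have [measurable]: "w \<in> borel_measurable lebesgue" by (rule weight_measurable[OF w])
  from A1_weighted_measure_ball[OF assms] obtain C where C: "C > 0"
    "\<And>c \<rho>. \<rho> > 0 \<Longrightarrow> AE x in lebesgue. x \<in> ball c \<rho> \<longrightarrow>
            weighted_measure w (ball c \<rho>) \<le> ennreal (C * \<rho> ^ CARD('n)) * ennreal (w x)" by blast
  have "weighted_measure w (ball c (5 * \<rho>)) \<le> ennreal (C * 5 ^ CARD('n) / \<alpha>) * (\<integral>\<^sup>+y\<in>ball c \<rho>. h y * ennreal (w y) \<partial>lebesgue)"
    if [measurable]: "h \<in> borel_measurable lebesgue" and rho: "0 < \<rho>" and lam: "0 < \<alpha>"
      and ge: "ennreal (\<alpha> * \<rho> ^ CARD('n)) \<le> (\<integral>\<^sup>+y\<in>ball c \<rho>. h y \<partial>lebesgue)" for h c \<rho> \<alpha>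
  proof -
    let ?W = "weighted_measure w (ball c (5 * \<rho>))"
    let ?A = "ennreal (C * (5 * \<rho>) ^ CARD('n))"
    have [measurable]: "ball c \<rho> \<in> sets lebesgue" by simp
    have [measurable]: "(\<lambda>y. h y * indicator (ball c \<rho>) y) \<in> borel_measurable lebesgue"
      "(\<lambda>y. h y * ennreal (w y) * indicator (ball c \<rho>) y) \<in> borel_measurable lebesgue"
      by (auto intro!: borel_measurable_times_ennreal borel_measurable_indicator)
    have "?W * ennreal (\<alpha> * \<rho> ^ CARD('n)) \<le> ?W * (\<integral>\<^sup>+y\<in>ball c \<rho>. h y \<partial>lebesgue)"
      by (rule mult_left_mono[OF ge]) simp
    also have "\<dots> = (\<integral>\<^sup>+y. ?W * (h y * indicator (ball c \<rho>) y) \<partial>lebesgue)"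
      by (rule nn_integral_cmult[symmetric]) measurable
    also have "\<dots> \<le> (\<integral>\<^sup>+y. ?A * (h y * ennreal (w y) * indicator (ball c \<rho>) y) \<partial>lebesgue)"
    proof (rule nn_integral_mono_AE)
      have "5 * \<rho> > 0" using rho by simp
      from C(2)[OF this, of c]
      show "AE y in lebesgue. ?W * (h y * indicator (ball c \<rho>) y) \<le> ?A * (h y * ennreal (w y) * indicator (ball c \<rho>) y)"
      proof eventually_elim
        case (elim y)
        show ?case
        proof (cases "y \<in> ball c \<rho>")
          case True
          then have "y \<in> ball c (5 * \<rho>)" using rho by auto
          with elim have "?W \<le> ?A * ennreal (w y)" by simp
          from mult_right_mono[OF this, of "h y"] True show ?thesis by (simp add: mult_ac)
        qed simp
      qed
    qed
    also have "\<dots> = ?A * (\<integral>\<^sup>+y\<in>ball c \<rho>. h y * ennreal (w y) \<partial>lebesgue)"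
      by (rule nn_integral_cmult) measurable
    finally have "?W \<le> ennreal (C * (5 * \<rho>) ^ CARD('n) / (\<alpha> * \<rho> ^ CARD('n))) * (\<integral>\<^sup>+y\<in>ball c \<rho>. h y * ennreal (w y) \<partial>lebesgue)"
      by (rule ennreal_mult_le_cancel) (use rho lam C(1) in auto)
    also have "C * (5 * \<rho>) ^ CARD('n) / (\<alpha> * \<rho> ^ CARD('n)) = C * 5 ^ CARD('n) / \<alpha>"
      using rho lam by (simp add: power_mult_distrib)
    finally show ?thesis .
  qed
  moreover have "C * 5 ^ CARD('n) > 0" using C(1) by simp
  ultimately show ?thesis by blast
qed

lemma suminf_nn_integral_disjoint_le:
  assumes f: "f \<in> borel_measurable M" and D: "\<And>k. D k \<in> sets M" "disjoint_family D"
  shows "(\<Sum>k::nat. \<integral>\<^sup>+y\<in>D k. f y \<partial>M) \<le> (\<integral>\<^sup>+y. f y \<partial>M)"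
proof -
  have "(\<Sum>k. \<integral>\<^sup>+y\<in>D k. f y \<partial>M) = (\<Sum>k. emeasure (density M f) (D k))"
    using f D(1) by (simp add: emeasure_density)
  also have "\<dots> = emeasure (density M f) (\<Union>k. D k)"
    using D by (intro suminf_emeasure) auto
  also have "\<dots> \<le> emeasure (density M f) (space (density M f))"
    using D(1) by (intro emeasure_mono) (auto dest: sets.sets_into_space)
  also have "\<dots> = (\<integral>\<^sup>+y. f y \<partial>M)"
    using f by (simp add: emeasure_density)
  finally show ?thesis .
qed

text \<open>The superlevel set is a union of balls, so it is open, and restricting to balls of radius
  at most \<open>L\<close> exhausts it from below: this makes the Vitali covering lemma applicable.\<close>

lemma maximal_fun_weak_1_1:
  fixes w :: "real ^ 'n::finite \<Rightarrow> real"
  assumes "w \<in> A1_class"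
  shows "\<exists>C>0. \<forall>h \<in> borel_measurable lebesgue. \<forall>\<alpha>>0.
     weighted_measure w {x. maximal_fun h x > ennreal \<alpha>} \<le> ennreal (C / \<alpha>) * (\<integral>\<^sup>+y. h y * ennreal (w y) \<partial>lebesgue)"
proof -
  from assms have w: "weight w" by (simp add: A1_class_def)
  have wm [measurable]: "w \<in> borel_measurable lebesgue" by (rule weight_measurable[OF w])
  from A1_maximal_ball[OF assms] obtain C where C: "C > 0" and
    Cball: "\<And>h c \<rho> \<alpha>. h \<in> borel_measurable lebesgue \<Longrightarrow> 0 < \<rho> \<Longrightarrow> 0 < \<alpha> \<Longrightarrow>
     ennreal (\<alpha> * \<rho> ^ CARD('n)) \<le> (\<integral>\<^sup>+y\<in>ball c \<rho>. h y \<partial>lebesgue) \<Longrightarrow>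
     weighted_measure w (ball c (5 * \<rho>)) \<le> ennreal (C / \<alpha>) * (\<integral>\<^sup>+y\<in>ball c \<rho>. h y * ennreal (w y) \<partial>lebesgue)"
    by blast
  have "weighted_measure w {x. maximal_fun h x > ennreal \<alpha>} \<le> ennreal (C / \<alpha>) * (\<integral>\<^sup>+y. h y * ennreal (w y) \<partial>lebesgue)"
    if hm [measurable]: "h \<in> borel_measurable lebesgue" and lam: "\<alpha> > 0" for h \<alpha>
  proof -
    let ?W = "density lebesgue (\<lambda>x. ennreal (w x))"
    define K where "K L = {(c, \<rho>). 0 < \<rho> \<and> \<rho> \<le> real L \<and>
        ennreal (\<alpha> * \<rho> ^ CARD('n)) \<le> (\<integral>\<^sup>+y\<in>ball c \<rho>. h y \<partial>lebesgue)}" for L :: nat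
    define E where "E L = (\<Union>(c, \<rho>)\<in>K L. ball c \<rho>)" for L
    have K_mono: "K L \<subseteq> K L'" if "L \<le> L'" for L L'
      unfolding K_def using that by (auto intro: order_trans)
    have E_open: "open (E L)" for L unfolding E_def by auto
    have E_sets [measurable]: "E L \<in> sets lebesgue" for L using E_open by simp
    have sub: "{x. maximal_fun h x > ennreal \<alpha>} \<subseteq> (\<Union>L. E L)"
    proof clarify
      fix x assume "maximal_fun h x > ennreal \<alpha>"
      then obtain c \<rho> where x: "x \<in> ball c \<rho>"
         and gt: "(\<integral>\<^sup>+y\<in>ball c \<rho>. h y \<partial>lebesgue) / ennreal (\<rho> ^ CARD('n)) > ennreal \<alpha>"
        unfolding maximal_fun_def less_SUP_iff by auto
      from x have rho: "\<rho> > 0" using zero_le_dist[of c x] unfolding mem_ball by linarith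
      obtain L where L: "\<rho> \<le> real L" using real_arch_simple by blast
      have "\<not> (\<integral>\<^sup>+y\<in>ball c \<rho>. h y \<partial>lebesgue) < ennreal (\<alpha> * \<rho> ^ CARD('n))"
      proof
        assume "(\<integral>\<^sup>+y\<in>ball c \<rho>. h y \<partial>lebesgue) < ennreal (\<alpha> * \<rho> ^ CARD('n))"
        then have "(\<integral>\<^sup>+y\<in>ball c \<rho>. h y \<partial>lebesgue) < ennreal \<alpha> * ennreal (\<rho> ^ CARD('n))"
          using lam rho by (simp add: ennreal_mult)
        then show False using gt rho by (subst (asm) divide_less_ennreal[symmetric]) auto
      qed
      then have "(c, \<rho>) \<in> K L" using L rho by (simp add: K_def not_less)
      with x have "x \<in> E L" unfolding E_def by (intro UN_I[of "(c, \<rho>)"]) auto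
      then show "x \<in> (\<Union>L. E L)" by blast
    qed
    have bound: "emeasure ?W (E L) \<le> ennreal (C / \<alpha>) * (\<integral>\<^sup>+y. h y * ennreal (w y) \<partial>lebesgue)" for L
    proof -
      have "E L \<subseteq> (\<Union>i\<in>K L. ball (fst i) (snd i))" by (auto simp: E_def)
      moreover have "0 < snd i \<and> snd i \<le> real L" if "i \<in> K L" for i using that by (auto simp: K_def)
      ultimately obtain J where J: "countable J" "J \<subseteq> K L"
        and disj: "pairwise (\<lambda>i j. disjnt (ball (fst i) (snd i)) (ball (fst j) (snd j))) J"
        and cov: "E L \<subseteq> (\<Union>i\<in>J. ball (fst i) (5 * snd i))"
        by (rule Vitali_covering_lemma_balls)
      define B where "B k = (if k \<in> to_nat_on J ` J then
            ball (fst (from_nat_into J k)) (snd (from_nat_into J k)) else {})" for k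
      define B5 where "B5 k = (if k \<in> to_nat_on J ` J then
            ball (fst (from_nat_into J k)) (5 * snd (from_nat_into J k)) else {})" for k
      have B_sets [measurable]: "B k \<in> sets lebesgue" "B5 k \<in> sets lebesgue" for k by (simp_all add: B_def B5_def)
      have disjB: "disjoint_family B"
        unfolding disjoint_family_on_def
      proof clarify
        fix k l :: nat assume kl: "k \<noteq> l"
        show "B k \<inter> B l = {}"
        proof (cases "k \<in> to_nat_on J ` J \<and> l \<in> to_nat_on J ` J")
          case True
          then obtain i j where ij: "i \<in> J" "k = to_nat_on J i" "j \<in> J" "l = to_nat_on J j" by blast
          with kl have "disjnt (ball (fst i) (snd i)) (ball (fst j) (snd j))"
            using pairwiseD[OF disj, of i j] by blast
          then show ?thesis using ij J(1) by (simp add: B_def disjnt_def)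
        qed (auto simp: B_def)
      qed
      have cov': "E L \<subseteq> (\<Union>k. B5 k)"
      proof
        fix x assume "x \<in> E L"
        then obtain i where i: "i \<in> J" "x \<in> ball (fst i) (5 * snd i)" using cov by auto
        then have "x \<in> B5 (to_nat_on J i)" using J(1) by (simp add: B5_def)
        then show "x \<in> (\<Union>k. B5 k)" by blast
      qed
      have each: "emeasure ?W (B5 k) \<le> ennreal (C / \<alpha>) * (\<integral>\<^sup>+y\<in>B k. h y * ennreal (w y) \<partial>lebesgue)" for k
      proof (cases "k \<in> to_nat_on J ` J")
        case True
        then obtain c \<rho> where i: "(c, \<rho>) \<in> J" "k = to_nat_on J (c, \<rho>)" by auto
        then have "(c, \<rho>) \<in> K L" using J(2) by blast
        then have "weighted_measure w (ball c (5 * \<rho>)) \<le> ennreal (C / \<alpha>) * (\<integral>\<^sup>+y\<in>ball c \<rho>. h y * ennreal (w y) \<partial>lebesgue)"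
          using lam by (intro Cball) (auto simp: K_def)
        then show ?thesis using i True J(1) by (simp add: B_def B5_def weighted_measure_eq_emeasure[OF w])
      qed (simp add: B5_def)
      have "emeasure ?W (E L) \<le> emeasure ?W (\<Union>k. B5 k)"
        using cov' by (intro emeasure_mono) auto
      also have "\<dots> \<le> (\<Sum>k. emeasure ?W (B5 k))"
        by (intro emeasure_subadditive_countably) auto
      also have "\<dots> \<le> (\<Sum>k. ennreal (C / \<alpha>) * (\<integral>\<^sup>+y\<in>B k. h y * ennreal (w y) \<partial>lebesgue))"
        by (intro suminf_le each) auto
      also have "\<dots> = ennreal (C / \<alpha>) * (\<Sum>k. \<integral>\<^sup>+y\<in>B k. h y * ennreal (w y) \<partial>lebesgue)"
        by simp
      also have "\<dots> \<le> ennreal (C / \<alpha>) * (\<integral>\<^sup>+y. h y * ennreal (w y) \<partial>lebesgue)"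
        by (intro mult_left_mono suminf_nn_integral_disjoint_le disjB) auto
      finally show ?thesis .
    qed
    have "weighted_measure w {x. maximal_fun h x > ennreal \<alpha>} \<le> weighted_measure w (\<Union>L. E L)"
      by (rule weighted_measure_mono[OF sub])
    also have "\<dots> = emeasure ?W (\<Union>L. E L)"
      by (rule weighted_measure_eq_emeasure[OF w]) auto
    also have "\<dots> = (SUP L. emeasure ?W (E L))"
    proof (rule SUP_emeasure_incseq[symmetric])
      show "incseq E" unfolding incseq_def E_def using K_mono by blast
    qed auto
    also have "\<dots> \<le> ennreal (C / \<alpha>) * (\<integral>\<^sup>+y. h y * ennreal (w y) \<partial>lebesgue)"
      by (intro SUP_least bound)
    finally show ?thesis .
  qed
  with C show ?thesis by blast
qed

section \<open>Maximal functions of powers of functions in weak L^p\<close>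

lemma ennreal_powr_ennreal [simp]: "0 \<le> x \<Longrightarrow> ennreal_powr (ennreal x) a = ennreal (x powr a)"
  by (simp add: ennreal_powr_def)

lemma ennreal_powr_top [simp]: "ennreal_powr top a = top"
  by (simp add: ennreal_powr_def)

lemma ennreal_powr_mono:
  assumes "x \<le> y" "0 \<le> a"
  shows "ennreal_powr x a \<le> ennreal_powr y a"
proof (cases "y = top")
  case False
  then have "x \<noteq> top" using assms(1) by (auto simp: top_unique)
  with False assms show ?thesis
    by (auto simp: ennreal_powr_def intro!: ennreal_leI powr_mono2 enn2real_mono simp: less_top)
qed simp

lemma ennreal_powr_measurable [measurable]:
  assumes [measurable]: "g \<in> borel_measurable M"
  shows "(\<lambda>x. ennreal_powr (g x) a) \<in> borel_measurable M"
  unfolding ennreal_powr_def by measurable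

lemma maximal_fun_const_le:
  fixes h :: "real ^ 'n::finite \<Rightarrow> ennreal"
  assumes "\<And>y. h y \<le> ennreal b" "b \<ge> 0"
  shows "maximal_fun h x \<le> ennreal (unit_ball_vol (real CARD('n)) * b)"
  unfolding maximal_fun_def
proof (rule SUP_least, clarify)
  fix c :: "real ^ 'n" and \<rho> assume x: "x \<in> ball c \<rho>"
  then have rho: "\<rho> > 0" using zero_le_dist[of c x] unfolding mem_ball by linarith
  have "(\<integral>\<^sup>+y\<in>ball c \<rho>. h y \<partial>lebesgue) \<le> (\<integral>\<^sup>+y\<in>ball c \<rho>. ennreal b \<partial>lebesgue)"
    using assms(1) by (intro nn_integral_mono mult_right_mono) auto
  also have "\<dots> = ennreal b * emeasure lborel (ball c \<rho>)"
    by (subst nn_integral_cmult_indicator) auto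
  also have "emeasure lborel (ball c \<rho>) = ennreal (unit_ball_vol (real CARD('n)) * \<rho> ^ CARD('n))"
    using rho by (simp add: emeasure_ball)
  also have "ennreal b * \<dots> = ennreal (unit_ball_vol (real CARD('n)) * b) * ennreal (\<rho> ^ CARD('n))"
    using assms(2) rho by (simp add: ennreal_mult[symmetric] mult_ac)
  finally have "(\<integral>\<^sup>+y\<in>ball c \<rho>. h y \<partial>lebesgue) \<le> ennreal (unit_ball_vol (real CARD('n)) * b) * ennreal (\<rho> ^ CARD('n))" .
  then have "(\<integral>\<^sup>+y\<in>ball c \<rho>. h y \<partial>lebesgue) / ennreal (\<rho> ^ CARD('n))
     \<le> ennreal (unit_ball_vol (real CARD('n)) * b) * ennreal (\<rho> ^ CARD('n)) / ennreal (\<rho> ^ CARD('n))"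
    by (rule divide_right_mono_ennreal)
  also have "\<dots> = ennreal (unit_ball_vol (real CARD('n)) * b)"
    using rho by (intro mult_divide_eq_ennreal) auto
  finally show "(\<integral>\<^sup>+y\<in>ball c \<rho>. h y \<partial>lebesgue) / ennreal (\<rho> ^ CARD('n)) \<le> ennreal (unit_ball_vol (real CARD('n)) * b)" .
qed

lemma ennreal_term_le_suminf: "f j \<le> (\<Sum>i. f i :: ennreal)"
  using sum_le_suminf[of f "{j}"] by simp

lemma power_powr_commute: "0 < x \<Longrightarrow> (x ^ j) powr a = (x powr a) ^ j" for x a :: real
  by (induction j) (simp_all add: powr_mult)

lemma ennreal_eq_topI:
  assumes "\<And>N. of_nat N \<le> (x :: ennreal)"
  shows "x = top"
proof (rule ccontr)
  assume "x \<noteq> top"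
  then obtain N where "x < of_nat N" using ennreal_Ex_less_of_nat[of x] by (auto simp: less_top)
  with assms[of N] show False by simp
qed

text \<open>Dyadic layer-cake bound: a finite value above \<open>\<tau>\<close> lies in one dyadic
  interval, and the term of that index alone dominates. At \<open>top\<close> all terms are present
  and each is at least \<open>\<tau> powr s\<close>, so the sum is infinite.\<close>

lemma ennreal_powr_tail_le:
  assumes s: "s > 0" and tau: "\<tau> > 0"
  shows "ennreal_powr g s * indicator {ennreal \<tau><..} g
      \<le> (\<Sum>j. ennreal ((2 ^ Suc j * \<tau>) powr s) * indicator {ennreal (2 ^ j * \<tau>)<..} g)"
proof (cases "g = top")
  case True
  have "of_nat N \<le> (\<Sum>j. ennreal ((2 ^ Suc j * \<tau>) powr s) * indicator {ennreal (2 ^ j * \<tau>)<..} g) / ennreal (\<tau> powr s)" for N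
  proof -
    have "of_nat N * ennreal (\<tau> powr s) = (\<Sum>j<N. ennreal (\<tau> powr s))" by simp
    also have "\<dots> \<le> (\<Sum>j<N. ennreal ((2 ^ Suc j * \<tau>) powr s) * indicator {ennreal (2 ^ j * \<tau>)<..} g)"
    proof (rule sum_mono)
      fix j
      have "1 * \<tau> \<le> 2 ^ Suc j * \<tau>" using tau by (intro mult_right_mono one_le_power) auto
      then have "\<tau> powr s \<le> (2 ^ Suc j * \<tau>) powr s" using s tau by (intro powr_mono2) auto
      then show "ennreal (\<tau> powr s) \<le> ennreal ((2 ^ Suc j * \<tau>) powr s) * indicator {ennreal (2 ^ j * \<tau>)<..} g"
        using True by (simp add: ennreal_leI)
    qed
    also have "\<dots> \<le> (\<Sum>j. ennreal ((2 ^ Suc j * \<tau>) powr s) * indicator {ennreal (2 ^ j * \<tau>)<..} g)"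
      by (rule sum_le_suminf) auto
    finally have "of_nat N * ennreal (\<tau> powr s) / ennreal (\<tau> powr s) \<le>
        (\<Sum>j. ennreal ((2 ^ Suc j * \<tau>) powr s) * indicator {ennreal (2 ^ j * \<tau>)<..} g) / ennreal (\<tau> powr s)"
      by (rule divide_right_mono_ennreal)
    then show ?thesis using tau by (subst (asm) mult_divide_eq_ennreal) auto
  qed
  then have "(\<Sum>j. ennreal ((2 ^ Suc j * \<tau>) powr s) * indicator {ennreal (2 ^ j * \<tau>)<..} g) / ennreal (\<tau> powr s) = top"
    by (rule ennreal_eq_topI)
  then have "(\<Sum>j. ennreal ((2 ^ Suc j * \<tau>) powr s) * indicator {ennreal (2 ^ j * \<tau>)<..} g) = top"
    using tau by (auto simp: ennreal_divide_eq_top_iff)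
  then show ?thesis by simp
next
  case False
  then obtain r where r: "g = ennreal r" "r \<ge> 0" by (cases g) auto
  show ?thesis
  proof (cases "r > \<tau>")
    case True
    obtain m :: nat where "r / \<tau> < 2 ^ m" using real_arch_pow[of 2 "r / \<tau>"] by auto
    then have m: "r \<le> 2 ^ m * \<tau>" using tau by (simp add: field_simps)
    \<comment> \<open>The least k is positive because r > \<tau>; its predecessor j satisfies 2^j *
      \<tau> < r \<le> 2^(j+1) * \<tau>.\<close>
    define k where "k = (LEAST m. r \<le> 2 ^ m * \<tau>)"
    have k: "r \<le> 2 ^ k * \<tau>" unfolding k_def using m by (rule LeastI)
    have "k \<noteq> 0" using k True by (intro notI) simp
    then obtain j where j: "k = Suc j" by (cases k) auto
    have "\<not> r \<le> 2 ^ j * \<tau>" using not_less_Least[of j "\<lambda>m. r \<le> 2 ^ m * \<tau>"] j by (simp add: k_def)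
    then have "g \<in> {ennreal (2 ^ j * \<tau>)<..}" using r tau by (simp add: ennreal_less_iff)
    have "ennreal_powr g s * indicator {ennreal \<tau><..} g \<le> ennreal (r powr s)"
      using r by (auto simp: indicator_def)
    also have "\<dots> \<le> ennreal ((2 ^ Suc j * \<tau>) powr s) * indicator {ennreal (2 ^ j * \<tau>)<..} g"
      using \<open>g \<in> _\<close> k j r s by (auto intro!: ennreal_leI powr_mono2)
    also have "\<dots> \<le> (\<Sum>j. ennreal ((2 ^ Suc j * \<tau>) powr s) * indicator {ennreal (2 ^ j * \<tau>)<..} g)"
      by (rule ennreal_term_le_suminf)
    finally show ?thesis .
  next
    case False
    then show ?thesis using r tau by (simp add: indicator_def ennreal_less_iff)
  qed
qed

text \<open>Summing the layer-cake bound against the distribution function of g gives a geometric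
  series of ratio \<open>2 powr (s - p)\<close>, which converges because s < p.\<close>

lemma nn_integral_tail_le:
  fixes w :: "real ^ 'n::finite \<Rightarrow> real"
  assumes w: "weight w" and g [measurable]: "g \<in> borel_measurable lebesgue"
    and A: "A \<ge> 0" "\<And>t. t > 0 \<Longrightarrow> weighted_measure w {x. g x > ennreal t} \<le> ennreal ((A / t) powr p)"
    and sp: "0 < s" "s < p" and tau: "\<tau> > 0"
  shows "(\<integral>\<^sup>+y. ennreal_powr (g y) s * indicator {ennreal \<tau><..} (g y) * ennreal (w y) \<partial>lebesgue)
     \<le> ennreal (2 powr s / (1 - 2 powr (s - p)) * (\<tau> powr (s - p) * A powr p))"
proof -
  have wm [measurable]: "w \<in> borel_measurable lebesgue" by (rule weight_measurable[OF w])
  have "(\<integral>\<^sup>+y. ennreal_powr (g y) s * indicator {ennreal \<tau><..} (g y) * ennreal (w y) \<partial>lebesgue)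
     \<le> (\<integral>\<^sup>+y. (\<Sum>j. ennreal ((2 ^ Suc j * \<tau>) powr s) * (indicator {ennreal (2 ^ j * \<tau>)<..} (g y) * ennreal (w y))) \<partial>lebesgue)"
  proof (rule nn_integral_mono)
    fix y
    have "ennreal_powr (g y) s * indicator {ennreal \<tau><..} (g y) * ennreal (w y)
       \<le> (\<Sum>j. ennreal ((2 ^ Suc j * \<tau>) powr s) * indicator {ennreal (2 ^ j * \<tau>)<..} (g y)) * ennreal (w y)"
      by (rule mult_right_mono[OF ennreal_powr_tail_le[OF sp(1) tau]]) simp
    also have "\<dots> = (\<Sum>j. ennreal ((2 ^ Suc j * \<tau>) powr s) * indicator {ennreal (2 ^ j * \<tau>)<..} (g y) * ennreal (w y))"
      by (rule ennreal_suminf_multc[symmetric])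
    finally show "ennreal_powr (g y) s * indicator {ennreal \<tau><..} (g y) * ennreal (w y)
       \<le> (\<Sum>j. ennreal ((2 ^ Suc j * \<tau>) powr s) * (indicator {ennreal (2 ^ j * \<tau>)<..} (g y) * ennreal (w y)))"
      by (simp only: mult.assoc)
  qed
  also have "\<dots> = (\<Sum>j. \<integral>\<^sup>+y. ennreal ((2 ^ Suc j * \<tau>) powr s) * (indicator {ennreal (2 ^ j * \<tau>)<..} (g y) * ennreal (w y)) \<partial>lebesgue)"
    by (rule nn_integral_suminf) measurable
  also have "\<dots> = (\<Sum>j. ennreal ((2 ^ Suc j * \<tau>) powr s) * weighted_measure w {x. g x > ennreal (2 ^ j * \<tau>)})"
  proof (rule suminf_cong)
    fix j
    have "(\<integral>\<^sup>+y. indicator {ennreal (2 ^ j * \<tau>)<..} (g y) * ennreal (w y) \<partial>lebesgue) = weighted_measure w {x. g x > ennreal (2 ^ j * \<tau>)}"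
      unfolding weighted_measure_def by (intro nn_integral_cong) (auto simp: indicator_def)
    then show "(\<integral>\<^sup>+y. ennreal ((2 ^ Suc j * \<tau>) powr s) * (indicator {ennreal (2 ^ j * \<tau>)<..} (g y) * ennreal (w y)) \<partial>lebesgue)
       = ennreal ((2 ^ Suc j * \<tau>) powr s) * weighted_measure w {x. g x > ennreal (2 ^ j * \<tau>)}"
      by (subst nn_integral_cmult) auto
  qed
  also have "\<dots> \<le> (\<Sum>j. ennreal ((2 ^ Suc j * \<tau>) powr s) * ennreal ((A / (2 ^ j * \<tau>)) powr p))"
    using tau by (intro suminf_le mult_left_mono A(2)) auto
  also have "\<dots> = (\<Sum>j. ennreal (2 powr s * (\<tau> powr (s - p) * A powr p) * (2 powr (s - p)) ^ j))"
  proof (rule suminf_cong)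
    fix j :: nat
    have "(2 ^ Suc j * \<tau>) powr s * (A / (2 ^ j * \<tau>)) powr p = 2 powr s * (2 ^ j * \<tau>) powr s * (A powr p / (2 ^ j * \<tau>) powr p)"
      using tau A(1) by (simp add: powr_mult powr_divide)
    also have "\<dots> = 2 powr s * A powr p * (2 ^ j * \<tau>) powr (s - p)"
      by (simp add: powr_diff)
    also have "(2 ^ j * \<tau>) powr (s - p) = (2 powr (s - p)) ^ j * \<tau> powr (s - p)"
      using tau by (simp add: powr_mult power_powr_commute)
    finally have "(2 ^ Suc j * \<tau>) powr s * (A / (2 ^ j * \<tau>)) powr p
       = 2 powr s * (\<tau> powr (s - p) * A powr p) * (2 powr (s - p)) ^ j" by (simp add: mult_ac)
    then show "ennreal ((2 ^ Suc j * \<tau>) powr s) * ennreal ((A / (2 ^ j * \<tau>)) powr p)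
        = ennreal (2 powr s * (\<tau> powr (s - p) * A powr p) * (2 powr (s - p)) ^ j)"
      by (simp add: ennreal_mult[symmetric])
  qed
  also have "\<dots> = ennreal (\<Sum>j. 2 powr s * (\<tau> powr (s - p) * A powr p) * (2 powr (s - p)) ^ j)"
    using sp by (intro suminf_ennreal2 summable_mult summable_geometric) (auto simp: powr_less_one)
  also have "(\<Sum>j. 2 powr s * (\<tau> powr (s - p) * A powr p) * (2 powr (s - p)) ^ j)
     = 2 powr s * (\<tau> powr (s - p) * A powr p) * (1 / (1 - 2 powr (s - p)))"
    using sp by (subst suminf_mult) (auto simp: powr_less_one summable_geometric suminf_geometric)
  finally show ?thesis by simp
qed

text \<open>Boundedness of the maximal operator on weak L^q, q = p / s > 1, applied to g^s and
  written with distribution functions. As in Marcinkiewicz interpolation, g is cut at height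
  \<open>\<theta> * t\<close>: the low part contributes at most half of the level, and the high part
  is integrable against w, so the weak-type (1,1) inequality applies to it.\<close>

lemma maximal_fun_weak_type:
  fixes w :: "real ^ 'n::finite \<Rightarrow> real"
  assumes w: "w \<in> A1_class" and sp: "0 < s" "s < p"
  shows "\<exists>D>0. \<forall>g \<in> borel_measurable lebesgue. \<forall>A\<ge>0.
     (\<forall>t>0. weighted_measure w {x. g x > ennreal t} \<le> ennreal ((A / t) powr p)) \<longrightarrow>
     (\<forall>t>0. weighted_measure w {x. maximal_fun (\<lambda>y. ennreal_powr (g y) s) x > ennreal (t powr s)} \<le> ennreal (D * (A / t) powr p))"
proof -
  from w have ww: "weight w" by (simp add: A1_class_def)
  from maximal_fun_weak_1_1[OF w] obtain C where C: "C > 0"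
    "\<And>h a. h \<in> borel_measurable lebesgue \<Longrightarrow> a > 0 \<Longrightarrow>
     weighted_measure w {x. maximal_fun h x > ennreal a} \<le> ennreal (C / a) * (\<integral>\<^sup>+y. h y * ennreal (w y) \<partial>lebesgue)"
    by blast
  define V where "V = unit_ball_vol (real CARD('n))"
  have V: "V > 0" by (simp add: V_def)
  \<comment> \<open>Chosen so that the maximal function of the low part is at most V * (\<theta>
    t)^s = t^s / 2.\<close>
  define \<theta> where "\<theta> = (1 / (2 * V)) powr (1 / s)"
  have theta: "\<theta> > 0" "\<theta> powr s = 1 / (2 * V)" using V sp by (auto simp: \<theta>_def powr_powr)
  define G where "G = 2 powr s / (1 - 2 powr (s - p))"
  have G: "G > 0" using sp by (simp add: G_def powr_less_one)
  define D where "D = 2 * C * G * \<theta> powr (s - p)"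
  have "D > 0" using C(1) G theta(1) by (simp add: D_def)
  moreover have "weighted_measure w {x. maximal_fun (\<lambda>y. ennreal_powr (g y) s) x > ennreal (t powr s)} \<le> ennreal (D * (A / t) powr p)"
    if g [measurable]: "g \<in> borel_measurable lebesgue" and A: "A \<ge> 0"
      "\<And>t. t > 0 \<Longrightarrow> weighted_measure w {x. g x > ennreal t} \<le> ennreal ((A / t) powr p)" and t: "t > 0" for g A t
  proof -
    let ?h = "\<lambda>y. ennreal_powr (g y) s"
    let ?I = "\<lambda>y. indicator {ennreal (\<theta> * t)<..} (g y) :: ennreal"
    have hl: "maximal_fun (\<lambda>y. ?h y * (1 - ?I y)) x \<le> ennreal (t powr s / 2)" for x
    proof -
      have "?h y * (1 - ?I y) \<le> ennreal (t powr s / (2 * V))" for y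
      proof (cases "g y \<le> ennreal (\<theta> * t)")
        case True
        then have "?h y \<le> ennreal_powr (ennreal (\<theta> * t)) s" using sp by (intro ennreal_powr_mono) auto
        also have "\<dots> = ennreal (t powr s / (2 * V))" using theta t by (simp add: powr_mult)
        finally show ?thesis using True by (simp add: indicator_def not_less)
      qed (simp add: indicator_def not_le)
      then have "maximal_fun (\<lambda>y. ?h y * (1 - ?I y)) x \<le> ennreal (unit_ball_vol (real CARD('n)) * (t powr s / (2 * V)))"
        using V by (intro maximal_fun_const_le) auto
      also have "unit_ball_vol (real CARD('n)) * (t powr s / (2 * V)) = t powr s / 2"
        using V by (simp add: V_def[symmetric])
      finally show ?thesis .
    qed
    have sum: "?h = (\<lambda>y. ?h y * (1 - ?I y) + ?h y * ?I y)" by (auto simp: indicator_def)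
    have sub: "{x. maximal_fun ?h x > ennreal (t powr s)} \<subseteq> {x. maximal_fun (\<lambda>y. ?h y * ?I y) x > ennreal (t powr s / 2)}"
    proof clarify
      fix x assume x: "maximal_fun ?h x > ennreal (t powr s)"
      have "maximal_fun ?h x \<le> maximal_fun (\<lambda>y. ?h y * (1 - ?I y)) x + maximal_fun (\<lambda>y. ?h y * ?I y) x"
        by (subst sum, rule maximal_fun_add_le) measurable
      also have "\<dots> \<le> ennreal (t powr s / 2) + maximal_fun (\<lambda>y. ?h y * ?I y) x"
        by (rule add_right_mono[OF hl])
      finally have lt: "ennreal (t powr s) < ennreal (t powr s / 2) + maximal_fun (\<lambda>y. ?h y * ?I y) x" using x by simp
      show "maximal_fun (\<lambda>y. ?h y * ?I y) x > ennreal (t powr s / 2)"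
      proof (rule ccontr)
        assume "\<not> maximal_fun (\<lambda>y. ?h y * ?I y) x > ennreal (t powr s / 2)"
        then have "ennreal (t powr s / 2) + maximal_fun (\<lambda>y. ?h y * ?I y) x \<le> ennreal (t powr s / 2) + ennreal (t powr s / 2)"
          by (intro add_left_mono) simp
        also have "\<dots> = ennreal (t powr s)" by (subst ennreal_plus[symmetric]) auto
        finally show False using lt by simp
      qed
    qed
    have "weighted_measure w {x. maximal_fun ?h x > ennreal (t powr s)}
        \<le> weighted_measure w {x. maximal_fun (\<lambda>y. ?h y * ?I y) x > ennreal (t powr s / 2)}"
      by (rule weighted_measure_mono[OF sub])
    also have "\<dots> \<le> ennreal (C / (t powr s / 2)) * (\<integral>\<^sup>+y. ?h y * ?I y * ennreal (w y) \<partial>lebesgue)"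
      using t by (intro C(2)) auto
    also have "\<dots> \<le> ennreal (C / (t powr s / 2)) * ennreal (G * ((\<theta> * t) powr (s - p) * A powr p))"
      unfolding G_def using t theta(1) by (intro mult_left_mono nn_integral_tail_le[OF ww g A sp]) auto
    also have "\<dots> = ennreal (D * (A / t) powr p)"
      using C(1) t G theta(1) A(1)
      by (simp add: ennreal_mult[symmetric] D_def powr_mult powr_diff powr_divide)
    finally show ?thesis .
  qed
  ultimately show ?thesis by blast
qed

section \<open>Power-decay kernels against the maximal function\<close>

text \<open>If k is least with dist y v / m < 2^k, then for k > 0 the quotient is at least 2^(k -
  1), so the kernel is at most 2^\<beta> * 2^(-\<beta> k). The k-th term of the sum is therefore
  enough, and the off-by-one explains the factor \<open>2 powr \<beta>\<close>.\<close>

lemma powr_neg_dyadic_le: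
  fixes y v :: "'a::metric_space" and \<beta> m :: real
  assumes m: "m > 0" and beta: "\<beta> \<ge> 0"
  shows "ennreal ((1 + dist y v / m) powr (- \<beta>))
     \<le> (\<Sum>j. ennreal (2 powr \<beta> * (2 powr (- \<beta>)) ^ j) * indicator (ball y (2 ^ j * m)) v)"
proof -
  let ?r = "dist y v / m"
  have r: "?r \<ge> 0" using m by simp
  define k where "k = (LEAST k. ?r < 2 ^ k)"
  obtain k0 :: nat where "?r < 2 ^ k0" using real_arch_pow[of 2 ?r] by auto
  then have k: "?r < 2 ^ k" unfolding k_def by (rule LeastI)
  have "(1 + ?r) powr (- \<beta>) \<le> 2 powr \<beta> * (2 powr (- \<beta>)) ^ k"
  proof (cases k)
    case 0
    have "(1 + ?r) powr (- \<beta>) \<le> 1 powr (- \<beta>)" using r beta by (intro powr_mono2') auto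
    also have "\<dots> \<le> 2 powr \<beta>" using beta by (simp add: ge_one_powr_ge_zero)
    finally show ?thesis using 0 by simp
  next
    case (Suc j)
    then have "\<not> ?r < 2 ^ j" using not_less_Least[of j "\<lambda>k. ?r < 2 ^ k"] by (simp add: k_def)
    then have "(1 + ?r) powr (- \<beta>) \<le> (2 ^ j) powr (- \<beta>)" using beta by (intro powr_mono2') auto
    also have "\<dots> = (2 powr (- \<beta>)) ^ j" by (rule power_powr_commute) simp
    also have "\<dots> = 2 powr \<beta> * (2 powr (- \<beta>)) ^ k" using Suc by (simp add: powr_minus)
    finally show ?thesis .
  qed
  then have "ennreal ((1 + ?r) powr (- \<beta>)) \<le> ennreal (2 powr \<beta> * (2 powr (- \<beta>)) ^ k) * indicator (ball y (2 ^ k * m)) v"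
    using k m by (simp add: field_simps ennreal_leI)
  also have "\<dots> \<le> (\<Sum>j. ennreal (2 powr \<beta> * (2 powr (- \<beta>)) ^ j) * indicator (ball y (2 ^ j * m)) v)"
    by (rule ennreal_term_le_suminf)
  finally show ?thesis .
qed

text \<open>All the balls about y with radius 2^j * m contain x, so each integral is controlled by
  the maximal function at the same point x; the volumes 2^(jn) are summable against 2^(-\<beta> j)
  because \<beta> > n.\<close>

lemma nn_integral_kernel_le_maximal_fun:
  fixes h :: "real ^ 'n::finite \<Rightarrow> ennreal"
  assumes beta: "\<beta> > real CARD('n)" and m: "m > 0" and xy: "dist x y < m" and h [measurable]: "h \<in> borel_measurable lebesgue"
  shows "(\<integral>\<^sup>+v. ennreal ((1 + dist y v / m) powr (- \<beta>)) * h v \<partial>lebesgue)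
     \<le> ennreal (2 powr \<beta> / (1 - 2 powr (real CARD('n) - \<beta>)) * m ^ CARD('n)) * maximal_fun h x"
proof -
  let ?M = "maximal_fun h x"
  have [measurable]: "ball y r \<in> sets lebesgue" for r by simp
  have "(\<integral>\<^sup>+v. ennreal ((1 + dist y v / m) powr (- \<beta>)) * h v \<partial>lebesgue)
     \<le> (\<integral>\<^sup>+v. (\<Sum>j. ennreal (2 powr \<beta> * (2 powr (- \<beta>)) ^ j) * (h v * indicator (ball y (2 ^ j * m)) v)) \<partial>lebesgue)"
  proof (rule nn_integral_mono)
    fix v
    have "ennreal ((1 + dist y v / m) powr (- \<beta>)) * h v
      \<le> (\<Sum>j. ennreal (2 powr \<beta> * (2 powr (- \<beta>)) ^ j) * indicator (ball y (2 ^ j * m)) v) * h v"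
      using beta by (intro mult_right_mono powr_neg_dyadic_le[OF m]) auto
    also have "\<dots> = (\<Sum>j. ennreal (2 powr \<beta> * (2 powr (- \<beta>)) ^ j) * indicator (ball y (2 ^ j * m)) v * h v)"
      by (rule ennreal_suminf_multc[symmetric])
    finally show "ennreal ((1 + dist y v / m) powr (- \<beta>)) * h v
      \<le> (\<Sum>j. ennreal (2 powr \<beta> * (2 powr (- \<beta>)) ^ j) * (h v * indicator (ball y (2 ^ j * m)) v))"
      by (simp only: mult.assoc mult.commute[of "h v"])
  qed
  also have "\<dots> = (\<Sum>j. \<integral>\<^sup>+v. ennreal (2 powr \<beta> * (2 powr (- \<beta>)) ^ j) * (h v * indicator (ball y (2 ^ j * m)) v) \<partial>lebesgue)"
    by (rule nn_integral_suminf) (auto intro!: borel_measurable_times_ennreal borel_measurable_indicator)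
  also have "\<dots> = (\<Sum>j. ennreal (2 powr \<beta> * (2 powr (- \<beta>)) ^ j) * (\<integral>\<^sup>+v\<in>ball y (2 ^ j * m). h v \<partial>lebesgue))"
    by (subst nn_integral_cmult) (auto intro!: borel_measurable_times_ennreal borel_measurable_indicator)
  also have "\<dots> \<le> (\<Sum>j. ennreal (2 powr \<beta> * (2 powr (- \<beta>)) ^ j) * (ennreal ((2 ^ j * m) ^ CARD('n)) * ?M))"
  proof (intro suminf_le mult_left_mono maximal_fun_upper)
    fix j :: nat
    have "1 * m \<le> 2 ^ j * m" using m by (intro mult_right_mono) auto
    then show "x \<in> ball y (2 ^ j * m)" using xy by (simp add: dist_commute)
  qed auto
  also have "\<dots> = (\<Sum>j. ennreal (2 powr \<beta> * m ^ CARD('n) * (2 powr (real CARD('n) - \<beta>)) ^ j) * ?M)"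
  proof (rule suminf_cong)
    fix j :: nat
    have "2 powr (real CARD('n) - \<beta>) = 2 ^ CARD('n) * 2 powr (- \<beta>)"
      by (simp add: powr_diff powr_minus powr_realpow divide_inverse)
    moreover have "(2 ^ j) ^ CARD('n) = (2 ^ CARD('n) :: real) ^ j"
      by (simp only: power_mult[symmetric] mult.commute)
    ultimately have "2 powr \<beta> * (2 powr (- \<beta>)) ^ j * (2 ^ j * m) ^ CARD('n) = 2 powr \<beta> * m ^ CARD('n) * (2 powr (real CARD('n) - \<beta>)) ^ j"
      by (simp add: power_mult_distrib)
    then show "ennreal (2 powr \<beta> * (2 powr (- \<beta>)) ^ j) * (ennreal ((2 ^ j * m) ^ CARD('n)) * ?M) =
       ennreal (2 powr \<beta> * m ^ CARD('n) * (2 powr (real CARD('n) - \<beta>)) ^ j) * ?M"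
      by (subst mult.assoc[symmetric], subst ennreal_mult'[symmetric]) (auto simp only: powr_ge_zero intro!: mult_nonneg_nonneg zero_le_power)
  qed
  also have "\<dots> = (\<Sum>j. ennreal (2 powr \<beta> * m ^ CARD('n) * (2 powr (real CARD('n) - \<beta>)) ^ j)) * ?M"
    by (rule ennreal_suminf_multc)
  also have "(\<Sum>j. ennreal (2 powr \<beta> * m ^ CARD('n) * (2 powr (real CARD('n) - \<beta>)) ^ j))
     = ennreal (\<Sum>j. 2 powr \<beta> * m ^ CARD('n) * (2 powr (real CARD('n) - \<beta>)) ^ j)"
    using beta m by (intro suminf_ennreal2 summable_mult summable_geometric) (auto simp: powr_less_one)
  also have "(\<Sum>j. 2 powr \<beta> * m ^ CARD('n) * (2 powr (real CARD('n) - \<beta>)) ^ j)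
     = 2 powr \<beta> * m ^ CARD('n) * (1 / (1 - 2 powr (real CARD('n) - \<beta>)))"
    using beta by (subst suminf_mult) (auto simp: powr_less_one summable_geometric suminf_geometric)
  finally show ?thesis by (simp add: mult_ac)
qed

text \<open>
  Since \<open>s < 1\<close>, the integral of \<open>\<kappa> |F|\<close> cannot be compared with an average of \<open>|F|\<^sup>s\<close> directly;
  the local constancy \<open>|F v| \<le> g z\<close> gives the sup bound first, and then
  \<open>\<kappa> |F| = (\<kappa> |F|)\<^sup>1\<^sup>-\<^sup>s (\<kappa> |F|)\<^sup>s\<close>.
\<close>

lemma kernel_average_le_maximal_fun:
  fixes \<sigma> s :: real
  assumes s: "0 < s" "s < 1" and sigma: "\<sigma> * s > real CARD('n::finite)"
  shows "\<exists>D>0. \<forall>m>0. \<forall>(x :: real ^ 'n) y. \<forall>F :: real ^ 'n \<Rightarrow> complex. \<forall>g \<in> borel_measurable lebesgue.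
     dist x y < m \<longrightarrow> (\<forall>v z. dist z v < m \<longrightarrow> ennreal (norm (F v)) \<le> g z) \<longrightarrow>
     (\<forall>v. ennreal ((1 + dist y v / m) powr (- \<sigma>) * norm (F v)) \<le> ennreal D * ennreal_powr (maximal_fun (\<lambda>z. ennreal_powr (g z) s) x) (1 / s)) \<and>
     (\<integral>\<^sup>+v. ennreal ((1 + dist y v / m) powr (- \<sigma>) * norm (F v)) \<partial>lebesgue)
        \<le> ennreal (D * m ^ CARD('n)) * ennreal_powr (maximal_fun (\<lambda>z. ennreal_powr (g z) s) x) (1 / s)"
proof -
  define n where "n = CARD('n)"
  \<comment> \<open>The s-th power of the kernel decays with this exponent, which exceeds n.\<close>
  define \<beta> where "\<beta> = \<sigma> * s"
  have beta: "\<beta> > real CARD('n)" "\<beta> > 0" using sigma by (auto simp: \<beta>_def intro: le_less_trans[rotated])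
  have sigma0: "\<sigma> > 0" using beta(2) s by (simp add: \<beta>_def zero_less_mult_iff)
  define D1 where "D1 = 2 powr \<beta> / (1 - 2 powr (real CARD('n) - \<beta>))"
  have D1: "D1 > 0" using beta by (simp add: D1_def powr_less_one)
  define V where "V = unit_ball_vol (real CARD('n))"
  have V: "V > 0" by (simp add: V_def)
  define D2 where "D2 = 2 powr \<beta> * D1 / V"
  have D2: "D2 > 0" using D1 V by (simp add: D2_def)
  define D where "D = D2 powr (1 / s) + D1 * D2 powr ((1 - s) / s)"
  have D: "D > 0" "D2 powr (1 / s) \<le> D" "D1 * D2 powr ((1 - s) / s) \<le> D"
    using D1 D2 by (auto simp: D_def intro!: add_pos_pos)
  have "(\<forall>v. ennreal ((1 + dist y v / m) powr (- \<sigma>) * norm (F v)) \<le> ennreal D * ennreal_powr (maximal_fun (\<lambda>z. ennreal_powr (g z) s) x) (1 / s)) \<and>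
     (\<integral>\<^sup>+v. ennreal ((1 + dist y v / m) powr (- \<sigma>) * norm (F v)) \<partial>lebesgue)
        \<le> ennreal (D * m ^ CARD('n)) * ennreal_powr (maximal_fun (\<lambda>z. ennreal_powr (g z) s) x) (1 / s)"
    if m: "m > 0" and g [measurable]: "g \<in> borel_measurable lebesgue" and xy: "dist x y < m"
      and F: "\<And>v z. dist z v < m \<Longrightarrow> ennreal (norm (F v)) \<le> g z"
    for m and x y :: "real ^ 'n" and F :: "real ^ 'n \<Rightarrow> complex" and g
  proof (cases "maximal_fun (\<lambda>z. ennreal_powr (g z) s) x = top")
    case True
    have "D * m ^ CARD('n) > 0" using D(1) m by simp
    then show ?thesis using True D(1) m by (simp add: ennreal_mult_top)
  next
    case False
    define h where "h = (\<lambda>z. ennreal_powr (g z) s)"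
    have [measurable]: "h \<in> borel_measurable lebesgue" unfolding h_def by measurable
    from False obtain M where M: "maximal_fun h x = ennreal M" "M \<ge> 0"
      unfolding h_def by (cases "maximal_fun (\<lambda>z. ennreal_powr (g z) s) x") auto
    define \<kappa> where "\<kappa> v = (1 + dist y v / m) powr (- \<sigma>)" for v
    have [measurable]: "\<kappa> \<in> borel_measurable lebesgue"
      unfolding \<kappa>_def[abs_def] by (rule measurable_completion) measurable
    have [measurable]: "(\<lambda>z. ennreal ((\<kappa> z) powr s) * h z) \<in> borel_measurable lebesgue"
      by measurable
    have kappa0: "\<kappa> v > 0" for v using m by (simp add: \<kappa>_def add_pos_nonneg less_imp_neq[symmetric])
    have kappa_s: "(\<kappa> v) powr s = (1 + dist y v / m) powr (- \<beta>)" for v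
      by (simp add: \<kappa>_def powr_powr \<beta>_def)
    have X: "(\<integral>\<^sup>+v. ennreal ((\<kappa> v) powr s) * h v \<partial>lebesgue) \<le> ennreal (D1 * m ^ CARD('n) * M)"
    proof -
      have "ennreal (D1 * m ^ CARD('n) * M) = ennreal (D1 * m ^ CARD('n)) * ennreal M"
        using D1 m M(2) by (intro ennreal_mult) auto
      then show ?thesis
        using nn_integral_kernel_le_maximal_fun[OF beta(1) m xy, of h]
        unfolding kappa_s D1_def[symmetric] M(1) by simp
    qed
    have Fh: "ennreal (norm (F v) powr s) \<le> h z" if "dist z v < m" for v z
      using ennreal_powr_mono[OF F[OF that], of s] s by (simp add: h_def)
    \<comment> \<open>The number at v is averaged over the ball of radius m about v. There |F v| is
      dominated by g z, and the kernel at v is comparable with the kernel at z up to a factor 2 in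
      the base, so the average is dominated by the integral in \<open>X\<close>.\<close>
    have sup: "(\<kappa> v * norm (F v)) powr s \<le> D2 * M" for v
    proof -
      have "ennreal ((\<kappa> v * norm (F v)) powr s) * indicator (ball v m) z \<le> ennreal (2 powr \<beta>) * (ennreal ((\<kappa> z) powr s) * h z)" for z
      proof (cases "z \<in> ball v m")
        case True
        have "1 + dist y z / m \<le> 2 * (1 + dist y v / m)"
        proof -
          have "dist y z \<le> dist y v + m" using dist_triangle[of y z v] True by simp
          then have "dist y z / m \<le> (dist y v + m) / m" using m by (intro divide_right_mono) auto
          also have "\<dots> = dist y v / m + 1" using m by (simp add: add_divide_distrib)
          finally have "1 + dist y z / m \<le> 2 + dist y v / m" by simp
          moreover have "0 \<le> dist y v / m" using m by simp
          ultimately show ?thesis unfolding distrib_left by linarith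
        qed
        then have "(2 * (1 + dist y v / m)) powr (- \<beta>) \<le> (\<kappa> z) powr s"
          unfolding kappa_s using m beta(2) by (intro powr_mono2') (auto simp: add_pos_nonneg)
        then have "2 powr \<beta> * (2 * (1 + dist y v / m)) powr (- \<beta>) \<le> 2 powr \<beta> * (\<kappa> z) powr s"
          by (rule mult_left_mono) simp
        also have "2 powr \<beta> * (2 * (1 + dist y v / m)) powr (- \<beta>) = (\<kappa> v) powr s"
          unfolding kappa_s using m by (intro powr_neg_double[symmetric]) (simp add: add_pos_nonneg)
        finally have "(\<kappa> v) powr s \<le> 2 powr \<beta> * (\<kappa> z) powr s" .
        then have "ennreal ((\<kappa> v) powr s) * ennreal (norm (F v) powr s) \<le> ennreal (2 powr \<beta> * (\<kappa> z) powr s) * h z"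
          using True by (intro mult_mono ennreal_leI Fh) (auto simp: dist_commute)
        then show ?thesis using True kappa0[of v] by (simp add: powr_mult ennreal_mult mult.assoc)
      qed simp
      then have "(\<integral>\<^sup>+z\<in>ball v m. ennreal ((\<kappa> v * norm (F v)) powr s) \<partial>lebesgue)
          \<le> (\<integral>\<^sup>+z. ennreal (2 powr \<beta>) * (ennreal ((\<kappa> z) powr s) * h z) \<partial>lebesgue)"
        by (rule nn_integral_mono)
      also have "\<dots> = ennreal (2 powr \<beta>) * (\<integral>\<^sup>+z. ennreal ((\<kappa> z) powr s) * h z \<partial>lebesgue)"
        by (rule nn_integral_cmult) measurable
      also have "\<dots> \<le> ennreal (2 powr \<beta>) * ennreal (D1 * m ^ CARD('n) * M)"
        by (rule mult_left_mono[OF X]) simp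
      also have "(\<integral>\<^sup>+z\<in>ball v m. ennreal ((\<kappa> v * norm (F v)) powr s) \<partial>lebesgue) =
          ennreal ((\<kappa> v * norm (F v)) powr s) * emeasure lborel (ball v m)"
        by (subst nn_integral_cmult_indicator) auto
      also have "\<dots> = ennreal ((\<kappa> v * norm (F v)) powr s * (V * m ^ CARD('n)))"
        using m by (simp add: emeasure_ball V_def ennreal_mult)
      finally have "(\<kappa> v * norm (F v)) powr s * (V * m ^ CARD('n)) \<le> 2 powr \<beta> * (D1 * m ^ CARD('n) * M)"
        using D1 m M(2) by (simp add: ennreal_mult[symmetric] del: ennreal_mult)
      then have "(\<kappa> v * norm (F v)) powr s * V \<le> 2 powr \<beta> * (D1 * M)"
        using m by (simp add: field_simps)
      then show ?thesis using V by (simp add: D2_def field_simps)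
    qed
    have pt: "\<kappa> v * norm (F v) \<le> D2 powr (1 / s) * M powr (1 / s)" for v
    proof -
      have "\<kappa> v * norm (F v) = ((\<kappa> v * norm (F v)) powr s) powr (1 / s)"
        using s kappa0[of v] by (simp add: powr_powr)
      also have "\<dots> \<le> (D2 * M) powr (1 / s)" using s sup[of v] by (intro powr_mono2) auto
      finally show ?thesis using D2 M(2) by (simp add: powr_mult)
    qed
    have 1: "ennreal (\<kappa> v * norm (F v)) \<le> ennreal D * ennreal_powr (maximal_fun h x) (1 / s)" for v
    proof -
      have "\<kappa> v * norm (F v) \<le> D * M powr (1 / s)"
        using pt[of v] mult_right_mono[OF D(2), of "M powr (1 / s)"] by simp
      then show ?thesis using D(1) M by (simp add: ennreal_mult[symmetric])
    qed
    have "(\<integral>\<^sup>+v. ennreal (\<kappa> v * norm (F v)) \<partial>lebesgue) \<le> (\<integral>\<^sup>+v. ennreal ((D2 * M) powr ((1 - s) / s)) * (ennreal ((\<kappa> v) powr s) * h v) \<partial>lebesgue)"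
    proof (rule nn_integral_mono)
      fix v
      have "\<kappa> v * norm (F v) = (\<kappa> v * norm (F v)) powr ((1 - s) + s)" using kappa0[of v] by simp
      also have "\<dots> = (\<kappa> v * norm (F v)) powr (1 - s) * (\<kappa> v * norm (F v)) powr s" by (rule powr_add)
      also have "(\<kappa> v * norm (F v)) powr (1 - s) = ((\<kappa> v * norm (F v)) powr s) powr ((1 - s) / s)"
        using s by (simp add: powr_powr)
      also have "\<dots> * (\<kappa> v * norm (F v)) powr s \<le> (D2 * M) powr ((1 - s) / s) * (\<kappa> v * norm (F v)) powr s"
        using s sup[of v] by (intro mult_right_mono powr_mono2) auto
      finally have "ennreal (\<kappa> v * norm (F v)) \<le> ennreal ((D2 * M) powr ((1 - s) / s) * ((\<kappa> v) powr s * norm (F v) powr s))"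
        using kappa0[of v] by (simp add: powr_mult ennreal_leI)
      also have "\<dots> = ennreal ((D2 * M) powr ((1 - s) / s)) * (ennreal ((\<kappa> v) powr s) * ennreal (norm (F v) powr s))"
        by (simp add: ennreal_mult)
      also have "\<dots> \<le> ennreal ((D2 * M) powr ((1 - s) / s)) * (ennreal ((\<kappa> v) powr s) * h v)"
        using m by (intro mult_left_mono Fh) auto
      finally show "ennreal (\<kappa> v * norm (F v)) \<le> ennreal ((D2 * M) powr ((1 - s) / s)) * (ennreal ((\<kappa> v) powr s) * h v)" .
    qed
    also have "\<dots> = ennreal ((D2 * M) powr ((1 - s) / s)) * (\<integral>\<^sup>+v. ennreal ((\<kappa> v) powr s) * h v \<partial>lebesgue)"
      by (rule nn_integral_cmult) measurable
    also have "\<dots> \<le> ennreal ((D2 * M) powr ((1 - s) / s)) * ennreal (D1 * m ^ CARD('n) * M)"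
      by (rule mult_left_mono[OF X]) simp
    also have "\<dots> = ennreal ((D2 * M) powr ((1 - s) / s) * (D1 * m ^ CARD('n) * M))"
      using D1 m M(2) by (simp add: ennreal_mult)
    also have "(D2 * M) powr ((1 - s) / s) * (D1 * m ^ CARD('n) * M) = D1 * D2 powr ((1 - s) / s) * (m ^ CARD('n) * M powr (1 / s))"
    proof -
      have "1 / s = (1 - s) / s + 1" using s by (simp add: field_simps)
      then have "M powr (1 / s) = M powr ((1 - s) / s) * M" using M(2) by (simp only: powr_add) simp
      then show ?thesis using D2 M(2) by (simp add: powr_mult)
    qed
    also have "ennreal \<dots> \<le> ennreal (D * (m ^ CARD('n) * M powr (1 / s)))"
      using m by (intro ennreal_leI mult_right_mono D) auto
    also have "\<dots> = ennreal (D * m ^ CARD('n)) * ennreal_powr (maximal_fun h x) (1 / s)"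
      using D(1) M m by (simp add: ennreal_mult[symmetric] mult.assoc)
    finally show ?thesis using 1 unfolding \<kappa>_def h_def by blast
  qed
  with D(1) show ?thesis by blast
qed

section \<open>Schwartz functions and convolution\<close>

lemma has_derivative_partial_deriv:
  fixes f :: "real ^ 'n::finite \<Rightarrow> complex"
  assumes "(f has_derivative f') (at x)"
  shows "partial_deriv i f x = f' (axis i 1)"
  using frechet_derivative_at[OF assms] by (simp add: partial_deriv_def)

lemma differentiable_has_derivative_partial:
  fixes f :: "real ^ 'n::finite \<Rightarrow> complex"
  assumes "f differentiable (at x)"
  shows "(f has_derivative (\<lambda>h. \<Sum>i\<in>UNIV. h $ i *\<^sub>R partial_deriv i f x)) (at x)"
proof -
  let ?f' = "frechet_derivative f (at x)"
  have d: "(f has_derivative ?f') (at x)" using assms by (simp add: frechet_derivative_works)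
  then interpret bounded_linear ?f' by (rule has_derivative_bounded_linear)
  have "?f' h = (\<Sum>i\<in>UNIV. h $ i *\<^sub>R partial_deriv i f x)" for h
  proof -
    have "?f' h = ?f' (\<Sum>i\<in>UNIV. h $ i *\<^sub>R axis i 1)" using basis_expansion[of h] by (simp add: scalar_mult_eq_scaleR)
    also have "\<dots> = (\<Sum>i\<in>UNIV. h $ i *\<^sub>R partial_deriv i f x)"
      by (simp add: sum scale partial_deriv_def)
    finally show ?thesis .
  qed
  then have "?f' = (\<lambda>h. \<Sum>i\<in>UNIV. h $ i *\<^sub>R partial_deriv i f x)" by (rule ext)
  with d show ?thesis by (simp only:)
qed

lemma iter_deriv_append: "iter_deriv (js @ is) f = iter_deriv js (iter_deriv is f)"
  by (induction js) simp_all

lemma smoothD: "smooth f \<Longrightarrow> iter_deriv is f differentiable (at x)"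
  by (simp add: smooth_def)

lemma smooth_iter_deriv: "smooth f \<Longrightarrow> smooth (iter_deriv is f)"
  by (simp add: smooth_def iter_deriv_append[symmetric])

lemma iter_deriv_affine:
  fixes f :: "real ^ 'n::finite \<Rightarrow> complex" and c :: real
  assumes "smooth f"
  shows "iter_deriv is (\<lambda>z. f (a + c *\<^sub>R z)) = (\<lambda>z. of_real (c ^ length is) * iter_deriv is f (a + c *\<^sub>R z))"
proof (induction "is")
  case (Cons i "is")
  let ?G = "iter_deriv is f"
  have "partial_deriv i (\<lambda>z. of_real (c ^ length is) * ?G (a + c *\<^sub>R z)) z =
      of_real (c ^ Suc (length is)) * partial_deriv i ?G (a + c *\<^sub>R z)" for z
  proof -
    have "?G differentiable (at (a + c *\<^sub>R z))" by (rule smoothD[OF assms])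
    then have d: "(?G has_derivative frechet_derivative ?G (at (a + c *\<^sub>R z))) (at (a + c *\<^sub>R z))"
      by (simp add: frechet_derivative_works)
    then interpret bounded_linear "frechet_derivative ?G (at (a + c *\<^sub>R z))"
      by (rule has_derivative_bounded_linear)
    have "((\<lambda>z. a + c *\<^sub>R z) has_derivative (\<lambda>h. c *\<^sub>R h)) (at z)"
      by (auto intro!: derivative_eq_intros)
    from has_derivative_compose[OF this d]
    have "((\<lambda>z. of_real (c ^ length is) * ?G (a + c *\<^sub>R z)) has_derivative
       (\<lambda>h. of_real (c ^ length is) * frechet_derivative ?G (at (a + c *\<^sub>R z)) (c *\<^sub>R h))) (at z)"
      by (rule has_derivative_mult_right)
    then have "partial_deriv i (\<lambda>z. of_real (c ^ length is) * ?G (a + c *\<^sub>R z)) z =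
       of_real (c ^ length is) * frechet_derivative ?G (at (a + c *\<^sub>R z)) (c *\<^sub>R axis i 1)"
      by (rule has_derivative_partial_deriv)
    then show ?thesis unfolding scale partial_deriv_def by (simp add: scaleR_conv_of_real)
  qed
  then show ?case unfolding iter_deriv.simps Cons.IH by (intro ext) simp
qed simp

lemma smooth_affine:
  fixes f :: "real ^ 'n::finite \<Rightarrow> complex" and c :: real
  assumes "smooth f"
  shows "smooth (\<lambda>z. f (a + c *\<^sub>R z))"
  unfolding smooth_def iter_deriv_affine[OF assms]
proof (intro allI)
  fix "is" x
  have "iter_deriv is f differentiable (at (a + c *\<^sub>R x))" by (rule smoothD[OF assms])
  moreover have "(\<lambda>z. a + c *\<^sub>R z) differentiable (at x)" by simp
  ultimately have "(\<lambda>z. iter_deriv is f (a + c *\<^sub>R z)) differentiable (at x)"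
    using differentiable_chain_at[of "\<lambda>z. a + c *\<^sub>R z" x "iter_deriv is f"] by (simp add: o_def)
  then show "(\<lambda>z. of_real (c ^ length is) * iter_deriv is f (a + c *\<^sub>R z)) differentiable (at x)"
    by (intro differentiable_mult) auto
qed

lemma iter_deriv_linear:
  fixes f g :: "real ^ 'n::finite \<Rightarrow> complex"
  assumes f: "smooth f" and g: "smooth g"
  shows "iter_deriv is (\<lambda>x. a * f x + b * g x) = (\<lambda>x. a * iter_deriv is f x + b * iter_deriv is g x)"
proof (induction "is")
  case (Cons i "is")
  have "partial_deriv i (\<lambda>x. a * iter_deriv is f x + b * iter_deriv is g x) x =
     a * partial_deriv i (iter_deriv is f) x + b * partial_deriv i (iter_deriv is g) x" for x
  proof -
    have "((\<lambda>x. a * iter_deriv is f x + b * iter_deriv is g x) has_derivative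
       (\<lambda>h. a * frechet_derivative (iter_deriv is f) (at x) h + b * frechet_derivative (iter_deriv is g) (at x) h)) (at x)"
      using smoothD[OF f] smoothD[OF g]
      by (intro has_derivative_add has_derivative_mult_right) (auto simp: frechet_derivative_works[symmetric])
    from has_derivative_partial_deriv[OF this] show ?thesis by (simp add: partial_deriv_def)
  qed
  then show ?case unfolding iter_deriv.simps Cons.IH by (rule ext)
qed simp

lemma smooth_linear:
  fixes f g :: "real ^ 'n::finite \<Rightarrow> complex"
  assumes "smooth f" "smooth g"
  shows "smooth (\<lambda>x. a * f x + b * g x)"
  unfolding smooth_def iter_deriv_linear[OF assms]
  using smoothD[OF assms(1)] smoothD[OF assms(2)] by (intro allI differentiable_add differentiable_mult) auto

lemma schwartz_smooth: "\<phi> \<in> schwartz \<Longrightarrow> smooth \<phi>"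
  by (simp add: schwartz_def)

lemma schwartz_bound:
  assumes "\<phi> \<in> schwartz"
  obtains B where "B \<ge> 0" "\<And>x. (1 + norm x) ^ k * norm (iter_deriv is \<phi> x) \<le> B"
proof -
  obtain B where B: "\<And>x. (1 + norm x) ^ k * norm (iter_deriv is \<phi> x) \<le> B"
    using assms unfolding schwartz_def by blast
  have "0 \<le> (1 + norm (0::real ^ 'a)) ^ k * norm (iter_deriv is \<phi> 0)" by simp
  also have "\<dots> \<le> B" by (rule B)
  finally show ?thesis using B that by blast
qed

lemma finite_lists_le: "finite {is :: 'n::finite list. length is \<le> k}"
  using finite_lists_length_le[of "UNIV :: 'n set" k] by simp

lemma schwartz_bound_uniform:
  fixes \<phi> :: "real ^ 'n::finite \<Rightarrow> complex"
  assumes "\<phi> \<in> schwartz"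
  obtains B where "B \<ge> 0" "\<And>is x. length is \<le> m \<Longrightarrow> (1 + norm x) ^ k * norm (iter_deriv is \<phi> x) \<le> B"
proof -
  have "\<exists>B\<ge>0. \<forall>x. (1 + norm x) ^ k * norm (iter_deriv is \<phi> x) \<le> B" for "is"
    using schwartz_bound[OF assms] by metis
  then obtain B where B: "\<And>is. B is \<ge> 0" "\<And>is x. (1 + norm x) ^ k * norm (iter_deriv is \<phi> x) \<le> B is"
    by metis
  let ?S = "\<Sum>is | length is \<le> m. B is"
  have "B is \<le> ?S" if "length is \<le> m" for "is"
    using that B(1) finite_lists_le[where 'n='n, of m] by (intro member_le_sum) auto
  then have "(1 + norm x) ^ k * norm (iter_deriv is \<phi> x) \<le> ?S" if "length is \<le> m" for "is" x
    using B(2) that by (meson order_trans)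
  moreover have "?S \<ge> 0" using B(1) by (intro sum_nonneg) auto
  ultimately show ?thesis using that by blast
qed

text \<open>\<open>schwartz_norm\<close> is a real supremum, so membership bounds nothing until the
  set is known to be bounded above. Only finitely many derivative lists of length at most k occur,
  and each has its own bound.\<close>

lemma schwartz_norm_upper:
  fixes \<phi> :: "real ^ 'n::finite \<Rightarrow> complex"
  assumes "\<phi> \<in> schwartz" "length is \<le> k"
  shows "(1 + norm x) ^ k * norm (iter_deriv is \<phi> x) \<le> schwartz_norm k \<phi>"
proof -
  obtain B where "\<And>is x. length is \<le> k \<Longrightarrow> (1 + norm x) ^ k * norm (iter_deriv is \<phi> x) \<le> B"
    using schwartz_bound_uniform[OF assms(1)] by blast
  then have "bdd_above ((\<lambda>(is, x). (1 + norm x) ^ k * norm (iter_deriv is \<phi> x)) ` ({is. length is \<le> k} \<times> UNIV))"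
    by (intro bdd_aboveI2[of _ _ B]) auto
  then show ?thesis unfolding schwartz_norm_def
    by (rule cSUP_upper2[where x = "(is, x)"]) (use assms(2) in auto)
qed

lemma schwartz_norm_le:
  fixes \<phi> :: "real ^ 'n::finite \<Rightarrow> complex"
  assumes "\<And>is x. length is \<le> k \<Longrightarrow> (1 + norm x) ^ k * norm (iter_deriv is \<phi> x) \<le> B"
  shows "schwartz_norm k \<phi> \<le> B"
  unfolding schwartz_norm_def by (rule cSUP_least) (use assms in \<open>auto intro!: exI[of _ "[]"]\<close>)

lemma schwartz_affine:
  fixes \<phi> :: "real ^ 'n::finite \<Rightarrow> complex"
  assumes "\<phi> \<in> schwartz" "c \<noteq> 0"
  shows "(\<lambda>z. \<phi> (a + c *\<^sub>R z)) \<in> schwartz"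
  unfolding schwartz_def
proof (intro CollectI conjI allI)
  show "smooth (\<lambda>z. \<phi> (a + c *\<^sub>R z))" by (intro smooth_affine schwartz_smooth assms)
  fix k "is"
  obtain B where B: "B \<ge> 0" "\<And>x. (1 + norm x) ^ k * norm (iter_deriv is \<phi> x) \<le> B"
    using schwartz_bound[OF assms(1)] by blast
  define K where "K = 1 + (norm a + 1) / \<bar>c\<bar>"
  have K: "1 + norm z \<le> K * (1 + norm (a + c *\<^sub>R z))" for z
  proof -
    have "\<bar>c\<bar> * norm z \<le> norm (a + c *\<^sub>R z) + norm a"
      using norm_triangle_ineq4[of "a + c *\<^sub>R z" a] by simp
    then have "norm z \<le> (norm (a + c *\<^sub>R z) + norm a) / \<bar>c\<bar>" using assms(2) by (simp add: field_simps)
    also have "\<dots> \<le> (norm a + 1) * (1 + norm (a + c *\<^sub>R z)) / \<bar>c\<bar>"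
      by (intro divide_right_mono) (auto simp: algebra_simps)
    finally have "norm z \<le> (norm a + 1) / \<bar>c\<bar> * (1 + norm (a + c *\<^sub>R z))" by simp
    then show ?thesis by (simp add: K_def distrib_right add_mono)
  qed
  have "K \<ge> 0" by (simp add: K_def add_nonneg_nonneg)
  have "(1 + norm z) ^ k * norm (iter_deriv is (\<lambda>z. \<phi> (a + c *\<^sub>R z)) z) \<le> K ^ k * \<bar>c\<bar> ^ length is * B" for z
  proof -
    have "(1 + norm z) ^ k * norm (iter_deriv is (\<lambda>z. \<phi> (a + c *\<^sub>R z)) z)
      = (1 + norm z) ^ k * (\<bar>c\<bar> ^ length is * norm (iter_deriv is \<phi> (a + c *\<^sub>R z)))"
      by (simp add: iter_deriv_affine[OF schwartz_smooth[OF assms(1)]] norm_mult norm_power)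
    also have "\<dots> \<le> (K * (1 + norm (a + c *\<^sub>R z))) ^ k * (\<bar>c\<bar> ^ length is * norm (iter_deriv is \<phi> (a + c *\<^sub>R z)))"
      by (intro mult_right_mono power_mono K) auto
    also have "\<dots> = K ^ k * \<bar>c\<bar> ^ length is * ((1 + norm (a + c *\<^sub>R z)) ^ k * norm (iter_deriv is \<phi> (a + c *\<^sub>R z)))"
      by (simp add: power_mult_distrib mult_ac)
    also have "\<dots> \<le> K ^ k * \<bar>c\<bar> ^ length is * B"
      using \<open>K \<ge> 0\<close> by (intro mult_left_mono B) auto
    finally show ?thesis .
  qed
  then show "\<exists>B. \<forall>x. (1 + norm x) ^ k * norm (iter_deriv is (\<lambda>z. \<phi> (a + c *\<^sub>R z)) x) \<le> B" by blast
qed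

lemma schwartz_linear:
  fixes \<phi> \<psi> :: "real ^ 'n::finite \<Rightarrow> complex"
  assumes "\<phi> \<in> schwartz" "\<psi> \<in> schwartz"
  shows "(\<lambda>x. a * \<phi> x + b * \<psi> x) \<in> schwartz"
  unfolding schwartz_def
proof (intro CollectI conjI allI)
  show "smooth (\<lambda>x. a * \<phi> x + b * \<psi> x)" by (intro smooth_linear schwartz_smooth assms)
  fix k "is"
  obtain B where B: "\<And>x. (1 + norm x) ^ k * norm (iter_deriv is \<phi> x) \<le> B"
    using schwartz_bound[OF assms(1)] by blast
  obtain B' where B': "\<And>x. (1 + norm x) ^ k * norm (iter_deriv is \<psi> x) \<le> B'"
    using schwartz_bound[OF assms(2)] by blast
  have "(1 + norm x) ^ k * norm (iter_deriv is (\<lambda>x. a * \<phi> x + b * \<psi> x) x) \<le> norm a * B + norm b * B'" for x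
  proof -
    have "(1 + norm x) ^ k * norm (iter_deriv is (\<lambda>x. a * \<phi> x + b * \<psi> x) x)
       \<le> (1 + norm x) ^ k * (norm a * norm (iter_deriv is \<phi> x) + norm b * norm (iter_deriv is \<psi> x))"
      unfolding iter_deriv_linear[OF schwartz_smooth[OF assms(1)] schwartz_smooth[OF assms(2)]]
      by (intro mult_left_mono order_trans[OF norm_triangle_ineq]) (auto simp: norm_mult)
    also have "\<dots> = norm a * ((1 + norm x) ^ k * norm (iter_deriv is \<phi> x)) + norm b * ((1 + norm x) ^ k * norm (iter_deriv is \<psi> x))"
      by (simp add: algebra_simps)
    also have "\<dots> \<le> norm a * B + norm b * B'" by (intro add_mono mult_left_mono B B') auto
    finally show ?thesis .
  qed
  then show "\<exists>B. \<forall>x. (1 + norm x) ^ k * norm (iter_deriv is (\<lambda>x. a * \<phi> x + b * \<psi> x) x) \<le> B" by blast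
qed

lemma schwartz_cmult: "\<phi> \<in> schwartz \<Longrightarrow> (\<lambda>x. a * \<phi> x) \<in> schwartz"
  using schwartz_linear[of \<phi> \<phi> a 0] by simp

lemma iter_deriv_cmult: "smooth \<phi> \<Longrightarrow> iter_deriv is (\<lambda>x. a * \<phi> x) = (\<lambda>x. a * iter_deriv is \<phi> x)"
  using iter_deriv_linear[of \<phi> \<phi> "is" a 0] by simp

lemma schwartz_iter_deriv: "\<phi> \<in> schwartz \<Longrightarrow> iter_deriv is \<phi> \<in> schwartz"
  unfolding schwartz_def by (auto simp: smooth_iter_deriv iter_deriv_append[symmetric])

lemma schwartz_partial_deriv: "\<phi> \<in> schwartz \<Longrightarrow> partial_deriv i \<phi> \<in> schwartz"
  using schwartz_iter_deriv[of \<phi> "[i]"] by simp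

lemma schwartz_has_derivative:
  assumes "\<phi> \<in> schwartz"
  shows "(\<phi> has_derivative (\<lambda>h. \<Sum>i\<in>UNIV. h $ i *\<^sub>R partial_deriv i \<phi> x)) (at x)"
  using smoothD[OF schwartz_smooth[OF assms], of "[]"] by (intro differentiable_has_derivative_partial) simp

lemma schwartz_continuous:
  assumes "\<phi> \<in> schwartz"
  shows "continuous_on UNIV \<phi>"
  using schwartz_has_derivative[OF assms]
  by (intro continuous_at_imp_continuous_on ballI) (rule has_derivative_continuous)

lemma schwartz_measurable: "\<phi> \<in> schwartz \<Longrightarrow> \<phi> \<in> borel_measurable borel"
  by (intro borel_measurable_continuous_onI schwartz_continuous)

lemma norm_sum_partial_le:
  fixes h :: "real ^ 'n::finite" and D :: "'n \<Rightarrow> complex"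
  assumes "\<And>i. norm (D i) \<le> B"
  shows "norm (\<Sum>i\<in>UNIV. h $ i *\<^sub>R D i) \<le> real CARD('n) * B * norm h"
proof -
  have "norm (\<Sum>i\<in>UNIV. h $ i *\<^sub>R D i) \<le> (\<Sum>i\<in>(UNIV::'n set). norm h * B)"
    by (rule sum_norm_le) (auto intro!: mult_mono assms component_le_norm_cart)
  then show ?thesis by (simp add: mult_ac)
qed

text \<open>Mean value inequality on the unit ball about u. The weight can stay at u because it is
  comparable, within a factor 2 in the base, to the weight at every point of that ball.\<close>

lemma schwartz_lipschitz:
  fixes \<phi> :: "real ^ 'n::finite \<Rightarrow> complex"
  assumes "\<phi> \<in> schwartz"
  obtains B where "B \<ge> 0" "\<And>u v. norm (u - v) \<le> 1 \<Longrightarrow> (1 + norm u) ^ k * norm (\<phi> u - \<phi> v) \<le> B * norm (u - v)"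
proof -
  obtain B where B: "B \<ge> 0" "\<And>is x. length is \<le> 1 \<Longrightarrow> (1 + norm x) ^ k * norm (iter_deriv is \<phi> x) \<le> B"
    using schwartz_bound_uniform[OF assms] by blast
  have "(1 + norm u) ^ k * norm (\<phi> u - \<phi> v) \<le> real CARD('n) * 2 ^ k * B * norm (u - v)" if uv: "norm (u - v) \<le> 1" for u v
  proof -
    have "norm (\<phi> u - \<phi> v) \<le> (real CARD('n) * (2 ^ k * B / (1 + norm u) ^ k)) * norm (u - v)"
    proof (rule differentiable_bound[where S = "cball u 1" and f' = "\<lambda>x h. \<Sum>i\<in>UNIV. h $ i *\<^sub>R partial_deriv i \<phi> x"])
      show "(\<phi> has_derivative (\<lambda>h. \<Sum>i\<in>UNIV. h $ i *\<^sub>R partial_deriv i \<phi> x)) (at x within cball u 1)" for x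
        by (rule has_derivative_at_withinI[OF schwartz_has_derivative[OF assms]])
      fix x assume x: "x \<in> cball u 1"
      show "onorm (\<lambda>h. \<Sum>i\<in>UNIV. h $ i *\<^sub>R partial_deriv i \<phi> x) \<le> real CARD('n) * (2 ^ k * B / (1 + norm u) ^ k)"
      proof (rule onorm_bound)
        have "1 + norm u \<le> 2 * (1 + norm x)"
        proof -
          have "norm u \<le> norm x + 1" using x norm_triangle_ineq2[of u x] by (simp add: dist_norm)
          then show ?thesis using norm_ge_zero[of x] unfolding distrib_left by linarith
        qed
        then have "(1 + norm u) ^ k \<le> 2 ^ k * (1 + norm x) ^ k"
          by (subst power_mult_distrib[symmetric]) (intro power_mono, auto)
        then have "(1 + norm u) ^ k * norm (partial_deriv i \<phi> x) \<le> 2 ^ k * (1 + norm x) ^ k * norm (partial_deriv i \<phi> x)" for i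
          by (rule mult_right_mono) simp
        also have "2 ^ k * (1 + norm x) ^ k * norm (partial_deriv i \<phi> x) \<le> 2 ^ k * B" for i
          using B(2)[of "[i]" x] by (simp add: mult.assoc)
        finally have "norm (partial_deriv i \<phi> x) \<le> 2 ^ k * B / (1 + norm u) ^ k" for i
          by (simp add: field_simps add_pos_nonneg)
        then show "norm (\<Sum>i\<in>UNIV. h $ i *\<^sub>R partial_deriv i \<phi> x) \<le> real CARD('n) * (2 ^ k * B / (1 + norm u) ^ k) * norm h" for h
          by (rule norm_sum_partial_le)
      qed (use B(1) in simp)
    qed (use uv in \<open>auto simp: dist_norm\<close>)
    then have "(1 + norm u) ^ k * norm (\<phi> u - \<phi> v) \<le> (1 + norm u) ^ k * ((real CARD('n) * (2 ^ k * B / (1 + norm u) ^ k)) * norm (u - v))"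
      by (rule mult_left_mono) simp
    also have "\<dots> = real CARD('n) * 2 ^ k * B * norm (u - v)"
    proof -
      have "w * ((a * (b * B / w)) * d) = a * b * B * d" if "w > 0" for w a b d :: real
        using that by simp
      moreover have "(1 + norm u) ^ k > 0" by (simp add: add_pos_nonneg)
      ultimately show ?thesis by blast
    qed
    finally show ?thesis .
  qed
  then show ?thesis using B(1) by (intro that[of "real CARD('n) * 2 ^ k * B"]) auto
qed

text \<open>Mean value inequality for \<phi> minus its linear part at x, whose derivative is small
  since the partial derivatives are Lipschitz. The remainder is uniform in x, as differentiation of
  a convolution requires.\<close>

lemma schwartz_taylor:
  fixes \<phi> :: "real ^ 'n::finite \<Rightarrow> complex"
  assumes "\<phi> \<in> schwartz"
  obtains B where "B \<ge> 0"
    "\<And>x h. norm h \<le> 1 \<Longrightarrow> norm (\<phi> (x + h) - \<phi> x - (\<Sum>i\<in>UNIV. h $ i *\<^sub>R partial_deriv i \<phi> x)) \<le> B * (norm h)\<^sup>2"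
proof -
  have "\<exists>B\<ge>0. \<forall>u v. norm (u - v) \<le> 1 \<longrightarrow> norm (partial_deriv i \<phi> u - partial_deriv i \<phi> v) \<le> B * norm (u - v)" for i
    using schwartz_lipschitz[OF schwartz_partial_deriv[OF assms, of i], of 0] by (metis mult_1 power_0)
  then obtain Bi where Bi: "\<And>i. Bi i \<ge> 0" "\<And>i u v. norm (u - v) \<le> 1 \<Longrightarrow> norm (partial_deriv i \<phi> u - partial_deriv i \<phi> v) \<le> Bi i * norm (u - v)"
    by metis
  define B where "B = (\<Sum>i\<in>UNIV. Bi i)"
  have B: "B \<ge> 0" "Bi i \<le> B" for i using Bi(1) by (auto simp: B_def intro: sum_nonneg member_le_sum)
  have "norm (\<phi> (x + h) - \<phi> x - (\<Sum>i\<in>UNIV. h $ i *\<^sub>R partial_deriv i \<phi> x)) \<le> real CARD('n) * B * (norm h)\<^sup>2"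
    if h: "norm h \<le> 1" for x h
  proof -
    define g where "g y = \<phi> y - (\<Sum>i\<in>UNIV. y $ i *\<^sub>R partial_deriv i \<phi> x)" for y
    have "norm (g (x + h) - g x) \<le> (real CARD('n) * (B * norm h)) * norm (x + h - x)"
    proof (rule differentiable_bound[where S = "cball x (norm h)" and f' = "\<lambda>y k. \<Sum>i\<in>UNIV. k $ i *\<^sub>R (partial_deriv i \<phi> y - partial_deriv i \<phi> x)"])
      fix y assume y: "y \<in> cball x (norm h)"
      have "((\<lambda>y. \<Sum>i\<in>UNIV. y $ i *\<^sub>R partial_deriv i \<phi> x) has_derivative (\<lambda>k. \<Sum>i\<in>UNIV. k $ i *\<^sub>R partial_deriv i \<phi> x)) (at y)"
        by (intro has_derivative_sum has_derivative_scaleR_left bounded_linear_imp_has_derivative bounded_linear_vec_nth)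
      from has_derivative_diff[OF schwartz_has_derivative[OF assms, of y] this]
      have "(g has_derivative (\<lambda>k. \<Sum>i\<in>UNIV. k $ i *\<^sub>R (partial_deriv i \<phi> y - partial_deriv i \<phi> x))) (at y)"
        unfolding g_def[abs_def] by (simp add: scaleR_diff_right sum_subtractf)
      then show "(g has_derivative (\<lambda>k. \<Sum>i\<in>UNIV. k $ i *\<^sub>R (partial_deriv i \<phi> y - partial_deriv i \<phi> x))) (at y within cball x (norm h))"
        by (rule has_derivative_at_withinI)
      have yx: "norm (y - x) \<le> norm h" using y by (simp add: dist_norm norm_minus_commute)
      have "norm (partial_deriv i \<phi> y - partial_deriv i \<phi> x) \<le> B * norm h" for i
      proof -
        have "norm (partial_deriv i \<phi> y - partial_deriv i \<phi> x) \<le> Bi i * norm (y - x)" using yx h by (intro Bi(2)) simp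
        also have "\<dots> \<le> B * norm h" using B Bi(1) yx by (intro mult_mono) auto
        finally show ?thesis .
      qed
      then show "onorm (\<lambda>k. \<Sum>i\<in>UNIV. k $ i *\<^sub>R (partial_deriv i \<phi> y - partial_deriv i \<phi> x)) \<le> real CARD('n) * (B * norm h)"
        using B by (intro onorm_bound norm_sum_partial_le) auto
    qed (auto simp: dist_norm)
    moreover have "g (x + h) - g x = \<phi> (x + h) - \<phi> x - (\<Sum>i\<in>UNIV. h $ i *\<^sub>R partial_deriv i \<phi> x)"
      by (simp add: g_def scaleR_add_left sum.distrib)
    ultimately show ?thesis by (simp add: power2_eq_square mult_ac)
  qed
  then show ?thesis using B(1) by (intro that[of "real CARD('n) * B"]) auto
qed

section \<open>Moments, rapid decay and convolutions\<close>

text \<open>The maximal estimate for kernels, applied to the constant 1 at scale 1: the maximal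
  function of a constant is finite.\<close>

lemma integrable_japanese_bracket:
  assumes "\<beta> > real CARD('n::finite)"
  shows "integrable lborel (\<lambda>x :: real ^ 'n. (1 + norm x) powr (- \<beta>))"
proof (rule integrableI_bounded)
  have "(\<integral>\<^sup>+v. ennreal ((1 + dist (0 :: real ^ 'n) v / 1) powr (- \<beta>)) * 1 \<partial>lebesgue)
     \<le> ennreal (2 powr \<beta> / (1 - 2 powr (real CARD('n) - \<beta>)) * 1 ^ CARD('n)) * maximal_fun (\<lambda>_. 1) (0 :: real ^ 'n)"
    by (rule nn_integral_kernel_le_maximal_fun[OF assms]) auto
  also have "\<dots> \<le> ennreal (2 powr \<beta> / (1 - 2 powr (real CARD('n) - \<beta>)) * 1 ^ CARD('n)) * ennreal (unit_ball_vol (real CARD('n)) * 1)"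
    by (intro mult_left_mono maximal_fun_const_le) auto
  also have "\<dots> < top" by (simp add: ennreal_mult_less_top)
  finally have *: "(\<integral>\<^sup>+v. ennreal ((1 + dist (0 :: real ^ 'n) v / 1) powr (- \<beta>)) * 1 \<partial>lebesgue) < top" .
  have "(\<integral>\<^sup>+v. ennreal (norm ((1 + norm (v :: real ^ 'n)) powr (- \<beta>))) \<partial>lebesgue) < top"
    using * by simp
  then show "(\<integral>\<^sup>+v. ennreal (norm ((1 + norm (v :: real ^ 'n)) powr (- \<beta>))) \<partial>lborel) < \<infinity>"
    by (subst (asm) nn_integral_completion) simp
qed measurable

text \<open>The exponent n + 1 is the smallest integer for which the integral converges, and it
  matches the n + 1 extra weight powers in \<open>test_class\<close>. The type argument fixes the
  dimension.\<close>

definition bracket_mass :: "'n::finite itself \<Rightarrow> real" where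
  "bracket_mass _ = (LINT x|lborel. (1 + norm (x :: real ^ 'n)) powr (- (real CARD('n) + 1)))"

lemma one_plus_norm_pos [simp]: "1 + norm x > 0" "1 + norm x \<noteq> 0" "0 \<le> 1 + norm x"
  using norm_ge_zero[of x] by (auto simp: add_pos_nonneg simp del: norm_ge_zero)

text \<open>Of the available weight powers, n + 1 are spent on integrability, and k remain in the
  integral.\<close>

lemma weighted_integral_le:
  fixes b :: "real ^ 'n::finite \<Rightarrow> complex"
  assumes [measurable]: "b \<in> borel_measurable borel"
    and B: "\<And>x. (1 + norm x) ^ (k + CARD('n) + 1) * norm (b x) \<le> B"
  shows "integrable lborel (\<lambda>x. (1 + norm x) ^ k * norm (b x))"
    and "(LINT x|lborel. (1 + norm x) ^ k * norm (b x)) \<le> B * bracket_mass TYPE('n)"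
proof -
  let ?g = "\<lambda>x :: real ^ 'n. B * (1 + norm x) powr (- (real CARD('n) + 1))"
  have int: "integrable lborel ?g" by (intro integrable_mult_right integrable_japanese_bracket) simp
  have le: "(1 + norm x) ^ k * norm (b x) \<le> ?g x" for x
  proof -
    have "(1 + norm x) ^ (k + CARD('n) + 1) = (1 + norm x) ^ k * (1 + norm x) powr (real CARD('n) + 1)"
      by (simp add: power_add powr_add powr_realpow)
    then have "(1 + norm x) ^ k * norm (b x) * (1 + norm x) powr (real CARD('n) + 1) \<le> B"
      using B[of x] by (simp add: mult_ac)
    moreover have "(1 + norm x) powr (real CARD('n) + 1) > 0" by simp
    ultimately show ?thesis
      unfolding powr_minus[of _ "real CARD('n) + 1"] divide_inverse[symmetric] by (subst pos_le_divide_eq)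
  qed
  show i: "integrable lborel (\<lambda>x. (1 + norm x) ^ k * norm (b x))"
  proof (rule Bochner_Integration.integrable_bound[OF int])
    have "norm ((1 + norm x) ^ k * norm (b x)) \<le> norm (?g x)" for x
      using order_trans[OF le abs_ge_self, of x] by simp
    then show "AE x in lborel. norm ((1 + norm x) ^ k * norm (b x)) \<le> norm (?g x)" by simp
  qed measurable
  have "(LINT x|lborel. (1 + norm x) ^ k * norm (b x)) \<le> (LINT x|lborel. ?g x)"
    by (rule integral_mono[OF i int le])
  then show "(LINT x|lborel. (1 + norm x) ^ k * norm (b x)) \<le> B * bracket_mass TYPE('n)"
    by (simp add: bracket_mass_def)
qed

text \<open>No smoothness is asked for: this class, unlike the Schwartz class, is closed under
  multiplication by indicators, so that a convolution can be cut into pieces over Borel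
  sets.\<close>

definition rapid :: "(real ^ 'n::finite \<Rightarrow> complex) \<Rightarrow> bool" where
  "rapid b \<longleftrightarrow> b \<in> borel_measurable borel \<and> (\<forall>k. integrable lborel (\<lambda>y. (1 + norm y) ^ k * norm (b y)))"

lemma rapid_measurable: "rapid b \<Longrightarrow> b \<in> borel_measurable borel"
  and rapid_moment: "rapid b \<Longrightarrow> integrable lborel (\<lambda>y. (1 + norm y) ^ k * norm (b y))"
  by (simp_all add: rapid_def)

lemma rapid_integrable: "rapid b \<Longrightarrow> integrable lborel b"
  using rapid_moment[of b 0] rapid_measurable[of b] by (simp add: integrable_norm_iff)

lemma schwartz_rapid:
  fixes \<phi> :: "real ^ 'n::finite \<Rightarrow> complex"
  assumes "\<phi> \<in> schwartz"
  shows "rapid \<phi>"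
  unfolding rapid_def
proof (intro conjI allI)
  show m: "\<phi> \<in> borel_measurable borel" by (rule schwartz_measurable[OF assms])
  fix k
  obtain B where "\<And>x. (1 + norm x) ^ (k + CARD('n) + 1) * norm (iter_deriv [] \<phi> x) \<le> B"
    using schwartz_bound[OF assms] by blast
  then show "integrable lborel (\<lambda>y. (1 + norm y) ^ k * norm (\<phi> y))"
    by (intro weighted_integral_le(1)[OF m]) simp
qed

lemma rapid_restrict:
  assumes b: "rapid b" and [measurable]: "S \<in> sets borel"
  shows "rapid (\<lambda>y. indicator S y * b y)"
proof -
  have [measurable]: "b \<in> borel_measurable borel" by (rule rapid_measurable[OF b])
  show ?thesis unfolding rapid_def
  proof (intro conjI allI)
    fix k
    show "integrable lborel (\<lambda>y. (1 + norm y) ^ k * norm (indicator S y * b y))"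
      by (rule Bochner_Integration.integrable_bound[OF rapid_moment[OF b, of k]]) (auto simp: indicator_def)
  qed measurable
qed

definition convolution :: "(real ^ 'n::finite \<Rightarrow> complex) \<Rightarrow> (real ^ 'n \<Rightarrow> complex) \<Rightarrow> real ^ 'n \<Rightarrow> complex" where
  "convolution a b x = (LINT y|lborel. a (x - y) * b y)"

text \<open>Holds for all functions, since reflection preserves the integral together with its
  default value 0.\<close>

lemma convolution_commute: "convolution a b = convolution b a"
proof
  fix x
  show "convolution a b x = convolution b a x"
    unfolding convolution_def
    by (subst integral_lborel_reflect[of _ x, symmetric]) (simp add: mult.commute)
qed

lemma convolution_integrable:
  fixes a b :: "real ^ 'n::finite \<Rightarrow> complex"
  assumes [measurable]: "a \<in> borel_measurable borel" and a: "\<And>x. norm (a x) \<le> A"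
    and b: "integrable lborel b"
  shows "integrable lborel (\<lambda>y. a (x - y) * b y)"
proof (rule Bochner_Integration.integrable_bound)
  show "integrable lborel (\<lambda>y. A *\<^sub>R b y)" using b by simp
  have [measurable]: "b \<in> borel_measurable borel" using b by auto
  show "(\<lambda>y. a (x - y) * b y) \<in> borel_measurable lborel" by measurable
  have "norm (a (x - y) * b y) \<le> norm (A *\<^sub>R b y)" for y
  proof -
    have "norm (a (x - y)) \<le> \<bar>A\<bar>" using a[of "x - y"] by linarith
    then show ?thesis by (simp add: norm_mult mult_right_mono)
  qed
  then show "AE y in lborel. norm (a (x - y) * b y) \<le> norm (A *\<^sub>R b y)" by simp
qed

lemma schwartz_bounded:
  assumes "a \<in> schwartz"
  obtains A where "A \<ge> 0" "\<And>x. norm (a x) \<le> A"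
  using schwartz_bound[OF assms, of 0 "[]"] by auto

lemma schwartz_convolution_integrable:
  assumes "a \<in> schwartz" "integrable lborel b"
  shows "integrable lborel (\<lambda>y. a (x - y) * b y)"
proof -
  obtain A where "\<And>x. norm (a x) \<le> A" using schwartz_bounded[OF assms(1)] by blast
  then show ?thesis using assms by (intro convolution_integrable schwartz_measurable)
qed

lemma has_derivative_quadratic:
  fixes f :: "'a::real_normed_vector \<Rightarrow> 'b::real_normed_vector"
  assumes D: "bounded_linear D" and C: "C \<ge> 0"
    and le: "\<And>h. norm h \<le> 1 \<Longrightarrow> norm (f (x + h) - f x - D h) \<le> C * (norm h)\<^sup>2"
  shows "(f has_derivative D) (at x)"
  unfolding has_derivative_at_alt
proof (intro conjI D allI impI)
  fix e :: real assume e: "e > 0"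
  define d where "d = min 1 (e / (C + 1))"
  have d: "d > 0" using e C by (simp add: d_def)
  have "norm (f y - f x - D (y - x)) \<le> e * norm (y - x)" if y: "norm (y - x) < d" for y
  proof -
    have "norm (f (x + (y - x)) - f x - D (y - x)) \<le> C * (norm (y - x))\<^sup>2"
      using y by (intro le) (simp add: d_def)
    also have "\<dots> = (C * norm (y - x)) * norm (y - x)" by (simp add: power2_eq_square)
    also have "\<dots> \<le> e * norm (y - x)"
    proof (rule mult_right_mono)
      have "C * norm (y - x) \<le> (C + 1) * (e / (C + 1))"
        using y C by (intro mult_mono) (auto simp: d_def)
      also have "\<dots> = e" using C by simp
      finally show "C * norm (y - x) \<le> e" .
    qed simp
    finally show ?thesis by simp
  qed
  with d show "\<exists>d>0. \<forall>y. norm (y - x) < d \<longrightarrow> norm (f y - f x - D (y - x)) \<le> e * norm (y - x)" by blast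
qed

text \<open>The uniform quadratic remainder of a is integrated against |b|, so mere integrability of
  b is enough to differentiate.\<close>

lemma convolution_has_derivative:
  fixes a b :: "real ^ 'n::finite \<Rightarrow> complex"
  assumes a: "a \<in> schwartz" and b: "integrable lborel b"
  shows "(convolution a b has_derivative (\<lambda>h. \<Sum>i\<in>UNIV. h $ i *\<^sub>R convolution (partial_deriv i a) b x)) (at x)"
proof -
  obtain B where B: "B \<ge> 0"
    "\<And>x h. norm h \<le> 1 \<Longrightarrow> norm (a (x + h) - a x - (\<Sum>i\<in>UNIV. h $ i *\<^sub>R partial_deriv i a x)) \<le> B * (norm h)\<^sup>2"
    using schwartz_taylor[OF a] by blast
  have bn: "integrable lborel (\<lambda>y. norm (b y))" using b by simp
  show ?thesis
  proof (rule has_derivative_quadratic[where C = "B * (LINT y|lborel. norm (b y))"])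
    show "bounded_linear (\<lambda>h. \<Sum>i\<in>UNIV. h $ i *\<^sub>R convolution (partial_deriv i a) b x)"
      by (intro bounded_linear_sum bounded_linear_scaleR_left[THEN bounded_linear_compose] bounded_linear_vec_nth)
    show "B * (LINT y|lborel. norm (b y)) \<ge> 0" using B(1) by (intro mult_nonneg_nonneg integral_nonneg_AE) auto
    fix h :: "real ^ 'n" assume h: "norm h \<le> 1"
    let ?R = "\<lambda>y. (a (x - y + h) - a (x - y) - (\<Sum>i\<in>UNIV. h $ i *\<^sub>R partial_deriv i a (x - y))) * b y"
    have i1: "integrable lborel (\<lambda>y. a (x + h - y) * b y)" "integrable lborel (\<lambda>y. a (x - y) * b y)"
       "integrable lborel (\<lambda>y. partial_deriv i a (x - y) * b y)" for i
      using a b by (auto intro!: schwartz_convolution_integrable schwartz_partial_deriv)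
    have i2: "integrable lborel (\<lambda>y. \<Sum>i\<in>UNIV. h $ i *\<^sub>R (partial_deriv i a (x - y) * b y))"
      by (intro Bochner_Integration.integrable_sum integrable_scaleR_right i1)
    have R: "?R = (\<lambda>y. a (x + h - y) * b y - a (x - y) * b y - (\<Sum>i\<in>UNIV. h $ i *\<^sub>R (partial_deriv i a (x - y) * b y)))"
      by (intro ext) (simp add: algebra_simps sum_distrib_left sum_distrib_right)
    have "convolution a b (x + h) - convolution a b x - (\<Sum>i\<in>UNIV. h $ i *\<^sub>R convolution (partial_deriv i a) b x)
       = (LINT y|lborel. ?R y)"
      unfolding R using i1 i2
      by (simp add: convolution_def Bochner_Integration.integral_diff Bochner_Integration.integral_sum
           Bochner_Integration.integrable_diff integral_scaleR_right)
    also have "norm \<dots> \<le> (LINT y|lborel. B * (norm h)\<^sup>2 * norm (b y))"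
    proof (rule Bochner_Integration.integral_norm_bound_integral)
      show "integrable lborel ?R" unfolding R using i1 i2 by (intro Bochner_Integration.integrable_diff)
      show "integrable lborel (\<lambda>y. B * (norm h)\<^sup>2 * norm (b y))" using bn by simp
      show "norm (?R y) \<le> B * (norm h)\<^sup>2 * norm (b y)" for y
        using B(2)[OF h, of "x - y"] by (simp only: norm_mult) (intro mult_right_mono, auto)
    qed
    finally show "norm (convolution a b (x + h) - convolution a b x - (\<Sum>i\<in>UNIV. h $ i *\<^sub>R convolution (partial_deriv i a) b x))
       \<le> B * (LINT y|lborel. norm (b y)) * (norm h)\<^sup>2"
      by (simp add: mult_ac)
  qed
qed

lemma iter_deriv_convolution:
  assumes a: "a \<in> schwartz" and b: "integrable lborel b"
  shows "iter_deriv is (convolution a b) = convolution (iter_deriv is a) b"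
proof (induction "is")
  case (Cons i "is")
  have "partial_deriv i (convolution (iter_deriv is a) b) x = convolution (partial_deriv i (iter_deriv is a)) b x" for x
    using has_derivative_partial_deriv[OF convolution_has_derivative[OF schwartz_iter_deriv[OF a] b], where i = i]
    by (simp add: axis_def if_distrib[of "\<lambda>r. r *\<^sub>R _"] cong: if_cong)
  then show ?case unfolding iter_deriv.simps Cons.IH by (rule ext)
qed simp

text \<open>The weight at x is distributed over \<open>x - y\<close> and y by submultiplicativity,
  so decay of a and a moment of b of the same order suffice.\<close>

lemma norm_convolution_le:
  fixes a b :: "real ^ 'n::finite \<Rightarrow> complex"
  assumes A: "\<And>x. (1 + norm x) ^ k * norm (a x) \<le> A" and [measurable]: "a \<in> borel_measurable borel"
    and [measurable]: "b \<in> borel_measurable borel"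
    and b: "integrable lborel (\<lambda>y. (1 + norm y) ^ k * norm (b y))"
  shows "(1 + norm x) ^ k * norm (convolution a b x) \<le> A * (LINT y|lborel. (1 + norm y) ^ k * norm (b y))"
proof -
  have nx: "norm (1 + complex_of_real (norm x)) = 1 + norm x"
    by (metis norm_of_real of_real_1 of_real_add abs_of_nonneg one_plus_norm_pos(3))
  have "norm (complex_of_real ((1 + norm x) ^ k) * convolution a b x) =
     norm (LINT y|lborel. complex_of_real ((1 + norm x) ^ k) * (a (x - y) * b y))"
    by (simp add: convolution_def)
  also have "\<dots> \<le> (LINT y|lborel. A * ((1 + norm y) ^ k * norm (b y)))"
  proof (rule Bochner_Integration.integral_norm_bound_integral)
    show i: "integrable lborel (\<lambda>y. A * ((1 + norm y) ^ k * norm (b y)))" using b by simp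
    show le: "norm (complex_of_real ((1 + norm x) ^ k) * (a (x - y) * b y)) \<le> A * ((1 + norm y) ^ k * norm (b y))" for y
    proof -
      have "1 + norm x \<le> (1 + norm (x - y)) * (1 + norm y)"
        using norm_triangle_ineq[of "x - y" y] by (intro one_plus_le_mult) auto
      then have "(1 + norm x) ^ k \<le> (1 + norm (x - y)) ^ k * (1 + norm y) ^ k"
        by (subst power_mult_distrib[symmetric]) (intro power_mono, auto)
      then have "(1 + norm x) ^ k * (norm (a (x - y)) * norm (b y)) \<le> (1 + norm (x - y)) ^ k * (1 + norm y) ^ k * (norm (a (x - y)) * norm (b y))"
        by (rule mult_right_mono) simp
      also have "\<dots> = ((1 + norm (x - y)) ^ k * norm (a (x - y))) * ((1 + norm y) ^ k * norm (b y))" by simp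
      also have "\<dots> \<le> A * ((1 + norm y) ^ k * norm (b y))" by (intro mult_right_mono A) simp
      finally have "(1 + norm x) ^ k * (norm (a (x - y)) * norm (b y)) \<le> A * ((1 + norm y) ^ k * norm (b y))" .
      then show ?thesis using nx by (simp add: norm_mult norm_power)
    qed
    have "AE y in lborel. norm (complex_of_real ((1 + norm x) ^ k) * (a (x - y) * b y)) \<le> norm (A * ((1 + norm y) ^ k * norm (b y)))"
      using le by (intro AE_I2) (metis abs_ge_self order_trans real_norm_def)
    then show "integrable lborel (\<lambda>y. complex_of_real ((1 + norm x) ^ k) * (a (x - y) * b y))"
      by (intro Bochner_Integration.integrable_bound[OF i]) measurable
  qed
  finally show ?thesis using nx by (simp add: norm_mult norm_power)
qed

lemma convolution_schwartz_bound:
  assumes a: "a \<in> schwartz" and b: "rapid b" and A: "\<And>x. (1 + norm x) ^ k * norm (iter_deriv is a x) \<le> A"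
  shows "(1 + norm x) ^ k * norm (iter_deriv is (convolution a b) x) \<le> A * (LINT y|lborel. (1 + norm y) ^ k * norm (b y))"
  unfolding iter_deriv_convolution[OF a rapid_integrable[OF b]]
  by (intro norm_convolution_le A schwartz_measurable schwartz_iter_deriv a rapid_measurable b rapid_moment)

lemma convolution_schwartz:
  assumes a: "a \<in> schwartz" and b: "rapid b"
  shows "convolution a b \<in> schwartz"
  unfolding schwartz_def
proof (intro CollectI conjI allI)
  show "smooth (convolution a b)"
    unfolding smooth_def iter_deriv_convolution[OF a rapid_integrable[OF b]]
    using convolution_has_derivative[OF schwartz_iter_deriv[OF a] rapid_integrable[OF b]]
    by (auto simp: differentiable_def)
  fix k "is"
  obtain A where "\<And>x. (1 + norm x) ^ k * norm (iter_deriv is a x) \<le> A"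
    using schwartz_bound[OF a] by blast
  from convolution_schwartz_bound[OF a b this]
  show "\<exists>B. \<forall>x. (1 + norm x) ^ k * norm (iter_deriv is (convolution a b) x) \<le> B" by blast
qed

lemma schwartz_norm_convolution_le:
  assumes a: "a \<in> schwartz" and b: "rapid b"
  shows "schwartz_norm k (convolution a b) \<le> schwartz_norm k a * (LINT y|lborel. (1 + norm y) ^ k * norm (b y))"
  by (rule schwartz_norm_le) (intro convolution_schwartz_bound[OF a b] schwartz_norm_upper[OF a])

section \<open>Tempered distributions\<close>

lemma tempered_distributions_linear:
  assumes "f \<in> tempered_distributions" "\<phi> \<in> schwartz" "\<psi> \<in> schwartz"
  shows "f (\<lambda>x. a * \<phi> x + b * \<psi> x) = a * f \<phi> + b * f \<psi>"
  using assms by (simp add: tempered_distributions_def)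

lemma schwartz_norm_nonneg: "\<phi> \<in> schwartz \<Longrightarrow> 0 \<le> schwartz_norm k \<phi>"
  by (rule order_trans[OF _ schwartz_norm_upper[of \<phi> "[]" k 0]]) auto

lemma tempered_distributions_bound:
  assumes "f \<in> tempered_distributions"
  obtains C k where "C \<ge> 0" "\<And>\<phi>. \<phi> \<in> schwartz \<Longrightarrow> norm (f \<phi>) \<le> C * schwartz_norm k \<phi>"
proof -
  obtain C k where C: "\<And>\<phi>. \<phi> \<in> schwartz \<Longrightarrow> norm (f \<phi>) \<le> C * schwartz_norm k \<phi>"
    using assms unfolding tempered_distributions_def by blast
  have "norm (f \<phi>) \<le> max 0 C * schwartz_norm k \<phi>" if "\<phi> \<in> schwartz" for \<phi>
    using C[OF that] mult_right_mono[of C "max 0 C" "schwartz_norm k \<phi>"] schwartz_norm_nonneg[OF that]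
    by (meson max.cobounded2 order_trans)
  then show ?thesis using that[of "max 0 C" k] by simp
qed

lemma schwartz_shift: "a \<in> schwartz \<Longrightarrow> (\<lambda>z. a (z - u)) \<in> schwartz"
  using schwartz_affine[of a 1 "- u"] by simp

lemma schwartz_reflect: "a \<in> schwartz \<Longrightarrow> (\<lambda>z. a (y - z)) \<in> schwartz"
  using schwartz_affine[of a "-1" y] by simp

lemma iter_deriv_shift: "a \<in> schwartz \<Longrightarrow> iter_deriv is (\<lambda>z. a (z - u)) = (\<lambda>z. iter_deriv is a (z - u))"
  using iter_deriv_affine[OF schwartz_smooth, of a "is" "- u" 1] by simp

lemma one_plus_norm_power_le: "(1 + norm z) ^ k \<le> (1 + norm (z - u)) ^ k * (1 + norm u) ^ k"
proof -
  have "1 + norm z \<le> (1 + norm (z - u)) * (1 + norm u)"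
    using norm_triangle_ineq[of "z - u" u] by (intro one_plus_le_mult) auto
  then show ?thesis by (subst power_mult_distrib[symmetric]) (intro power_mono, auto)
qed

lemma schwartz_lipschitz_uniform:
  fixes a :: "real ^ 'n::finite \<Rightarrow> complex"
  assumes a: "a \<in> schwartz"
  obtains B where "B \<ge> 0" "\<And>is p q. length is \<le> m \<Longrightarrow> norm (p - q) \<le> 1 \<Longrightarrow>
     (1 + norm p) ^ k * norm (iter_deriv is a p - iter_deriv is a q) \<le> B * norm (p - q)"
proof -
  have "\<exists>B\<ge>0. \<forall>p q. norm (p - q) \<le> 1 \<longrightarrow> (1 + norm p) ^ k * norm (iter_deriv is a p - iter_deriv is a q) \<le> B * norm (p - q)" for "is"
    using schwartz_lipschitz[OF schwartz_iter_deriv[OF a, of "is"], of k] by metis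
  then obtain B where B: "\<And>is. B is \<ge> 0" "\<And>is p q. norm (p - q) \<le> 1 \<Longrightarrow>
     (1 + norm p) ^ k * norm (iter_deriv is a p - iter_deriv is a q) \<le> B is * norm (p - q)" by metis
  let ?S = "\<Sum>is | length is \<le> m. B is"
  have "B is \<le> ?S" if "length is \<le> m" for "is"
    using that B(1) finite_lists_le[where 'n='n, of m] by (intro member_le_sum) auto
  then have "(1 + norm p) ^ k * norm (iter_deriv is a p - iter_deriv is a q) \<le> ?S * norm (p - q)"
    if "length is \<le> m" "norm (p - q) \<le> 1" for "is" p q
    using B(2) that by (meson mult_right_mono norm_ge_zero order_trans)
  moreover have "?S \<ge> 0" using B(1) by (intro sum_nonneg) auto
  ultimately show ?thesis using that by blast
qed

lemma schwartz_norm_shift_le: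
  assumes a: "a \<in> schwartz"
  shows "schwartz_norm k (\<lambda>z. a (z - u)) \<le> schwartz_norm k a * (1 + norm u) ^ k"
proof (rule schwartz_norm_le)
  fix "is" :: "'a list" and z
  assume l: "length is \<le> k"
  have "(1 + norm z) ^ k * norm (iter_deriv is (\<lambda>z. a (z - u)) z) \<le> (1 + norm (z - u)) ^ k * (1 + norm u) ^ k * norm (iter_deriv is a (z - u))"
    unfolding iter_deriv_shift[OF a] by (rule mult_right_mono[OF one_plus_norm_power_le]) simp
  also have "\<dots> = ((1 + norm (z - u)) ^ k * norm (iter_deriv is a (z - u))) * (1 + norm u) ^ k" by simp
  also have "\<dots> \<le> schwartz_norm k a * (1 + norm u) ^ k"
    by (intro mult_right_mono schwartz_norm_upper[OF a l]) simp
  finally show "(1 + norm z) ^ k * norm (iter_deriv is (\<lambda>z. a (z - u)) z) \<le> schwartz_norm k a * (1 + norm u) ^ k" .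
qed

text \<open>The seminorm of a difference of two shifts is of the order of their distance, with the
  weight \<open>(1 + norm u) ^ k\<close> for moving the origin to u. The constants are taken as
  parameters because the quantitative bound is reused with them when a distribution is exchanged
  with an integral.\<close>

lemma tempered_shift_continuous:
  fixes a :: "real ^ 'n::finite \<Rightarrow> complex"
  assumes f: "f \<in> tempered_distributions" and a: "a \<in> schwartz"
    and C: "C \<ge> 0" "\<And>\<phi>. \<phi> \<in> schwartz \<Longrightarrow> norm (f \<phi>) \<le> C * schwartz_norm k \<phi>"
    and B: "\<And>is p q. length is \<le> k \<Longrightarrow> norm (p - q) \<le> 1 \<Longrightarrow>
     (1 + norm p) ^ k * norm (iter_deriv is a p - iter_deriv is a q) \<le> B * norm (p - q)"
  shows "norm (u - v) \<le> 1 \<Longrightarrow> norm (f (\<lambda>z. a (z - u)) - f (\<lambda>z. a (z - v))) \<le> C * (B * norm (u - v) * (1 + norm u) ^ k)"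
    and "continuous_on UNIV (\<lambda>u. f (\<lambda>z. a (z - u)))"
proof -
  have le: "norm (f (\<lambda>z. a (z - u)) - f (\<lambda>z. a (z - v))) \<le> C * (B * norm (u - v) * (1 + norm u) ^ k)"
    if uv: "norm (u - v) \<le> 1" for u v
  proof -
    let ?d = "\<lambda>z. 1 * a (z - u) + (- 1) * a (z - v)"
    have d: "?d \<in> schwartz" using a by (intro schwartz_linear schwartz_shift)
    have "f (\<lambda>z. a (z - u)) - f (\<lambda>z. a (z - v)) = f ?d"
      by (subst tempered_distributions_linear[OF f]) (auto intro: schwartz_shift a)
    also have "norm \<dots> \<le> C * schwartz_norm k ?d" by (rule C(2)[OF d])
    also have "\<dots> \<le> C * (B * norm (u - v) * (1 + norm u) ^ k)"
    proof (intro mult_left_mono[OF _ C(1)] schwartz_norm_le)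
      fix "is" :: "'n list" and z assume l: "length is \<le> k"
      have "iter_deriv is ?d z = iter_deriv is a (z - u) - iter_deriv is a (z - v)"
        using a by (subst iter_deriv_linear) (auto intro: schwartz_smooth schwartz_shift simp: iter_deriv_shift)
      then have "(1 + norm z) ^ k * norm (iter_deriv is ?d z) = (1 + norm z) ^ k * norm (iter_deriv is a (z - u) - iter_deriv is a (z - v))"
        by simp
      also have "\<dots> \<le> (1 + norm (z - u)) ^ k * (1 + norm u) ^ k * norm (iter_deriv is a (z - u) - iter_deriv is a (z - v))"
        by (rule mult_right_mono[OF one_plus_norm_power_le]) simp
      also have "\<dots> = ((1 + norm (z - u)) ^ k * norm (iter_deriv is a (z - u) - iter_deriv is a (z - v))) * (1 + norm u) ^ k"
        by simp
      also have "\<dots> \<le> B * norm (u - v) * (1 + norm u) ^ k"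
        using B[OF l, of "z - u" "z - v"] uv by (intro mult_right_mono) (auto simp: norm_minus_commute)
      finally show "(1 + norm z) ^ k * norm (iter_deriv is ?d z) \<le> B * norm (u - v) * (1 + norm u) ^ k" .
    qed
    finally show ?thesis .
  qed
  show "norm (u - v) \<le> 1 \<Longrightarrow> norm (f (\<lambda>z. a (z - u)) - f (\<lambda>z. a (z - v))) \<le> C * (B * norm (u - v) * (1 + norm u) ^ k)"
    by (rule le)
  show "continuous_on UNIV (\<lambda>u. f (\<lambda>z. a (z - u)))"
  proof (intro continuous_at_imp_continuous_on ballI)
    fix u
    have ev: "\<forall>\<^sub>F v in at u. norm (f (\<lambda>z. a (z - v)) - f (\<lambda>z. a (z - u))) \<le> C * (B * norm (u - v) * (1 + norm u) ^ k)"
      unfolding eventually_at using le[of u] by (intro exI[of _ 1]) (auto simp: dist_norm norm_minus_commute)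
    have "((\<lambda>v. C * (B * norm (u - v) * (1 + norm u) ^ k)) \<longlongrightarrow> C * (B * norm (u - u) * (1 + norm u) ^ k)) (at u)"
      by (intro tendsto_intros)
    then have "((\<lambda>v. C * (B * norm (u - v) * (1 + norm u) ^ k)) \<longlongrightarrow> 0) (at u)" by simp
    from Lim_null_comparison[OF ev this]
    show "isCont (\<lambda>u. f (\<lambda>z. a (z - u))) u" by (simp add: isCont_def Lim_null[symmetric])
  qed
qed

text \<open>
  The defect of the interchange over a Borel set \<open>S\<close> is additive in \<open>S\<close>. On a ball of radius \<open>\<epsilon>\<close> it is
  \<open>O(\<epsilon>)\<close> times the mass of \<open>S\<close>, hence it vanishes on compact sets, and its tail is
  small.
\<close>

lemma tempered_convolution:
  fixes a b :: "real ^ 'n::finite \<Rightarrow> complex"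
  assumes f: "f \<in> tempered_distributions" and a: "a \<in> schwartz" and b: "rapid b"
  shows "f (convolution a b) = (LINT u|lborel. f (\<lambda>z. a (z - u)) * b u)"
proof -
  obtain C k where C: "C \<ge> 0" "\<And>\<phi>. \<phi> \<in> schwartz \<Longrightarrow> norm (f \<phi>) \<le> C * schwartz_norm k \<phi>"
    using tempered_distributions_bound[OF f] by blast
  obtain B0 where B0: "B0 \<ge> 0" "\<And>is p q. length is \<le> k \<Longrightarrow> norm (p - q) \<le> 1 \<Longrightarrow>
     (1 + norm p) ^ k * norm (iter_deriv is a p - iter_deriv is a q) \<le> B0 * norm (p - q)"
    using schwartz_lipschitz_uniform[OF a, of k k] by blast
  define H where "H u = f (\<lambda>z. a (z - u))" for u
  \<comment> \<open>A single constant for both the Lipschitz bound and the size of a, so that all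
    later estimates have the same form.\<close>
  define B where "B = max B0 (schwartz_norm k a)"
  have B: "B \<ge> 0" "schwartz_norm k a \<le> B" using B0(1) by (auto simp: B_def)
  have B1: "(1 + norm p) ^ k * norm (iter_deriv is a p - iter_deriv is a q) \<le> B * norm (p - q)"
    if "length is \<le> k" "norm (p - q) \<le> 1" for "is" p q
    using B0(2)[OF that] mult_right_mono[of B0 B "norm (p - q)"] by (simp add: B_def)
  have [measurable]: "H \<in> borel_measurable borel"
    unfolding H_def[abs_def] by (intro borel_measurable_continuous_onI tempered_shift_continuous(2)[OF f a C B1])
  have [measurable]: "b \<in> borel_measurable borel" by (rule rapid_measurable[OF b])
  have H_lip: "norm (H u - H v) \<le> C * (B * norm (u - v) * (1 + norm u) ^ k)" if "norm (u - v) \<le> 1" for u v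
    unfolding H_def using tempered_shift_continuous(1)[OF f a C B1 that] .
  have H_le: "norm (H u) \<le> C * B * (1 + norm u) ^ k" for u
  proof -
    have "norm (H u) \<le> C * schwartz_norm k (\<lambda>z. a (z - u))" unfolding H_def by (rule C(2)[OF schwartz_shift[OF a]])
    also have "\<dots> \<le> C * (B * (1 + norm u) ^ k)"
      using B C(1) by (intro mult_left_mono order_trans[OF schwartz_norm_shift_le[OF a]] mult_right_mono) auto
    finally show ?thesis by (simp add: mult.assoc)
  qed
  define bS where "bS S u = indicator S u * b u" for S u
  define W where "W S = (LINT u|lborel. (1 + norm u) ^ k * norm (bS S u))" for S
  \<comment> \<open>The defect of the interchange when b is restricted to S; the goal is that it
    vanishes for S = UNIV, with \<open>W S\<close> as the mass that controls it.\<close>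
  define E where "E S = f (convolution a (bS S)) - (LINT u|lborel. H u * bS S u)" for S
  have bS_rapid: "rapid (bS S)" if "S \<in> sets borel" for S
    unfolding bS_def[abs_def] by (rule rapid_restrict[OF b that])
  have bS_meas [measurable]: "bS S \<in> borel_measurable borel" if "S \<in> sets borel" for S
    by (rule rapid_measurable[OF bS_rapid[OF that]])
  have bS_int: "integrable lborel (\<lambda>u. (1 + norm u) ^ j * norm (bS S u))" if "S \<in> sets borel" for S j
    by (rule rapid_moment[OF bS_rapid[OF that]])
  have H_int: "integrable lborel (\<lambda>u. H u * bS S u)" if [measurable]: "S \<in> sets borel" for S
  proof (rule Bochner_Integration.integrable_bound)
    show "integrable lborel (\<lambda>u. C * B * ((1 + norm u) ^ k * norm (bS S u)))" using bS_int[OF that] by simp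
    have "norm (H u * bS S u) \<le> norm (C * B * ((1 + norm u) ^ k * norm (bS S u)))" for u
      using mult_right_mono[OF H_le, of "norm (bS S u)" u] C(1) B(1) by (simp add: norm_mult abs_mult)
    then show "AE u in lborel. norm (H u * bS S u) \<le> norm (C * B * ((1 + norm u) ^ k * norm (bS S u)))" by simp
  qed measurable
  have W_nonneg: "W S \<ge> 0" for S unfolding W_def by (rule integral_nonneg_AE) simp
  have E_add: "E (S \<union> T) = E S + E T" and W_add: "W (S \<union> T) = W S + W T"
    if S: "S \<in> sets borel" and T: "T \<in> sets borel" and disj: "S \<inter> T = {}" for S T
  proof -
    have eq: "bS (S \<union> T) u = bS S u + bS T u" and eqn: "norm (bS (S \<union> T) u) = norm (bS S u) + norm (bS T u)" for u
      using disj by (auto simp: bS_def indicator_def)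
    have "convolution a (bS (S \<union> T)) = (\<lambda>x. 1 * convolution a (bS S) x + 1 * convolution a (bS T) x)"
      unfolding convolution_def eq distrib_left
      by (simp add: Bochner_Integration.integral_add schwartz_convolution_integrable[OF a] rapid_integrable bS_rapid S T)
    then have "f (convolution a (bS (S \<union> T))) = f (convolution a (bS S)) + f (convolution a (bS T))"
      using tempered_distributions_linear[OF f convolution_schwartz[OF a bS_rapid[OF S]] convolution_schwartz[OF a bS_rapid[OF T]], of 1 1] by simp
    then show "E (S \<union> T) = E S + E T"
      unfolding E_def eq distrib_left using H_int[OF S] H_int[OF T] by (simp add: Bochner_Integration.integral_add)
    show "W (S \<union> T) = W S + W T"
      unfolding W_def eqn distrib_left using bS_int[OF S] bS_int[OF T] by (simp add: Bochner_Integration.integral_add)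
  qed
  have E_le: "norm (E S) \<le> 2 * C * B * W S" if S: "S \<in> sets borel" for S
  proof -
    have "norm (f (convolution a (bS S))) \<le> C * schwartz_norm k (convolution a (bS S))"
      by (rule C(2)[OF convolution_schwartz[OF a bS_rapid[OF S]]])
    also have "\<dots> \<le> C * (schwartz_norm k a * W S)"
      unfolding W_def by (intro mult_left_mono schwartz_norm_convolution_le[OF a bS_rapid[OF S]] C(1))
    also have "\<dots> \<le> C * (B * W S)" using B C(1) W_nonneg by (intro mult_left_mono mult_right_mono) auto
    finally have 1: "norm (f (convolution a (bS S))) \<le> C * B * W S" by (simp add: mult.assoc)
    have "norm (LINT u|lborel. H u * bS S u) \<le> (LINT u|lborel. C * B * ((1 + norm u) ^ k * norm (bS S u)))"
    proof (rule Bochner_Integration.integral_norm_bound_integral[OF H_int[OF S]])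
      show "integrable lborel (\<lambda>u. C * B * ((1 + norm u) ^ k * norm (bS S u)))" using bS_int[OF S] by simp
      show "norm (H u * bS S u) \<le> C * B * ((1 + norm u) ^ k * norm (bS S u))" for u
        using mult_right_mono[OF H_le, of "norm (bS S u)" u] by (simp add: norm_mult mult.assoc)
    qed
    also have "\<dots> = C * B * W S" by (simp add: W_def)
    finally have 2: "norm (LINT u|lborel. H u * bS S u) \<le> C * B * W S" .
    show ?thesis unfolding E_def using norm_triangle_ineq4[of "f (convolution a (bS S))" "LINT u|lborel. H u * bS S u"] 1 2 by linarith
  qed
  \<comment> \<open>On a small ball both terms of the defect are compared with the same quantity,
    the one obtained by concentrating the whole mass \<open>?c\<close> of the piece at the centre
    p.\<close>
  have E_ball: "norm (E S) \<le> 2 * C * B * \<epsilon> * W S"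
    if S: "S \<in> sets borel" "S \<subseteq> ball p \<epsilon>" and eps: "0 < \<epsilon>" "\<epsilon> \<le> 1" for S p \<epsilon>
  proof -
    let ?c = "LINT u|lborel. bS S u"
    let ?d = "\<lambda>z. 1 * convolution a (bS S) z + (- ?c) * a (z - p)"
    have near: "norm (u - p) \<le> \<epsilon>" "norm (u - p) \<le> 1" if "bS S u \<noteq> 0" for u
      using that S(2) eps by (auto simp: bS_def indicator_def dist_norm norm_minus_commute split: if_splits)
    have bS_i: "integrable lborel (bS S)" by (rule rapid_integrable[OF bS_rapid[OF S(1)]])
    have dS: "?d \<in> schwartz"
      using a S(1) by (intro schwartz_linear convolution_schwartz bS_rapid schwartz_shift)
    have "schwartz_norm k ?d \<le> B * \<epsilon> * W S"
    proof (rule schwartz_norm_le)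
      fix "is" :: "'n list" and z assume l: "length is \<le> k"
      let ?D = "iter_deriv is a"
      have Di: "integrable lborel (\<lambda>u. ?D (z - u) * bS S u)"
        by (intro schwartz_convolution_integrable schwartz_iter_deriv a bS_i)
      have "iter_deriv is ?d z = convolution ?D (bS S) z - ?c * ?D (z - p)"
        using a S(1)
        by (subst iter_deriv_linear) (auto intro!: schwartz_smooth convolution_schwartz bS_rapid schwartz_shift
              simp: iter_deriv_shift iter_deriv_convolution bS_i)
      also have "\<dots> = (LINT u|lborel. (?D (z - u) - ?D (z - p)) * bS S u)"
        unfolding convolution_def left_diff_distrib using Di bS_i by (simp add: Bochner_Integration.integral_diff mult.commute[of ?c])
      finally have "norm (iter_deriv is ?d z) * (1 + norm z) ^ k = norm (LINT u|lborel. (?D (z - u) - ?D (z - p)) * bS S u) * (1 + norm z) ^ k"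
        by simp
      also have "\<dots> \<le> (LINT u|lborel. B * \<epsilon> / (1 + norm z) ^ k * ((1 + norm u) ^ k * norm (bS S u))) * (1 + norm z) ^ k"
      proof (rule mult_right_mono[OF Bochner_Integration.integral_norm_bound_integral])
        show "integrable lborel (\<lambda>u. (?D (z - u) - ?D (z - p)) * bS S u)"
          unfolding left_diff_distrib using Di bS_i by simp
        show "integrable lborel (\<lambda>u. B * \<epsilon> / (1 + norm z) ^ k * ((1 + norm u) ^ k * norm (bS S u)))"
          using bS_int[OF S(1)] by simp
        show "norm ((?D (z - u) - ?D (z - p)) * bS S u) \<le> B * \<epsilon> / (1 + norm z) ^ k * ((1 + norm u) ^ k * norm (bS S u))" for u
        proof (cases "bS S u = 0")
          case False
          have "(1 + norm z) ^ k * norm (?D (z - u) - ?D (z - p)) \<le> ((1 + norm (z - u)) ^ k * (1 + norm u) ^ k) * norm (?D (z - u) - ?D (z - p))"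
            by (rule mult_right_mono[OF one_plus_norm_power_le]) simp
          also have "\<dots> = ((1 + norm (z - u)) ^ k * norm (?D (z - u) - ?D (z - p))) * (1 + norm u) ^ k" by simp
          also have "\<dots> \<le> (B * norm (u - p)) * (1 + norm u) ^ k"
            using B1[OF l, of "z - u" "z - p"] near[OF False] by (intro mult_right_mono) (auto simp: norm_minus_commute)
          also have "\<dots> \<le> (B * \<epsilon>) * (1 + norm u) ^ k"
            using near[OF False] B by (intro mult_right_mono mult_left_mono) auto
          finally have "norm (?D (z - u) - ?D (z - p)) \<le> B * \<epsilon> * (1 + norm u) ^ k / (1 + norm z) ^ k"
            by (subst pos_le_divide_eq) (simp_all add: mult.commute)
          then have "norm (?D (z - u) - ?D (z - p)) * norm (bS S u) \<le> B * \<epsilon> * (1 + norm u) ^ k / (1 + norm z) ^ k * norm (bS S u)"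
            by (rule mult_right_mono) simp
          then show ?thesis by (simp add: norm_mult mult.assoc)
        qed simp
      qed simp
      also have "\<dots> = B * \<epsilon> * W S" by (simp add: W_def)
      finally show "(1 + norm z) ^ k * norm (iter_deriv is ?d z) \<le> B * \<epsilon> * W S" by (simp add: mult.commute)
    qed
    then have "norm (f ?d) \<le> C * (B * \<epsilon> * W S)"
      using C(2)[OF dS] C(1) by (meson mult_left_mono order_trans)
    moreover have "f ?d = f (convolution a (bS S)) - ?c * H p"
      unfolding H_def using a S(1) by (subst tempered_distributions_linear[OF f]) (auto intro!: convolution_schwartz bS_rapid schwartz_shift)
    moreover have "norm ((LINT u|lborel. H u * bS S u) - ?c * H p) \<le> C * (B * \<epsilon> * W S)"
    proof -
      have "(LINT u|lborel. H u * bS S u) - ?c * H p = (LINT u|lborel. (H u - H p) * bS S u)"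
        unfolding left_diff_distrib using H_int[OF S(1)] bS_i by (simp add: Bochner_Integration.integral_diff mult.commute[of ?c])
      also have "norm \<dots> \<le> (LINT u|lborel. C * (B * \<epsilon>) * ((1 + norm u) ^ k * norm (bS S u)))"
      proof (rule Bochner_Integration.integral_norm_bound_integral)
        show "integrable lborel (\<lambda>u. (H u - H p) * bS S u)"
          unfolding left_diff_distrib using H_int[OF S(1)] bS_i by simp
        show "integrable lborel (\<lambda>u. C * (B * \<epsilon>) * ((1 + norm u) ^ k * norm (bS S u)))"
          using bS_int[OF S(1)] by simp
        show "norm ((H u - H p) * bS S u) \<le> C * (B * \<epsilon>) * ((1 + norm u) ^ k * norm (bS S u))" for u
        proof (cases "bS S u = 0")
          case False
          have "norm (H u - H p) \<le> C * (B * norm (u - p) * (1 + norm u) ^ k)" by (rule H_lip[OF near(2)[OF False]])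
          also have "\<dots> \<le> C * (B * \<epsilon> * (1 + norm u) ^ k)"
            using near[OF False] B C(1) by (intro mult_left_mono mult_right_mono) auto
          finally have "norm (H u - H p) * norm (bS S u) \<le> C * (B * \<epsilon> * (1 + norm u) ^ k) * norm (bS S u)"
            by (rule mult_right_mono) simp
          then show ?thesis by (simp add: norm_mult mult.assoc)
        qed simp
      qed
      also have "\<dots> = C * (B * \<epsilon> * W S)" by (simp add: W_def mult.assoc)
      finally show ?thesis .
    qed
    ultimately have "norm (f (convolution a (bS S)) - ?c * H p) + norm ((LINT u|lborel. H u * bS S u) - ?c * H p) \<le> 2 * C * B * \<epsilon> * W S"
      by simp
    then show ?thesis
      unfolding E_def using norm_triangle_ineq4[of "f (convolution a (bS S)) - ?c * H p" "(LINT u|lborel. H u * bS S u) - ?c * H p"] by simp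
  qed
  \<comment> \<open>Balls are peeled off one at a time. Since E and W are additive over disjoint
    pieces, the bound involves the mass of S and not the number of balls.\<close>
  have E_cover: "norm (E S) \<le> 2 * C * B * \<epsilon> * W S"
    if "finite P" "S \<in> sets borel" "S \<subseteq> (\<Union>p\<in>P. ball p \<epsilon>)" "0 < \<epsilon>" "\<epsilon> \<le> 1" for S P \<epsilon>
    using that
  proof (induction P arbitrary: S rule: finite_induct)
    case empty
    then have "S \<subseteq> ball 0 \<epsilon>" by simp
    then show ?case using empty by (intro E_ball) auto
  next
    case (insert p P)
    let ?S = "S \<inter> ball p \<epsilon>" and ?T = "S - ball p \<epsilon>"
    have ST: "S = ?S \<union> ?T" "?S \<inter> ?T = {}" "?S \<in> sets borel" "?T \<in> sets borel" using insert.prems(1) by auto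
    have "norm (E S) \<le> norm (E ?S) + norm (E ?T)"
      using E_add[OF ST(3,4,2)] ST(1) norm_triangle_ineq[of "E ?S" "E ?T"] by simp
    also have "\<dots> \<le> 2 * C * B * \<epsilon> * W ?S + 2 * C * B * \<epsilon> * W ?T"
      using insert.prems ST by (intro add_mono E_ball insert.IH) auto
    also have "\<dots> = 2 * C * B * \<epsilon> * W S"
      using W_add[OF ST(3,4,2)] ST(1) by (simp add: distrib_left)
    finally show ?case .
  qed
  have E_cball: "E (cball 0 M) = 0" for M
  proof -
    have "norm (E (cball 0 M)) \<le> 0 + e" if e: "e > 0" for e
    proof -
      define K where "K = 2 * C * B * W (cball 0 M)"
      have K: "K \<ge> 0" unfolding K_def using C(1) B(1) W_nonneg by simp
      \<comment> \<open>The 1 in the minimum keeps the radius in the range of the Lipschitz bound,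
        and \<open>K + 1\<close> avoids division by 0.\<close>
      define \<epsilon> where "\<epsilon> = min 1 (e / (K + 1))"
      have eps: "0 < \<epsilon>" "\<epsilon> \<le> 1" using e K by (auto simp: \<epsilon>_def)
      have "\<exists>P. finite P \<and> cball (0 :: real ^ 'n) M \<subseteq> (\<Union>p\<in>P. ball p \<epsilon>)"
        by (rule compact_eq_totally_bounded[THEN iffD1, OF compact_cball, THEN conjunct2, rule_format, OF eps(1)])
      then obtain P where P: "finite P" "cball (0 :: real ^ 'n) M \<subseteq> (\<Union>p\<in>P. ball p \<epsilon>)" by (elim exE conjE)
      have "norm (E (cball 0 M)) \<le> 2 * C * B * \<epsilon> * W (cball 0 M)" by (rule E_cover[OF P(1) _ P(2) eps]) simp
      then have "norm (E (cball 0 M)) \<le> K * \<epsilon>" by (simp add: K_def mult_ac)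
      also have "\<dots> \<le> (K + 1) * (e / (K + 1))" using K eps by (intro mult_mono) (auto simp: \<epsilon>_def)
      also have "\<dots> = e" using K by simp
      finally show ?thesis by simp
    qed
    then have "norm (E (cball 0 M)) \<le> 0" by (rule field_le_epsilon)
    then show ?thesis by simp
  qed
  define W1 where "W1 = (LINT u|lborel. (1 + norm u) ^ Suc k * norm (b u))"
  \<comment> \<open>Outside the ball one spare power of \<open>1 + norm u\<close> exceeds M, so the
    tail is at most the next moment divided by M.\<close>
  have W_tail: "W (- cball 0 M) \<le> W1 / M" if M: "M > 0" for M
  proof -
    have "W (- cball 0 M) \<le> (LINT u|lborel. 1 / M * ((1 + norm u) ^ Suc k * norm (b u)))"
      unfolding W_def
    proof (rule integral_mono)
      show "integrable lborel (\<lambda>u. (1 + norm u) ^ k * norm (bS (- cball 0 M) u))" by (rule bS_int) simp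
      show "integrable lborel (\<lambda>u. 1 / M * ((1 + norm u) ^ Suc k * norm (b u)))"
        using rapid_moment[OF b] by (intro integrable_mult_right)
      fix u :: "real ^ 'n"
      show "(1 + norm u) ^ k * norm (bS (- cball 0 M) u) \<le> 1 / M * ((1 + norm u) ^ Suc k * norm (b u))"
      proof (cases "norm u > M")
        case True
        have "M * ((1 + norm u) ^ k * norm (b u)) \<le> (1 + norm u) * ((1 + norm u) ^ k * norm (b u))"
          using True M by (intro mult_right_mono) auto
        then have "(1 + norm u) ^ k * norm (b u) \<le> 1 / M * ((1 + norm u) ^ Suc k * norm (b u))"
          using M by (simp add: field_simps)
        then show ?thesis using True by (simp add: bS_def)
      qed (use M in \<open>simp add: bS_def\<close>)
    qed
    then show ?thesis by (simp add: W1_def)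
  qed
  have W1: "W1 \<ge> 0" unfolding W1_def by (rule integral_nonneg_AE) simp
  have "norm (E UNIV) \<le> 0 + e" if e: "e > 0" for e
  proof -
    define K where "K = 2 * C * B * W1"
    have K: "K \<ge> 0" unfolding K_def using C(1) B(1) W1 by simp
    define M where "M = (K + 1) / e"
    have M: "M > 0" using e K by (simp add: M_def)
    have "E (cball 0 M \<union> - cball 0 M) = E (cball 0 M) + E (- cball 0 M)" by (rule E_add) auto
    then have "E UNIV = E (- cball 0 M)" using E_cball by (simp add: Compl_partition)
    also have "norm \<dots> \<le> 2 * C * B * W (- cball 0 M)" by (rule E_le) simp
    also have "\<dots> \<le> 2 * C * B * (W1 / M)" using C(1) B(1) by (intro mult_left_mono W_tail M) auto
    also have "\<dots> = K / (K + 1) * e" by (simp add: M_def K_def)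
    also have "\<dots> \<le> 1 * e" using K e by (intro mult_right_mono) (auto simp: divide_le_eq_1)
    finally show ?thesis by simp
  qed
  then have "norm (E UNIV) \<le> 0" by (rule field_le_epsilon)
  moreover have "bS UNIV = b" by (simp add: bS_def[abs_def])
  ultimately show ?thesis by (simp add: E_def H_def)
qed

lemma conv_distr_continuous:
  assumes f: "f \<in> tempered_distributions" and \<psi>: "\<psi> \<in> schwartz"
  shows "continuous_on UNIV (conv_distr \<psi> f)"
proof -
  define a where "a t = \<psi> (0 - t)" for t
  have a: "a \<in> schwartz" unfolding a_def[abs_def] by (rule schwartz_reflect[OF \<psi>])
  obtain C k where C: "C \<ge> 0" "\<And>\<phi>. \<phi> \<in> schwartz \<Longrightarrow> norm (f \<phi>) \<le> C * schwartz_norm k \<phi>"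
    using tempered_distributions_bound[OF f] by blast
  obtain B where "B \<ge> 0" and B: "\<And>is p q. length is \<le> k \<Longrightarrow> norm (p - q) \<le> 1 \<Longrightarrow>
     (1 + norm p) ^ k * norm (iter_deriv is a p - iter_deriv is a q) \<le> B * norm (p - q)"
    using schwartz_lipschitz_uniform[OF a, of k k] by blast
  have "continuous_on UNIV (\<lambda>u. f (\<lambda>z. a (z - u)))" by (rule tempered_shift_continuous(2)[OF f a C B])
  then show ?thesis by (simp add: a_def conv_distr_def[abs_def])
qed

text \<open>The exchange of f with an integral, applied to the reflection of \<psi> and to \<phi>
  shifted and reflected at y: the translates of the former, paired with f, are the values of \<psi>
  * f.\<close>

lemma conv_distr_convolution:
  fixes \<phi> \<psi> :: "real ^ 'n::finite \<Rightarrow> complex"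
  assumes f: "f \<in> tempered_distributions" and \<phi>: "\<phi> \<in> schwartz" and \<psi>: "\<psi> \<in> schwartz"
  shows "conv_distr (convolution \<phi> \<psi>) f = convolution \<phi> (conv_distr \<psi> f)"
proof
  fix y
  define a where "a t = \<psi> (0 - t)" for t
  define b where "b u = \<phi> (y - u)" for u
  have a: "a \<in> schwartz" unfolding a_def[abs_def] by (rule schwartz_reflect[OF \<psi>])
  have b: "b \<in> schwartz" unfolding b_def[abs_def] by (rule schwartz_reflect[OF \<phi>])
  have "convolution \<phi> \<psi> (y - z) = convolution a b z" for z
  proof -
    have "convolution \<phi> \<psi> (y - z) = convolution \<psi> \<phi> (y - z)" by (simp add: convolution_commute[of \<phi>])
    also have "\<dots> = (LINT u|lborel. \<psi> (y - z - (y - u)) * \<phi> (y - u))"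
      unfolding convolution_def by (rule integral_lborel_reflect[symmetric])
    also have "\<dots> = convolution a b z" by (simp add: convolution_def a_def b_def)
    finally show ?thesis .
  qed
  then have "conv_distr (convolution \<phi> \<psi>) f y = f (convolution a b)"
    by (simp add: conv_distr_def)
  also have "\<dots> = (LINT u|lborel. f (\<lambda>z. a (z - u)) * b u)"
    by (rule tempered_convolution[OF f a schwartz_rapid[OF b]])
  also have "\<dots> = convolution \<phi> (conv_distr \<psi> f) y"
    by (simp add: convolution_def conv_distr_def a_def b_def mult.commute)
  finally show "conv_distr (convolution \<phi> \<psi>) f y = convolution \<phi> (conv_distr \<psi> f) y" .
qed

section \<open>Test functions at different scales\<close>

lemma dilate_schwartz:
  assumes "\<phi> \<in> schwartz" "t > 0"
  shows "dilate t \<phi> \<in> schwartz"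
proof -
  have "(\<lambda>x. \<phi> (0 + inverse t *\<^sub>R x)) \<in> schwartz" using assms by (intro schwartz_affine) auto
  from schwartz_cmult[OF this, of "1 / of_real (t ^ CARD('a))"] show ?thesis
    by (simp add: dilate_def[abs_def] divide_inverse mult.commute)
qed

lemma dilate_one [simp]: "dilate 1 \<phi> = \<phi>"
  by (simp add: dilate_def fun_eq_iff)

lemma dilate_dilate: "dilate s (dilate t \<phi>) = dilate (s * t) \<phi>"
  by (simp add: dilate_def fun_eq_iff power_mult_distrib mult.commute)

lemma dilate_cmult: "dilate t (\<lambda>x. c * \<phi> x) = (\<lambda>x. c * dilate t \<phi> x)"
  by (simp add: dilate_def fun_eq_iff)

lemma dilate_convolution:
  fixes a b :: "real ^ 'n::finite \<Rightarrow> complex"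
  assumes "t > 0"
  shows "dilate t (convolution a b) = convolution (dilate t a) (dilate t b)"
proof
  fix x
  have "convolution (dilate t a) (dilate t b) x =
     \<bar>t\<bar> ^ CARD('n) *\<^sub>R (LINT y|lborel. dilate t a (x - (0 + t *\<^sub>R y)) * dilate t b (0 + t *\<^sub>R y))"
    unfolding convolution_def using assms by (subst integral_lborel_affine[of t _ 0]) auto
  also have "(\<lambda>y. dilate t a (x - (0 + t *\<^sub>R y)) * dilate t b (0 + t *\<^sub>R y)) =
     (\<lambda>y. a (x /\<^sub>R t - y) * b y / of_real (t ^ CARD('n) * t ^ CARD('n)))"
    using assms by (intro ext) (simp add: dilate_def scaleR_diff_right)
  also have "\<bar>t\<bar> ^ CARD('n) *\<^sub>R (LINT y|lborel. a (x /\<^sub>R t - y) * b y / of_real (t ^ CARD('n) * t ^ CARD('n)))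
     = dilate t (convolution a b) x"
    using assms by (simp add: dilate_def convolution_def scaleR_conv_of_real field_simps)
  finally show "dilate t (convolution a b) x = convolution (dilate t a) (dilate t b) x" by simp
qed

text \<open>After the substitution the dilation survives only in the weight, as
  \<open>1 + t * norm y\<close>, which is smaller when t \<le> 1.\<close>

lemma dilate_moment_le:
  fixes b :: "real ^ 'n::finite \<Rightarrow> complex"
  assumes b: "rapid b" and t: "0 < t" "t \<le> 1"
  shows "(LINT y|lborel. (1 + norm y) ^ k * norm (dilate t b y)) \<le> (LINT y|lborel. (1 + norm y) ^ k * norm (b y))"
proof -
  have [measurable]: "b \<in> borel_measurable borel" by (rule rapid_measurable[OF b])
  have "(LINT y|lborel. (1 + norm y) ^ k * norm (dilate t b y)) =
     \<bar>t\<bar> ^ CARD('n) *\<^sub>R (LINT y|lborel. (1 + norm (0 + t *\<^sub>R y)) ^ k * norm (dilate t b (0 + t *\<^sub>R y)))"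
    using t by (subst integral_lborel_affine[of t _ 0]) auto
  also have "\<dots> = (LINT y|lborel. (1 + t * norm y) ^ k * norm (b y))"
    using t by (simp add: dilate_def norm_divide norm_power)
  also have "\<dots> \<le> (LINT y|lborel. (1 + norm y) ^ k * norm (b y))"
  proof (rule integral_mono)
    have le: "(1 + t * norm y) ^ k * norm (b y) \<le> (1 + norm y) ^ k * norm (b y)" for y
      using t by (intro mult_right_mono power_mono add_left_mono) (auto simp: mult_left_le_one_le)
    then show "(1 + t * norm y) ^ k * norm (b y) \<le> (1 + norm y) ^ k * norm (b y)" for y .
    show i: "integrable lborel (\<lambda>y. (1 + norm y) ^ k * norm (b y))" by (rule rapid_moment[OF b])
    have "norm ((1 + t * norm y) ^ k * norm (b y)) \<le> norm ((1 + norm y) ^ k * norm (b y))" for y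
      using le[of y] t by simp
    then show "integrable lborel (\<lambda>y. (1 + t * norm y) ^ k * norm (b y))"
      by (intro Bochner_Integration.integrable_bound[OF i] AE_I2) measurable
  qed
  finally show ?thesis .
qed

lemma test_class_schwartz: "\<phi> \<in> test_class N \<Longrightarrow> \<phi> \<in> schwartz"
  by (simp add: test_class_def)

lemma test_class_bound:
  fixes \<phi> :: "real ^ 'n::finite \<Rightarrow> complex"
  shows "\<phi> \<in> test_class N \<Longrightarrow> length is \<le> N + 1 \<Longrightarrow> (1 + norm x) ^ (N + CARD('n) + 1) * norm (iter_deriv is \<phi> x) \<le> 1"
  by (simp add: test_class_def)

lemma conv_distr_cmult:
  assumes "f \<in> tempered_distributions" "\<phi> \<in> schwartz"
  shows "conv_distr (\<lambda>x. c * \<phi> x) f y = c * conv_distr \<phi> f y"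
  using tempered_distributions_linear[OF assms(1) schwartz_reflect[OF assms(2)] schwartz_reflect[OF assms(2)], where a = c and b = 0]
  by (simp add: conv_distr_def)

text \<open>Dividing by C puts \<phi> into the test class. Because the maximal function is
  nontangential, one value at y is bounded at every z within distance t; this is the local constancy
  on which the kernel estimate rests.\<close>

lemma conv_distr_le_grand_maximal:
  fixes \<phi> :: "real ^ 'n::finite \<Rightarrow> complex"
  assumes f: "f \<in> tempered_distributions" and \<phi>: "\<phi> \<in> schwartz" and C: "C > 0"
    and le: "\<And>is x. length is \<le> N + 1 \<Longrightarrow> (1 + norm x) ^ (N + CARD('n) + 1) * norm (iter_deriv is \<phi> x) \<le> C"
    and zy: "dist z y < t"
  shows "ennreal (norm (conv_distr (dilate t \<phi>) f y)) \<le> ennreal C * grand_maximal N f z"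
proof -
  have t: "t > 0" using zy zero_le_dist[of z y] by linarith
  define \<theta> where "\<theta> x = of_real (1 / C) * \<phi> x" for x
  have chi: "\<theta> \<in> test_class N"
    unfolding test_class_def
  proof (intro CollectI conjI allI impI)
    show "\<theta> \<in> schwartz" unfolding \<theta>_def[abs_def] by (rule schwartz_cmult[OF \<phi>])
    fix x and "is" :: "'n list" assume "length is \<le> N + 1"
    from le[OF this, of x] show "(1 + norm x) ^ (N + CARD('n) + 1) * norm (iter_deriv is \<theta> x) \<le> 1"
      unfolding \<theta>_def[abs_def] iter_deriv_cmult[OF schwartz_smooth[OF \<phi>]]
      using C by (simp add: norm_mult norm_divide field_simps)
  qed
  have "\<phi> = (\<lambda>x. of_real C * \<theta> x)" using C by (simp add: \<theta>_def fun_eq_iff)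
  then have "conv_distr (dilate t \<phi>) f y = of_real C * conv_distr (dilate t \<theta>) f y"
    using conv_distr_cmult[OF f dilate_schwartz[OF test_class_schwartz[OF chi] t], of "of_real C" y]
    by (simp add: dilate_cmult)
  then have "ennreal (norm (conv_distr (dilate t \<phi>) f y)) = ennreal C * ennreal (norm (conv_distr (dilate t \<theta>) f y))"
    using C by (simp add: norm_mult ennreal_mult)
  also have "\<dots> \<le> ennreal C * grand_maximal N f z"
  proof (rule mult_left_mono)
    show "ennreal (norm (conv_distr (dilate t \<theta>) f y)) \<le> grand_maximal N f z"
      unfolding grand_maximal_def
      by (rule SUP_upper2[OF chi], rule SUP_upper2[where i = "(y, t)"])
         (use zy in \<open>auto simp: dist_norm norm_minus_commute\<close>)
  qed simp
  finally show ?thesis .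
qed

text \<open>Used for a test function b shrunk to a small scale. The test class does not bound its
  k-th moment uniformly, only its mass and \<open>norm y ^ k * norm (b y)\<close>, and at the origin
  it may be large. So the weight at x goes to whichever of \<open>x - y\<close> and y is larger: to
  a, with the mass of b left over, or to b, with the mass of a left over.\<close>

lemma norm_convolution_le_split:
  fixes a b :: "real ^ 'n::finite \<Rightarrow> complex"
  assumes A: "\<And>x. (1 + norm x) ^ k * norm (a x) \<le> A" and a [measurable]: "integrable lborel a"
    and b: "integrable lborel b" and B: "\<And>y. norm y ^ k * norm (b y) \<le> 1"
  shows "(1 + norm x) ^ k * norm (convolution a b x) \<le> 2 ^ k * (A * (LINT y|lborel. norm (b y)) + (LINT y|lborel. norm (a y)))"
proof -
  have [measurable]: "a \<in> borel_measurable borel" "b \<in> borel_measurable borel" using a b by auto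
  let ?w = "(1 + norm x) ^ k"
  let ?g = "\<lambda>y. 2 ^ k / ?w * (A * norm (b y) + norm (a (x - y)))"
  have w: "?w > 0" by simp
  have i: "integrable lborel (\<lambda>y. norm (a (x - y)))" using a by (subst integrable_lborel_reflect) simp
  have ig: "integrable lborel ?g" using i b by simp
  have le: "norm (a (x - y) * b y) \<le> ?g y" for y
  proof -
    have tri: "1 + norm x \<le> (1 + norm (x - y)) + norm y" using norm_triangle_ineq[of "x - y" y] by simp
    have "?w \<le> 2 ^ k * ((1 + norm (x - y)) ^ k + norm y ^ k)"
    proof (cases "norm y \<le> 1 + norm (x - y)")
      case True
      then have "?w \<le> (2 * (1 + norm (x - y))) ^ k" using tri by (intro power_mono) auto
      also have "\<dots> = 2 ^ k * (1 + norm (x - y)) ^ k" by (rule power_mult_distrib)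
      also have "\<dots> \<le> 2 ^ k * ((1 + norm (x - y)) ^ k + norm y ^ k)" by (intro mult_left_mono) auto
      finally show ?thesis .
    next
      case False
      then have "?w \<le> (2 * norm y) ^ k" using tri by (intro power_mono) auto
      also have "\<dots> = 2 ^ k * norm y ^ k" by (rule power_mult_distrib)
      also have "\<dots> \<le> 2 ^ k * ((1 + norm (x - y)) ^ k + norm y ^ k)" by (intro mult_left_mono) auto
      finally show ?thesis .
    qed
    then have "?w * (norm (a (x - y)) * norm (b y)) \<le> 2 ^ k * ((1 + norm (x - y)) ^ k + norm y ^ k) * (norm (a (x - y)) * norm (b y))"
      by (rule mult_right_mono) simp
    also have "\<dots> = 2 ^ k * (((1 + norm (x - y)) ^ k * norm (a (x - y))) * norm (b y) + (norm y ^ k * norm (b y)) * norm (a (x - y)))"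
      by (simp add: algebra_simps)
    also have "\<dots> \<le> 2 ^ k * (A * norm (b y) + 1 * norm (a (x - y)))"
      by (intro mult_left_mono add_mono mult_right_mono A B) auto
    finally have "norm (a (x - y)) * norm (b y) * ?w \<le> 2 ^ k * (A * norm (b y) + norm (a (x - y)))" by (simp add: mult_ac)
    then have "norm (a (x - y)) * norm (b y) \<le> 2 ^ k * (A * norm (b y) + norm (a (x - y))) / ?w"
      using w by (subst pos_le_divide_eq)
    then show ?thesis by (simp add: norm_mult)
  qed
  have "norm (a (x - y) * b y) \<le> norm (?g y)" for y
    unfolding real_norm_def by (rule order_trans[OF le abs_ge_self])
  then have "integrable lborel (\<lambda>y. a (x - y) * b y)"
    by (intro Bochner_Integration.integrable_bound[OF ig] AE_I2) measurable
  then have "norm (convolution a b x) \<le> (LINT y|lborel. ?g y)"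
    unfolding convolution_def by (intro Bochner_Integration.integral_norm_bound_integral ig le)
  also have "\<dots> = 2 ^ k / ?w * (A * (LINT y|lborel. norm (b y)) + (LINT y|lborel. norm (a (x - y))))"
    using i b by simp
  also have "(LINT y|lborel. norm (a (x - y))) = (LINT y|lborel. norm (a y))" by (rule integral_lborel_reflect)
  finally have "norm (convolution a b x) \<le> 2 ^ k * (A * (LINT y|lborel. norm (b y)) + (LINT y|lborel. norm (a y))) / ?w" by simp
  then show ?thesis using w by (subst (asm) pos_le_divide_eq) (auto simp: mult.commute)
qed

text \<open>
  The convolution of two functions living at scales \<open>t\<close> and \<open>r\<close> lives at the larger scale: there the
  derivatives are put on the factor with the larger scale.
\<close>

lemma convolution_dilate_test_class:
  fixes \<psi> :: "real ^ 'n::finite \<Rightarrow> complex"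
  assumes \<psi>: "\<psi> \<in> schwartz"
  shows "\<exists>C>0. \<forall>\<phi>\<in>test_class N. \<forall>t>0. \<forall>r>0. \<exists>\<Phi>\<in>schwartz.
     convolution (dilate t \<phi>) (dilate r \<psi>) = dilate (max t r) \<Phi> \<and>
     (\<forall>is x. length is \<le> N + 1 \<longrightarrow> (1 + norm x) ^ (N + CARD('n) + 1) * norm (iter_deriv is \<Phi> x) \<le> C)"
proof -
  define L where "L = N + CARD('n) + 1"
  obtain A where A: "A \<ge> 0" "\<And>is x. length is \<le> N + 1 \<Longrightarrow> (1 + norm x) ^ L * norm (iter_deriv is \<psi> x) \<le> A"
    using schwartz_bound_uniform[OF \<psi>] by blast
  define M where "M = bracket_mass TYPE('n)"
  have M: "M \<ge> 0" unfolding M_def bracket_mass_def by (rule integral_nonneg_AE) simp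
  define C1 where "C1 = (LINT y|lborel. (1 + norm y) ^ L * norm (\<psi> y))"
  have C1: "C1 \<ge> 0" unfolding C1_def by (rule integral_nonneg_AE) simp
  define C2 where "C2 = 2 ^ L * (A * M + A * M)"
  have C2: "C2 \<ge> 0" using A(1) M by (simp add: C2_def)
  \<comment> \<open>\<open>C1\<close> serves the case r \<le> t and \<open>C2\<close> the case t <
    r; neither depends on the test function or on the scales.\<close>
  define C where "C = C1 + C2 + 1"
  have C: "C > 0" "C1 \<le> C" "C2 \<le> C" using C1 C2 by (auto simp: C_def)
  have mass: "(LINT y|lborel. norm (b y)) \<le> D * M"
    if b: "b \<in> borel_measurable borel" and D: "\<And>x. (1 + norm x) ^ L * norm (b x) \<le> D" for b :: "real ^ 'n \<Rightarrow> complex" and D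
  proof -
    have "(1 + norm x) ^ (0 + CARD('n) + 1) * norm (b x) \<le> D" for x
    proof -
      have "(1 + norm x) ^ (0 + CARD('n) + 1) \<le> (1 + norm x) ^ L"
        unfolding L_def by (rule power_increasing) auto
      from mult_right_mono[OF this, of "norm (b x)"] D[of x] show ?thesis by simp
    qed
    from weighted_integral_le(2)[OF b this] show ?thesis by (simp add: M_def)
  qed
  have "\<exists>\<Phi>\<in>schwartz. convolution (dilate t \<phi>) (dilate r \<psi>) = dilate (max t r) \<Phi> \<and>
     (\<forall>is x. length is \<le> N + 1 \<longrightarrow> (1 + norm x) ^ L * norm (iter_deriv is \<Phi> x) \<le> C)"
    if \<phi>: "\<phi> \<in> test_class N" and t: "t > 0" and r: "r > 0" for \<phi> t r
  proof (cases "r \<le> t")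
    case True
    \<comment> \<open>Derivatives fall on \<phi>, whose bounds are uniform; \<psi> is fixed and is
      shrunk by r / t \<le> 1, so its moments do not grow.\<close>
    define \<Phi> where "\<Phi> = convolution \<phi> (dilate (r / t) \<psi>)"
    have rt: "0 < r / t" "r / t \<le> 1" using True t r by auto
    have rap: "rapid (dilate (r / t) \<psi>)" by (intro schwartz_rapid dilate_schwartz \<psi> rt)
    have S: "\<Phi> \<in> schwartz" unfolding \<Phi>_def by (intro convolution_schwartz test_class_schwartz[OF \<phi>] rap)
    moreover have "dilate (max t r) \<Phi> = convolution (dilate t \<phi>) (dilate r \<psi>)"
      unfolding \<Phi>_def using True t by (simp add: dilate_convolution dilate_dilate max_def)
    moreover have "(1 + norm x) ^ L * norm (iter_deriv is \<Phi> x) \<le> C" if l: "length is \<le> N + 1" for "is" x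
    proof -
      have "(1 + norm x) ^ L * norm (iter_deriv is \<Phi> x) \<le> 1 * (LINT y|lborel. (1 + norm y) ^ L * norm (dilate (r / t) \<psi> y))"
        unfolding \<Phi>_def L_def by (intro convolution_schwartz_bound test_class_schwartz[OF \<phi>] rap test_class_bound[OF \<phi> l])
      also have "\<dots> \<le> C1" using dilate_moment_le[OF schwartz_rapid[OF \<psi>] rt] by (simp add: C1_def)
      finally show ?thesis using C by simp
    qed
    ultimately show ?thesis by metis
  next
    case False
    define \<epsilon> where "\<epsilon> = t / r"
    define b where "b = dilate \<epsilon> \<phi>"
    \<comment> \<open>Derivatives fall on the fixed \<psi>, since those of the shrunk test function
      would blow up as its scale tends to 0.\<close>
    define \<Phi> where "\<Phi> = convolution \<psi> b"
    have eps: "0 < \<epsilon>" "\<epsilon> \<le> 1" using False t r by (auto simp: \<epsilon>_def)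
    have bS: "b \<in> schwartz" unfolding b_def by (intro dilate_schwartz test_class_schwartz[OF \<phi>] eps)
    have rap: "rapid b" by (rule schwartz_rapid[OF bS])
    have S: "\<Phi> \<in> schwartz" unfolding \<Phi>_def by (intro convolution_schwartz \<psi> rap)
    moreover have "dilate (max t r) \<Phi> = convolution (dilate t \<phi>) (dilate r \<psi>)"
      unfolding \<Phi>_def b_def \<epsilon>_def using False r by (simp add: dilate_convolution dilate_dilate max_def convolution_commute[of "dilate r \<psi>"])
    moreover have "(1 + norm x) ^ L * norm (iter_deriv is \<Phi> x) \<le> C" if l: "length is \<le> N + 1" for "is" x
    proof -
      have phi0: "(1 + norm x) ^ L * norm (\<phi> x) \<le> 1" for x
        using test_class_bound[OF \<phi>, of "[]" x] by (simp add: L_def)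
      have "norm y ^ L * norm (b y) \<le> 1" for y
      proof -
        have "norm y = \<epsilon> * norm (y /\<^sub>R \<epsilon>)" using eps by simp
        then have "norm y ^ L = \<epsilon> ^ L * norm (y /\<^sub>R \<epsilon>) ^ L" by (metis power_mult_distrib)
        \<comment> \<open>Since L \<ge> n and \<epsilon> \<le> 1, the factor gained from the weight
          is at most \<epsilon>^n, which cancels the \<epsilon>^(-n) in the dilation.\<close>
        also have "\<dots> \<le> \<epsilon> ^ CARD('n) * (1 + norm (y /\<^sub>R \<epsilon>)) ^ L"
          using eps by (intro mult_mono power_mono power_decreasing) (auto simp: L_def)
        finally have "norm y ^ L * norm (\<phi> (y /\<^sub>R \<epsilon>)) \<le> \<epsilon> ^ CARD('n) * (1 + norm (y /\<^sub>R \<epsilon>)) ^ L * norm (\<phi> (y /\<^sub>R \<epsilon>))"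
          by (rule mult_right_mono) simp
        also have "\<dots> \<le> \<epsilon> ^ CARD('n) * 1"
          unfolding mult.assoc using eps by (intro mult_left_mono phi0) auto
        finally show ?thesis using eps by (simp add: b_def dilate_def norm_divide norm_power divide_le_eq_1)
      qed
      then have "(1 + norm x) ^ L * norm (convolution (iter_deriv is \<psi>) b x) \<le>
          2 ^ L * (A * (LINT y|lborel. norm (b y)) + (LINT y|lborel. norm (iter_deriv is \<psi> y)))"
        by (intro norm_convolution_le_split A(2)[OF l] rapid_integrable schwartz_rapid schwartz_iter_deriv \<psi> bS)
      also have "\<dots> \<le> 2 ^ L * (A * (1 * M) + A * M)"
      proof (intro mult_left_mono add_mono)
        have "(LINT y|lborel. norm (b y)) \<le> (LINT y|lborel. norm (\<phi> y))"
          unfolding b_def using dilate_moment_le[OF schwartz_rapid[OF test_class_schwartz[OF \<phi>]] eps, of 0] by simp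
        also have "\<dots> \<le> 1 * M" by (intro mass phi0 schwartz_measurable test_class_schwartz[OF \<phi>])
        finally show "(LINT y|lborel. norm (b y)) \<le> 1 * M" .
        show "(LINT y|lborel. norm (iter_deriv is \<psi> y)) \<le> A * M"
          by (intro mass A(2)[OF l] schwartz_measurable schwartz_iter_deriv \<psi>)
      qed (use A in auto)
      also have "\<dots> \<le> C" using C by (simp add: C2_def)
      finally show ?thesis unfolding \<Phi>_def by (simp add: iter_deriv_convolution[OF \<psi> rapid_integrable[OF rap]])
    qed
    ultimately show ?thesis by metis
  qed
  with C(1) show ?thesis unfolding L_def by blast
qed

lemma fourier_dilate:
  fixes \<psi> :: "real ^ 'n::finite \<Rightarrow> complex"
  assumes "t > 0"
  shows "fourier (dilate t \<psi>) \<xi> = fourier \<psi> (t *\<^sub>R \<xi>)"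
proof -
  let ?e = "\<lambda>c x. exp (- 2 * of_real pi * \<i> * of_real (c * (x \<bullet> \<xi>)))"
  have "fourier (dilate t \<psi>) \<xi> = \<bar>t\<bar> ^ CARD('n) *\<^sub>R (LINT x|lborel. dilate t \<psi> (0 + t *\<^sub>R x) * ?e 1 (0 + t *\<^sub>R x))"
    unfolding fourier_def using assms by (subst integral_lborel_affine[of t _ 0]) auto
  also have "\<dots> = (LINT x|lborel. \<bar>t\<bar> ^ CARD('n) *\<^sub>R (dilate t \<psi> (0 + t *\<^sub>R x) * ?e 1 (0 + t *\<^sub>R x)))"
    by simp
  also have "\<dots> = (LINT x|lborel. \<psi> x * ?e t x)"
    using assms by (intro Bochner_Integration.integral_cong refl) (simp add: dilate_def scaleR_conv_of_real[where 'a = complex])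
  also have "\<dots> = fourier \<psi> (t *\<^sub>R \<xi>)" by (simp add: fourier_def)
  finally show ?thesis .
qed

lemma spectral_cutoff_dilate:
  assumes "spectral_cutoff R \<psi>" and t: "t > 0"
  shows "spectral_cutoff (R / t) (dilate t \<psi>)"
proof -
  from assms obtain U where \<psi>: "\<psi> \<in> schwartz" and U: "open U" "cball 0 R \<subseteq> U" "\<And>\<xi>. \<xi> \<in> U \<Longrightarrow> fourier \<psi> \<xi> = 1"
    unfolding spectral_cutoff_def by blast
  let ?V = "(\<lambda>\<xi>. t *\<^sub>R \<xi>) -` U"
  have "open ?V" by (intro open_vimage U) (auto intro!: continuous_intros)
  moreover have "cball 0 (R / t) \<subseteq> ?V"
  proof
    fix \<xi> assume "\<xi> \<in> cball (0 :: real ^ 'a) (R / t)"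
    then have "norm (t *\<^sub>R \<xi>) \<le> R" using t by (simp add: pos_le_divide_eq mult.commute)
    then show "\<xi> \<in> ?V" using U(2) by auto
  qed
  moreover have "fourier (dilate t \<psi>) \<xi> = 1" if "\<xi> \<in> ?V" for \<xi>
    using that U(3) by (simp add: fourier_dilate[OF t])
  ultimately show ?thesis unfolding spectral_cutoff_def using dilate_schwartz[OF \<psi> t] by blast
qed

section \<open>Bochner-Riesz means\<close>

definition decays :: "real \<Rightarrow> (real ^ 'n::finite \<Rightarrow> complex) \<Rightarrow> bool" where
  "decays \<sigma> A \<longleftrightarrow> A \<in> borel_measurable borel \<and> (\<exists>c\<ge>0. \<forall>x. norm (A x) \<le> c * (1 + norm x) powr (- \<sigma>))"

text \<open>The class in which \<psi> * f and its Bochner-Riesz means live. Its weight is dual to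
  \<open>decays \<sigma>\<close>, so that products of the two classes are integrable and
  convolutions with kernels of decay \<sigma> converge everywhere.\<close>

definition tame :: "real \<Rightarrow> (real ^ 'n::finite \<Rightarrow> complex) \<Rightarrow> bool" where
  "tame \<sigma> G \<longleftrightarrow> G \<in> borel_measurable borel \<and> integrable lborel (\<lambda>v. (1 + norm v) powr (- \<sigma>) * norm (G v))"

lemma decays_measurable: "decays \<sigma> A \<Longrightarrow> A \<in> borel_measurable borel"
  and tame_measurable: "tame \<sigma> G \<Longrightarrow> G \<in> borel_measurable borel"
  by (simp_all add: decays_def tame_def)

lemma schwartz_decays_norm:
  assumes "\<phi> \<in> schwartz" "\<sigma> \<le> real k"
  shows "norm (\<phi> x) \<le> schwartz_norm k \<phi> * (1 + norm x) powr (- \<sigma>)"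
proof -
  have "(1 + norm x) powr \<sigma> * norm (\<phi> x) \<le> (1 + norm x) powr (real k) * norm (\<phi> x)"
    using assms(2) by (intro mult_right_mono powr_mono) auto
  also have "\<dots> = (1 + norm x) ^ k * norm (iter_deriv [] \<phi> x)" by (simp add: powr_realpow)
  also have "\<dots> \<le> schwartz_norm k \<phi>" by (rule schwartz_norm_upper[OF assms(1)]) simp
  finally have "norm (\<phi> x) * (1 + norm x) powr \<sigma> \<le> schwartz_norm k \<phi>" by (simp add: mult.commute)
  moreover have "(1 + norm x) powr \<sigma> > 0" by simp
  ultimately show ?thesis unfolding powr_minus divide_inverse[symmetric] by (subst pos_le_divide_eq)
qed

lemma schwartz_decays:
  assumes "\<phi> \<in> schwartz"
  shows "decays \<sigma> \<phi>"
proof -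
  obtain k :: nat where "\<sigma> \<le> real k" using real_arch_simple by blast
  then show ?thesis unfolding decays_def
    using schwartz_measurable[OF assms] schwartz_decays_norm[OF assms, of \<sigma> k] schwartz_norm_nonneg[OF assms] by blast
qed

text \<open>The constant depends on x, which is harmless: the lemma serves integrability of
  convolution integrands at a fixed point.\<close>

lemma decays_reflect:
  assumes A: "decays \<sigma> A" and sigma: "\<sigma> \<ge> 0"
  shows "decays \<sigma> (\<lambda>v. A (x - v))"
proof -
  from A obtain c where m [measurable]: "A \<in> borel_measurable borel" and c: "c \<ge> 0"
    "\<And>x. norm (A x) \<le> c * (1 + norm x) powr (- \<sigma>)"
    unfolding decays_def by blast
  have "norm (A (x - v)) \<le> c * (1 + norm x) powr \<sigma> * (1 + norm v) powr (- \<sigma>)" for v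
  proof -
    have "(1 + norm (x - v)) powr (- \<sigma>) \<le> (1 + norm v) powr (- \<sigma>) * (1 + \<bar>norm (x - v) - norm v\<bar>) powr \<sigma>"
      using sigma by (intro powr_neg_add_le) auto
    also have "\<dots> \<le> (1 + norm v) powr (- \<sigma>) * (1 + norm x) powr \<sigma>"
    proof -
      have "\<bar>norm (x - v) - norm v\<bar> \<le> norm x"
        using norm_triangle_ineq3[of "v - x" v] by (simp add: norm_minus_commute)
      then show ?thesis using sigma by (intro mult_left_mono powr_mono2) auto
    qed
    finally have "c * (1 + norm (x - v)) powr (- \<sigma>) \<le> c * ((1 + norm v) powr (- \<sigma>) * (1 + norm x) powr \<sigma>)"
      using c(1) by (intro mult_left_mono)
    with c(2)[of "x - v"] show ?thesis by (simp add: mult_ac)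
  qed
  then show ?thesis unfolding decays_def using c(1) by (intro conjI exI[of _ "c * (1 + norm x) powr \<sigma>"]) auto
qed

lemma decays_mult_integrable:
  assumes A: "decays \<sigma> A" and G: "tame \<sigma> G"
  shows "integrable lborel (\<lambda>v. A v * G v)"
proof -
  from A obtain c where m [measurable]: "A \<in> borel_measurable borel" and c: "c \<ge> 0"
    "\<And>x. norm (A x) \<le> c * (1 + norm x) powr (- \<sigma>)"
    unfolding decays_def by blast
  have [measurable]: "G \<in> borel_measurable borel" by (rule tame_measurable[OF G])
  show ?thesis
  proof (rule Bochner_Integration.integrable_bound)
    show "integrable lborel (\<lambda>v. c * ((1 + norm v) powr (- \<sigma>) * norm (G v)))"
      using G by (simp add: tame_def)
    have "norm (A v * G v) \<le> norm (c * ((1 + norm v) powr (- \<sigma>) * norm (G v)))" for v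
      using mult_right_mono[OF c(2)[of v], of "norm (G v)"] c(1) by (simp add: norm_mult mult.assoc)
    then show "AE v in lborel. norm (A v * G v) \<le> norm (c * ((1 + norm v) powr (- \<sigma>) * norm (G v)))" by simp
  qed measurable
qed

text \<open>One of |u| and |y - u| is at least about |y| / 2, so one factor carries the full decay
  in y while the other is integrable because \<sigma> > n.\<close>

lemma decays_convolution_nn_bound:
  fixes A B :: "real ^ 'n::finite \<Rightarrow> complex"
  assumes A: "decays \<sigma> A" and B: "decays \<sigma> B" and sigma: "\<sigma> > real CARD('n)"
  shows "\<exists>c\<ge>0. \<forall>y. (\<integral>\<^sup>+u. ennreal (norm (A (y - u)) * norm (B u)) \<partial>lborel) \<le> ennreal (c * (1 + norm y) powr (- \<sigma>))"
proof -
  have s0: "\<sigma> > 0" using sigma by (meson less_trans of_nat_0_less_iff zero_less_card_finite)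
  from A obtain a where [measurable]: "A \<in> borel_measurable borel" and a: "a \<ge> 0"
    "\<And>x. norm (A x) \<le> a * (1 + norm x) powr (- \<sigma>)" unfolding decays_def by blast
  from B obtain b where [measurable]: "B \<in> borel_measurable borel" and b: "b \<ge> 0"
    "\<And>x. norm (B x) \<le> b * (1 + norm x) powr (- \<sigma>)" unfolding decays_def by blast
  let ?j = "\<lambda>u :: real ^ 'n. (1 + norm u) powr (- \<sigma>)"
  define J where "J = (LINT u|lborel. ?j u)"
  have ji: "integrable lborel ?j" by (rule integrable_japanese_bracket[OF sigma])
  have J: "(\<integral>\<^sup>+u. ennreal (?j u) \<partial>lborel) = ennreal J" unfolding J_def
    by (rule nn_integral_eq_integral[OF ji]) auto
  have J0: "J \<ge> 0" unfolding J_def by (rule integral_nonneg_AE) simp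
  have "(\<integral>\<^sup>+u. ennreal (norm (A (y - u)) * norm (B u)) \<partial>lborel) \<le> ennreal (a * b * 2 powr \<sigma> * 2 * J * (1 + norm y) powr (- \<sigma>))" for y
  proof -
    let ?c = "a * b * 2 powr \<sigma> * (1 + norm y) powr (- \<sigma>)"
    have c0: "?c \<ge> 0" using a(1) b(1) by simp
    have "norm (A (y - u)) * norm (B u) \<le> ?c * ?j u + ?c * ?j (y - u)" for u
    proof -
      have main: "?j (y - u) * ?j u \<le> 2 powr \<sigma> * (1 + norm y) powr (- \<sigma>) * (?j u + ?j (y - u))"
      proof (cases "norm u \<le> norm (y - u)")
        case True
        then have "(1 + norm y) \<le> 2 * (1 + norm (y - u))" using norm_triangle_ineq[of "y - u" u] by simp
        then have "(2 * (1 + norm (y - u))) powr (- \<sigma>) \<le> (1 + norm y) powr (- \<sigma>)"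
          using s0 by (intro powr_mono2') auto
        then have "?j (y - u) \<le> 2 powr \<sigma> * (1 + norm y) powr (- \<sigma>)"
          by (subst powr_neg_double) auto
        then have "?j (y - u) * ?j u \<le> 2 powr \<sigma> * (1 + norm y) powr (- \<sigma>) * ?j u" by (rule mult_right_mono) simp
        also have "\<dots> \<le> 2 powr \<sigma> * (1 + norm y) powr (- \<sigma>) * (?j u + ?j (y - u))" by (intro mult_left_mono) auto
        finally show ?thesis .
      next
        case False
        then have "(1 + norm y) \<le> 2 * (1 + norm u)" using norm_triangle_ineq[of "y - u" u] by simp
        then have "(2 * (1 + norm u)) powr (- \<sigma>) \<le> (1 + norm y) powr (- \<sigma>)"
          using s0 by (intro powr_mono2') auto
        then have "?j u \<le> 2 powr \<sigma> * (1 + norm y) powr (- \<sigma>)"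
          by (subst powr_neg_double) auto
        then have "?j u * ?j (y - u) \<le> 2 powr \<sigma> * (1 + norm y) powr (- \<sigma>) * ?j (y - u)" by (rule mult_right_mono) simp
        also have "\<dots> \<le> 2 powr \<sigma> * (1 + norm y) powr (- \<sigma>) * (?j u + ?j (y - u))" by (intro mult_left_mono) auto
        finally show ?thesis by (simp add: mult.commute)
      qed
      have "norm (A (y - u)) * norm (B u) \<le> (a * ?j (y - u)) * (b * ?j u)"
        using a b by (intro mult_mono) auto
      also have "\<dots> = a * b * (?j (y - u) * ?j u)" by simp
      also have "\<dots> \<le> a * b * (2 powr \<sigma> * (1 + norm y) powr (- \<sigma>) * (?j u + ?j (y - u)))"
        using a b by (intro mult_left_mono main) auto
      finally show ?thesis by (simp add: distrib_left mult.assoc)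
    qed
    then have "(\<integral>\<^sup>+u. ennreal (norm (A (y - u)) * norm (B u)) \<partial>lborel) \<le> (\<integral>\<^sup>+u. ennreal (?c * ?j u + ?c * ?j (y - u)) \<partial>lborel)"
      by (intro nn_integral_mono ennreal_leI)
    also have "\<dots> = (\<integral>\<^sup>+u. ennreal ?c * ennreal (?j u) + ennreal ?c * ennreal (?j (y - u)) \<partial>lborel)"
      using c0 by (intro nn_integral_cong) (simp add: ennreal_mult[symmetric] ennreal_plus[symmetric] del: ennreal_plus)
    also have "\<dots> = ennreal ?c * ennreal J + ennreal ?c * ennreal J"
    proof -
      have "(\<integral>\<^sup>+u. ennreal (?j (y - u)) \<partial>lborel) = ennreal J"
        using nn_integral_lborel_reflect[of "\<lambda>u. ennreal (?j u)" y] J by simp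
      then show ?thesis by (subst nn_integral_add) (simp_all add: nn_integral_cmult J)
    qed
    also have "\<dots> = ennreal (?c * J + ?c * J)" using c0 J0 by (simp add: ennreal_mult[symmetric] ennreal_plus[symmetric] del: ennreal_plus)
    also have "?c * J + ?c * J = a * b * 2 powr \<sigma> * 2 * J * (1 + norm y) powr (- \<sigma>)" by simp
    finally show ?thesis .
  qed
  moreover have "a * b * 2 powr \<sigma> * 2 * J \<ge> 0" using a(1) b(1) J0 by simp
  ultimately show ?thesis by blast
qed

lemma integrable_pair_if_nn:
  fixes h :: "('a::euclidean_space) \<times> ('b::euclidean_space) \<Rightarrow> complex"
  assumes [measurable]: "h \<in> borel_measurable (lborel \<Otimes>\<^sub>M lborel)"
    and "(\<integral>\<^sup>+x. \<integral>\<^sup>+y. ennreal (norm (h (x, y))) \<partial>lborel \<partial>lborel) < top"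
  shows "integrable (lborel \<Otimes>\<^sub>M lborel) h"
proof (rule integrableI_bounded)
  show "(\<integral>\<^sup>+z. ennreal (norm (h z)) \<partial>(lborel \<Otimes>\<^sub>M lborel)) < \<infinity>"
    using assms(2) by (subst lborel.nn_integral_fst[symmetric]) auto
qed measurable

text \<open>The inner integral is the convolution of |A| and |B|, which decays like either factor;
  what remains is a pairing of that decay with a tame function.\<close>

lemma convolution_assoc_nn_bound:
  fixes A B G :: "real ^ 'n::finite \<Rightarrow> complex"
  assumes A: "decays \<sigma> A" and B: "decays \<sigma> B" and G: "tame \<sigma> G" and sigma: "\<sigma> > real CARD('n)"
  shows "(\<integral>\<^sup>+v. \<integral>\<^sup>+u. ennreal (norm (A (x - u) * (B (u - v) * G v))) \<partial>lborel \<partial>lborel) < top"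
proof -
  have s0: "\<sigma> \<ge> 0" using sigma by (meson less_imp_le less_trans of_nat_0_less_iff zero_less_card_finite)
  have [measurable]: "A \<in> borel_measurable borel" "B \<in> borel_measurable borel" "G \<in> borel_measurable borel"
    using A B G by (auto intro: decays_measurable tame_measurable)
  obtain c where c: "c \<ge> 0" "\<And>y. (\<integral>\<^sup>+u. ennreal (norm (A (y - u)) * norm (B u)) \<partial>lborel) \<le> ennreal (c * (1 + norm y) powr (- \<sigma>))"
    using decays_convolution_nn_bound[OF A B sigma] by blast
  have inner: "(\<integral>\<^sup>+u. ennreal (norm (A (x - u) * (B (u - v) * G v))) \<partial>lborel) \<le> ennreal (norm (of_real (c * (1 + norm (x - v)) powr (- \<sigma>)) * G v))" for v
  proof -
    have "(\<integral>\<^sup>+u. ennreal (norm (A (x - u) * (B (u - v) * G v))) \<partial>lborel) = (\<integral>\<^sup>+u. ennreal (norm (A (x - u)) * norm (B (u - v))) * ennreal (norm (G v)) \<partial>lborel)"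
      by (intro nn_integral_cong) (simp add: norm_mult ennreal_mult mult.assoc)
    also have "\<dots> = (\<integral>\<^sup>+u. ennreal (norm (A (x - u)) * norm (B (u - v))) \<partial>lborel) * ennreal (norm (G v))"
      by (rule nn_integral_multc) measurable
    also have "(\<integral>\<^sup>+u. ennreal (norm (A (x - u)) * norm (B (u - v))) \<partial>lborel) = (\<integral>\<^sup>+u. ennreal (norm (A (x - v - u)) * norm (B u)) \<partial>lborel)"
      by (subst nn_integral_lborel_translate[of _ v, symmetric]) (simp_all add: algebra_simps)
    also have "\<dots> * ennreal (norm (G v)) \<le> ennreal (c * (1 + norm (x - v)) powr (- \<sigma>)) * ennreal (norm (G v))"
      by (intro mult_right_mono c(2)) simp
    also have "\<dots> = ennreal (norm (of_real (c * (1 + norm (x - v)) powr (- \<sigma>)) * G v))"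
      using c(1) by (simp add: norm_mult ennreal_mult abs_mult)
    finally show ?thesis .
  qed
  have "decays \<sigma> (\<lambda>y :: real ^ 'n. of_real (c * (1 + norm y) powr (- \<sigma>)))"
    unfolding decays_def using c(1) by (intro conjI exI[of _ c]) (auto simp: norm_mult)
  from decays_mult_integrable[OF decays_reflect[OF this s0, of x] G]
  have "(\<integral>\<^sup>+v. ennreal (norm (of_real (c * (1 + norm (x - v)) powr (- \<sigma>)) * G v)) \<partial>lborel) < top"
    by (simp add: integrable_iff_bounded)
  then show ?thesis using nn_integral_mono[OF inner] by (rule le_less_trans[rotated])
qed

lemma convolution_assoc:
  fixes A B G :: "real ^ 'n::finite \<Rightarrow> complex"
  assumes A: "decays \<sigma> A" and B: "decays \<sigma> B" and G: "tame \<sigma> G" and sigma: "\<sigma> > real CARD('n)"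
  shows "convolution A (convolution B G) = convolution (convolution A B) G"
proof
  fix x
  have [measurable]: "A \<in> borel_measurable borel" "B \<in> borel_measurable borel" "G \<in> borel_measurable borel"
    using A B G by (auto intro: decays_measurable tame_measurable)
  have "integrable (lborel \<Otimes>\<^sub>M lborel) (\<lambda>(v, u). A (x - u) * (B (u - v) * G v))"
    using convolution_assoc_nn_bound[OF A B G sigma, of x] by (intro integrable_pair_if_nn) auto
  then have "(LINT u|lborel. LINT v|lborel. A (x - u) * (B (u - v) * G v)) = (LINT v|lborel. LINT u|lborel. A (x - u) * (B (u - v) * G v))"
    by (rule lborel_pair.Fubini_integral)
  moreover have "convolution A (convolution B G) x = (LINT u|lborel. LINT v|lborel. A (x - u) * (B (u - v) * G v))"
    by (simp add: convolution_def)
  moreover have "convolution (convolution A B) G x = (LINT v|lborel. LINT u|lborel. A (x - u) * (B (u - v) * G v))"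
  proof -
    have "convolution A B (x - v) * G v = (LINT u|lborel. A (x - u) * (B (u - v) * G v))" for v
    proof -
      have "convolution A B (x - v) = (LINT u|lborel. A (x - u) * B (u - v))"
        unfolding convolution_def by (subst integral_lborel_affine[of 1 _ "- v"]) (simp_all add: algebra_simps)
      then show ?thesis by (simp only: mult.assoc[symmetric]) simp
    qed
    then show ?thesis unfolding convolution_def[of "convolution A B"] by simp
  qed
  ultimately show "convolution A (convolution B G) x = convolution (convolution A B) G x" by simp
qed

lemma convolution_measurable:
  assumes [measurable]: "A \<in> borel_measurable borel" "G \<in> borel_measurable borel"
  shows "convolution A G \<in> borel_measurable borel"
  unfolding convolution_def[abs_def] by (rule lborel.borel_measurable_lebesgue_integral) measurable

text \<open>Integrability is no concern, since a non-integrable function has integral 0.\<close>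

lemma norm_integral_le_nn_integral:
  fixes h :: "'a \<Rightarrow> 'b::{banach, second_countable_topology}"
  shows "ennreal (norm (integral\<^sup>L M h)) \<le> (\<integral>\<^sup>+x. ennreal (norm (h x)) \<partial>M)"
  by (cases "integrable M h") (auto simp: integral_norm_bound_ennreal not_integrable_integral_eq)

text \<open>The tame weight is itself a decaying function, \<open>J\<close>, so the required
  integral is the triple integral behind associativity, taken at the point 0 after exchanging the
  order of integration.\<close>

lemma convolution_tame:
  fixes A G :: "real ^ 'n::finite \<Rightarrow> complex"
  assumes A: "decays \<sigma> A" and G: "tame \<sigma> G" and sigma: "\<sigma> > real CARD('n)"
  shows "tame \<sigma> (convolution A G)"
  unfolding tame_def
proof (intro conjI integrableI_bounded)
  have [measurable]: "A \<in> borel_measurable borel" "G \<in> borel_measurable borel"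
    using A G by (auto intro: decays_measurable tame_measurable)
  show m [measurable]: "convolution A G \<in> borel_measurable borel" by (rule convolution_measurable) measurable
  show "(\<lambda>v. (1 + norm v) powr - \<sigma> * norm (convolution A G v)) \<in> borel_measurable lborel" by measurable
  define J where "J y = complex_of_real ((1 + norm (y :: real ^ 'n)) powr (- \<sigma>))" for y
  have J: "decays \<sigma> J"
    unfolding decays_def J_def[abs_def] by (intro conjI exI[of _ 1]) auto
  have [measurable]: "J \<in> borel_measurable borel" by (rule decays_measurable[OF J])
  have "(\<integral>\<^sup>+u. ennreal (norm ((1 + norm u) powr - \<sigma> * norm (convolution A G u))) \<partial>lborel)
     \<le> (\<integral>\<^sup>+u. \<integral>\<^sup>+v. ennreal (norm (J (0 - u) * (A (u - v) * G v))) \<partial>lborel \<partial>lborel)"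
  proof (rule nn_integral_mono)
    fix u
    have "ennreal (norm (convolution A G u)) \<le> (\<integral>\<^sup>+v. ennreal (norm (A (u - v) * G v)) \<partial>lborel)"
      unfolding convolution_def by (rule norm_integral_le_nn_integral)
    then have "ennreal (norm (J (0 - u))) * ennreal (norm (convolution A G u)) \<le> ennreal (norm (J (0 - u))) * (\<integral>\<^sup>+v. ennreal (norm (A (u - v) * G v)) \<partial>lborel)"
      by (rule mult_left_mono) simp
    also have "\<dots> = (\<integral>\<^sup>+v. ennreal (norm (J (0 - u) * (A (u - v) * G v))) \<partial>lborel)"
      by (subst nn_integral_cmult[symmetric]) (auto simp: norm_mult ennreal_mult)
    finally show "ennreal (norm ((1 + norm u) powr - \<sigma> * norm (convolution A G u))) \<le> (\<integral>\<^sup>+v. ennreal (norm (J (0 - u) * (A (u - v) * G v))) \<partial>lborel)"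
      by (simp add: J_def norm_mult ennreal_mult abs_mult)
  qed
  also have "\<dots> = (\<integral>\<^sup>+v. \<integral>\<^sup>+u. ennreal (norm (J (0 - u) * (A (u - v) * G v))) \<partial>lborel \<partial>lborel)"
    by (rule lborel_pair.Fubini') measurable
  also have "\<dots> < top" by (rule convolution_assoc_nn_bound[OF J A G sigma])
  finally show "(\<integral>\<^sup>+u. ennreal (norm ((1 + norm u) powr - \<sigma> * norm (convolution A G u))) \<partial>lborel) < \<infinity>" by simp
qed

lemma distr_of_tame_tempered:
  fixes u :: "real ^ 'n::finite \<Rightarrow> complex"
  assumes u: "tame \<sigma> u"
  shows "distr_of u \<in> tempered_distributions"
    and "\<eta> \<in> schwartz \<Longrightarrow> integrable lborel (\<lambda>x. u x * \<eta> x)"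
proof -
  have int: "integrable lborel (\<lambda>x. u x * \<eta> x)" if "\<eta> \<in> schwartz" for \<eta>
    using decays_mult_integrable[OF schwartz_decays[OF that] u] by (simp add: mult.commute)
  then show "\<eta> \<in> schwartz \<Longrightarrow> integrable lborel (\<lambda>x. u x * \<eta> x)" .
  obtain k :: nat where k: "\<sigma> \<le> real k" using real_arch_simple by blast
  let ?I = "LINT v|lborel. (1 + norm v) powr (- \<sigma>) * norm (u v)"
  have ui: "integrable lborel (\<lambda>v. (1 + norm v) powr (- \<sigma>) * norm (u v))" using u by (simp add: tame_def)
  show "distr_of u \<in> tempered_distributions"
    unfolding tempered_distributions_def
  proof (intro CollectI conjI ballI allI)
    fix \<phi> \<psi> :: "real ^ 'n \<Rightarrow> complex" and a b
    assume "\<phi> \<in> schwartz" "\<psi> \<in> schwartz"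
    from int[OF this(1)] int[OF this(2)]
    have "(LINT x|lborel. a * (u x * \<phi> x) + b * (u x * \<psi> x)) = a * distr_of u \<phi> + b * distr_of u \<psi>"
      by (simp add: distr_of_def)
    then show "distr_of u (\<lambda>x. a * \<phi> x + b * \<psi> x) = a * distr_of u \<phi> + b * distr_of u \<psi>"
      by (simp add: distr_of_def algebra_simps)
  next
    have "norm (distr_of u \<phi>) \<le> ?I * schwartz_norm k \<phi>" if \<phi>: "\<phi> \<in> schwartz" for \<phi>
    proof -
      have "norm (distr_of u \<phi>) \<le> (LINT v|lborel. schwartz_norm k \<phi> * ((1 + norm v) powr (- \<sigma>) * norm (u v)))"
        unfolding distr_of_def
      proof (rule Bochner_Integration.integral_norm_bound_integral[OF int[OF \<phi>]])
        show "integrable lborel (\<lambda>v. schwartz_norm k \<phi> * ((1 + norm v) powr (- \<sigma>) * norm (u v)))" using ui by (rule integrable_mult_right)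
        show "norm (u v * \<phi> v) \<le> schwartz_norm k \<phi> * ((1 + norm v) powr (- \<sigma>) * norm (u v))" for v
          using mult_right_mono[OF schwartz_decays_norm[OF \<phi> k, of v], of "norm (u v)"] by (simp add: norm_mult mult_ac)
      qed
      then show ?thesis by (simp add: mult.commute)
    qed
    then show "\<exists>C k. \<forall>\<phi>\<in>schwartz. norm (distr_of u \<phi>) \<le> C * schwartz_norm k \<phi>" by blast
  qed
qed

section \<open>The Bochner-Riesz kernel: reproduction by cutoffs, dilation and maximal
  estimates\<close>

lemma fourier_measurable:
  fixes F :: "real ^ 'n::finite \<Rightarrow> complex"
  assumes [measurable]: "F \<in> borel_measurable borel"
  shows "fourier F \<in> borel_measurable borel"
  unfolding fourier_def[abs_def] by (rule lborel.borel_measurable_lebesgue_integral) measurable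

lemma dilate_fourier:
  fixes F :: "real ^ 'n::finite \<Rightarrow> complex"
  assumes "R > 0"
  shows "dilate (1 / R) (fourier F) = fourier (\<lambda>\<xi>. F (\<xi> /\<^sub>R R))"
proof
  fix x :: "real ^ 'n"
  let ?e = "\<lambda>\<xi> :: real ^ 'n. exp (- 2 * of_real pi * \<i> * of_real (\<xi> \<bullet> x))"
  have "fourier (\<lambda>\<xi>. F (\<xi> /\<^sub>R R)) x = \<bar>R\<bar> ^ CARD('n) *\<^sub>R (LINT \<xi>|lborel. F ((0 + R *\<^sub>R \<xi>) /\<^sub>R R) * ?e (0 + R *\<^sub>R \<xi>))"
    unfolding fourier_def using assms by (subst integral_lborel_affine[of R _ 0]) auto
  also have "\<dots> = dilate (1 / R) (fourier F) x"
    using assms by (simp add: dilate_def fourier_def scaleR_conv_of_real[where 'a = complex] power_one_over power_inverse divide_inverse mult.commute)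
  finally show "dilate (1 / R) (fourier F) x = fourier (\<lambda>\<xi>. F (\<xi> /\<^sub>R R)) x" by simp
qed

text \<open>By Fubini, convolving with \<psi> multiplies F by the transform of \<psi>, which is 1 on
  the support of F.\<close>

lemma fourier_convolution_cutoff:
  fixes F \<psi> :: "real ^ 'n::finite \<Rightarrow> complex"
  assumes F: "integrable lborel F" "\<And>\<xi>. norm \<xi> > R \<Longrightarrow> F \<xi> = 0" and \<psi>: "spectral_cutoff R \<psi>"
  shows "convolution (fourier F) \<psi> = fourier F"
proof
  fix x :: "real ^ 'n"
  have [measurable]: "F \<in> borel_measurable borel" using F(1) by auto
  have S: "\<psi> \<in> schwartz" using \<psi> by (simp add: spectral_cutoff_def)
  have [measurable]: "\<psi> \<in> borel_measurable borel" by (rule schwartz_measurable[OF S])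
  have \<psi>i: "integrable lborel \<psi>" by (rule rapid_integrable[OF schwartz_rapid[OF S]])
  let ?e = "\<lambda>z. exp (- 2 * of_real pi * \<i> * of_real z) :: complex"
  have e_add: "?e (a + b) = ?e a * ?e b" for a b by (simp add: exp_add[symmetric] algebra_simps)
  have "(\<integral>\<^sup>+u. \<integral>\<^sup>+\<xi>. ennreal (norm (F \<xi> * ?e (\<xi> \<bullet> (x - u)) * \<psi> u)) \<partial>lborel \<partial>lborel)
      = (\<integral>\<^sup>+u. (\<integral>\<^sup>+\<xi>. ennreal (norm (F \<xi>)) \<partial>lborel) * ennreal (norm (\<psi> u)) \<partial>lborel)"
    by (intro nn_integral_cong) (simp add: norm_mult ennreal_mult nn_integral_multc)
  also have "\<dots> = (\<integral>\<^sup>+\<xi>. ennreal (norm (F \<xi>)) \<partial>lborel) * (\<integral>\<^sup>+u. ennreal (norm (\<psi> u)) \<partial>lborel)"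
    by (rule nn_integral_cmult) measurable
  also have "\<dots> < top"
    using F(1) \<psi>i by (simp add: integrable_iff_bounded ennreal_mult_less_top)
  finally have "integrable (lborel \<Otimes>\<^sub>M lborel) (\<lambda>(u, \<xi>). F \<xi> * ?e (\<xi> \<bullet> (x - u)) * \<psi> u)"
    by (intro integrable_pair_if_nn) auto
  then have "(LINT u|lborel. LINT \<xi>|lborel. F \<xi> * ?e (\<xi> \<bullet> (x - u)) * \<psi> u) = (LINT \<xi>|lborel. LINT u|lborel. F \<xi> * ?e (\<xi> \<bullet> (x - u)) * \<psi> u)"
    by (rule lborel_pair.Fubini_integral[symmetric])
  moreover have "convolution (fourier F) \<psi> x = (LINT u|lborel. LINT \<xi>|lborel. F \<xi> * ?e (\<xi> \<bullet> (x - u)) * \<psi> u)"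
    by (simp add: convolution_def fourier_def)
  moreover have "(LINT u|lborel. F \<xi> * ?e (\<xi> \<bullet> (x - u)) * \<psi> u) = F \<xi> * ?e (\<xi> \<bullet> x)" for \<xi>
  proof -
    have "F \<xi> * ?e (\<xi> \<bullet> (x - u)) * \<psi> u = F \<xi> * ?e (\<xi> \<bullet> x) * (\<psi> u * ?e (u \<bullet> (- \<xi>)))" for u
      using e_add[of "\<xi> \<bullet> x" "u \<bullet> (- \<xi>)"] by (simp add: inner_diff_right inner_commute[of u] mult_ac)
    then have "(LINT u|lborel. F \<xi> * ?e (\<xi> \<bullet> (x - u)) * \<psi> u) = F \<xi> * ?e (\<xi> \<bullet> x) * fourier \<psi> (- \<xi>)"
      unfolding fourier_def by (simp only: integral_mult_right_zero)
    \<comment> \<open>The transform is evaluated at the reflected frequency; the ball on which it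
      equals 1 is symmetric.\<close>
    moreover have "fourier \<psi> (- \<xi>) = 1" if "F \<xi> \<noteq> 0"
    proof -
      have "norm \<xi> \<le> R" using that F(2)[of \<xi>] by force
      then have "- \<xi> \<in> cball 0 R" by simp
      then show ?thesis using \<psi> unfolding spectral_cutoff_def by blast
    qed
    ultimately show ?thesis by (cases "F \<xi> = 0") auto
  qed
  ultimately show "convolution (fourier F) \<psi> x = fourier F x" by (simp add: fourier_def)
qed

lemma br_kernel_eq: "br_kernel \<delta> = fourier (\<lambda>\<xi>. complex_of_real (ball_power \<delta> \<xi>))"
  by (simp add: br_kernel_def ball_power_def)

lemma br_kernel_decays:
  assumes "\<delta> > 0"
  shows "decays (\<delta> + (real CARD('n) + 1) / 2) (br_kernel \<delta> :: real ^ 'n::finite \<Rightarrow> complex)"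
proof -
  have "br_kernel \<delta> \<in> borel_measurable (borel :: (real ^ 'n) measure)"
    unfolding br_kernel_eq by (rule fourier_measurable) measurable
  then show ?thesis
    using fourier_ball_power_decay[OF assms, where 'n = 'n] unfolding decays_def br_kernel_eq by (meson less_imp_le)
qed

lemma br_kernel_convolution_cutoff:
  fixes \<psi> :: "real ^ 'n::finite \<Rightarrow> complex"
  assumes "\<delta> > 0" "R > 0" "spectral_cutoff R \<psi>"
  shows "convolution (dilate (1 / R) (br_kernel \<delta>)) \<psi> = dilate (1 / R) (br_kernel \<delta>)"
  unfolding br_kernel_eq dilate_fourier[OF assms(2)]
proof (rule fourier_convolution_cutoff[OF _ _ assms(3)])
  have "integrable lborel (\<lambda>\<xi> :: real ^ 'n. ball_power \<delta> (0 + inverse R *\<^sub>R \<xi>))"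
    using assms by (subst integrable_lborel_affine_iff) (auto intro: ball_power_integrable)
  then show "integrable lborel (\<lambda>\<xi> :: real ^ 'n. complex_of_real (ball_power \<delta> (\<xi> /\<^sub>R R)))" by simp
  fix \<xi> :: "real ^ 'n" assume "R < norm \<xi>"
  then have "1 \<le> norm (\<xi> /\<^sub>R R)" using assms(2) by (simp add: field_simps)
  then show "complex_of_real (ball_power \<delta> (\<xi> /\<^sub>R R)) = 0" by (simp only: ball_power_eq_0 of_real_0)
qed

lemma dilate_measurable:
  assumes [measurable]: "A \<in> borel_measurable borel"
  shows "dilate t A \<in> borel_measurable borel"
  unfolding dilate_def[abs_def] by measurable

text \<open>The constant depends on t and serves only convergence. Bounds uniform in the scale come
  from \<open>dilate_far_bound\<close> and from the scale invariance of the L^1 norm.\<close>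

lemma dilate_decays:
  assumes A: "decays \<sigma> A" and t: "t > 0" and sigma: "\<sigma> \<ge> 0"
  shows "decays \<sigma> (dilate t A :: real ^ 'n::finite \<Rightarrow> complex)"
proof -
  from A obtain c where m: "A \<in> borel_measurable borel" and c: "c \<ge> 0"
    "\<And>x. norm (A x) \<le> c * (1 + norm x) powr (- \<sigma>)" unfolding decays_def by blast
  have "norm (dilate t A x) \<le> c * (1 + t) powr \<sigma> / t ^ CARD('n) * (1 + norm x) powr (- \<sigma>)" for x
  proof -
    have "1 + norm x \<le> (1 + t) * (1 + norm (x /\<^sub>R t))" using t by (simp add: field_simps)
    then have "((1 + t) * (1 + norm (x /\<^sub>R t))) powr (- \<sigma>) \<le> (1 + norm x) powr (- \<sigma>)"
      using sigma by (intro powr_mono2') auto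
    moreover have "((1 + t) * (1 + norm (x /\<^sub>R t))) powr (- \<sigma>) = (1 + t) powr (- \<sigma>) * (1 + norm (x /\<^sub>R t)) powr (- \<sigma>)"
      using t by (intro powr_mult)
    ultimately have "(1 + t) powr (- \<sigma>) * (1 + norm (x /\<^sub>R t)) powr (- \<sigma>) \<le> (1 + norm x) powr (- \<sigma>)" by simp
    then have "(1 + t) powr \<sigma> * ((1 + t) powr (- \<sigma>) * (1 + norm (x /\<^sub>R t)) powr (- \<sigma>)) \<le> (1 + t) powr \<sigma> * (1 + norm x) powr (- \<sigma>)"
      by (rule mult_left_mono) simp
    moreover have "(1 + t) powr \<sigma> * (1 + t) powr (- \<sigma>) = 1" using t by (simp add: powr_minus)
    ultimately have "(1 + norm (x /\<^sub>R t)) powr (- \<sigma>) \<le> (1 + t) powr \<sigma> * (1 + norm x) powr (- \<sigma>)"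
      by (simp only: mult.assoc[symmetric] mult_1)
    then have "norm (A (x /\<^sub>R t)) \<le> c * ((1 + t) powr \<sigma> * (1 + norm x) powr (- \<sigma>))"
      using c(1) by (intro order_trans[OF c(2)] mult_left_mono)
    then have "norm (A (x /\<^sub>R t)) / t ^ CARD('n) \<le> c * ((1 + t) powr \<sigma> * (1 + norm x) powr (- \<sigma>)) / t ^ CARD('n)"
      using t by (intro divide_right_mono) auto
    then show ?thesis using t by (simp add: dilate_def norm_divide norm_power)
  qed
  moreover have "c * (1 + t) powr \<sigma> / t ^ CARD('n) \<ge> 0" using c t by simp
  ultimately show ?thesis unfolding decays_def using dilate_measurable[OF m] by blast
qed

text \<open>At a fixed distant point the kernel of scale r is of size r^(\<sigma> - n)
  |u|^(-\<sigma>). As \<sigma> \<ge> n this increases with r, so beyond distance m the kernel of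
  scale r is dominated by the profile of the larger scale m.\<close>

lemma dilate_far_bound:
  fixes A :: "real ^ 'n::finite \<Rightarrow> complex"
  assumes c: "c \<ge> 0" "\<And>x. norm (A x) \<le> c * (1 + norm x) powr (- \<sigma>)"
    and sigma: "\<sigma> \<ge> real CARD('n)" and r: "0 < r" "r \<le> m" and u: "norm u > m"
  shows "norm (dilate r A u) \<le> c * 2 powr \<sigma> / m ^ CARD('n) * (1 + norm u / m) powr (- \<sigma>)"
proof -
  have m: "m > 0" using r by simp
  have u0: "norm u > 0" using u m by linarith
  have s0: "\<sigma> \<ge> 0" using sigma by (meson of_nat_0_le_iff order_trans)
  have split: "(norm u / q) powr (- \<sigma>) / q ^ CARD('n) = q powr (\<sigma> - real CARD('n)) * norm u powr (- \<sigma>)" if "q > 0" for q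
  proof -
    have "(norm u / q) powr (- \<sigma>) = norm u powr (- \<sigma>) / q powr (- \<sigma>)"
      using that u0 by (intro powr_divide)
    also have "\<dots> = q powr \<sigma> * norm u powr (- \<sigma>)" by (simp add: powr_minus_divide[of q])
    finally show ?thesis using that by (simp add: powr_diff powr_realpow)
  qed
  have "norm (A (u /\<^sub>R r)) \<le> c * (norm u / r) powr (- \<sigma>)"
  proof -
    have "(1 + norm (u /\<^sub>R r)) powr (- \<sigma>) \<le> (norm u / r) powr (- \<sigma>)"
      using r u0 s0 by (intro powr_mono2') (auto simp: divide_inverse mult.commute)
    then show ?thesis using c(1) by (intro order_trans[OF c(2)] mult_left_mono)
  qed
  then have "norm (dilate r A u) \<le> c * (norm u / r) powr (- \<sigma>) / r ^ CARD('n)"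
    using r by (simp add: dilate_def norm_divide norm_power divide_right_mono)
  also have "\<dots> = c * (r powr (\<sigma> - real CARD('n)) * norm u powr (- \<sigma>))" unfolding split[OF r(1), symmetric] by simp
  also have "\<dots> \<le> c * (m powr (\<sigma> - real CARD('n)) * norm u powr (- \<sigma>))"
    using c(1) r sigma by (intro mult_left_mono mult_right_mono powr_mono2) auto
  also have "\<dots> = c / m ^ CARD('n) * (norm u / m) powr (- \<sigma>)" unfolding split[OF m, symmetric] by simp
  also have "\<dots> \<le> c / m ^ CARD('n) * (2 powr \<sigma> * (1 + norm u / m) powr (- \<sigma>))"
  proof (rule mult_left_mono)
    have um: "norm u / m > 1" using u m by simp
    have "(norm u / m) powr (- \<sigma>) = 2 powr \<sigma> * (2 * (norm u / m)) powr (- \<sigma>)"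
      using um by (intro powr_neg_double) linarith
    also have "\<dots> \<le> 2 powr \<sigma> * (1 + norm u / m) powr (- \<sigma>)"
      using um s0 by (intro mult_left_mono[OF powr_mono2' powr_ge_zero]) linarith+
    finally show "(norm u / m) powr (- \<sigma>) \<le> 2 powr \<sigma> * (1 + norm u / m) powr (- \<sigma>)" .
  qed (use c(1) m in auto)
  finally show ?thesis by (simp add: mult_ac)
qed

lemma nn_integral_dilate_reflect:
  fixes A :: "real ^ 'n::finite \<Rightarrow> complex"
  assumes [measurable]: "A \<in> borel_measurable borel" and r: "r > 0"
  shows "(\<integral>\<^sup>+v. ennreal (norm (dilate r A (y - v))) \<partial>lborel) = (\<integral>\<^sup>+v. ennreal (norm (A v)) \<partial>lborel)"
proof -
  have [measurable]: "dilate r A \<in> borel_measurable borel" by (rule dilate_measurable) measurable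
  have "(\<integral>\<^sup>+v. ennreal (norm (dilate r A (y - v))) \<partial>lborel) = (\<integral>\<^sup>+v. ennreal (norm (dilate r A v)) \<partial>lborel)"
    by (rule nn_integral_lborel_reflect) measurable
  also have "\<dots> = ennreal (\<bar>r\<bar> ^ CARD('n)) * (\<integral>\<^sup>+v. ennreal (norm (dilate r A (0 + r *\<^sub>R v))) \<partial>lborel)"
    using r nn_integral_lborel_affine[of "\<lambda>v. ennreal (norm (dilate r A v))" r 0] by simp
  also have "\<dots> = (\<integral>\<^sup>+v. ennreal (\<bar>r\<bar> ^ CARD('n)) * ennreal (norm (dilate r A (0 + r *\<^sub>R v))) \<partial>lborel)"
    by (rule nn_integral_cmult[symmetric]) measurable
  also have "\<dots> = (\<integral>\<^sup>+v. ennreal (norm (A v)) \<partial>lborel)"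
    using r by (intro nn_integral_cong) (simp add: dilate_def norm_divide norm_power ennreal_mult[symmetric])
  finally show ?thesis .
qed

lemma decays_nn_integral_finite:
  fixes A :: "real ^ 'n::finite \<Rightarrow> complex"
  assumes A: "decays \<sigma> A" and sigma: "\<sigma> > real CARD('n)"
  shows "(\<integral>\<^sup>+v. ennreal (norm (A v)) \<partial>lborel) < top"
proof -
  have "tame \<sigma> (\<lambda>_ :: real ^ 'n. 1)"
    unfolding tame_def using integrable_japanese_bracket[OF sigma] by simp
  from decays_mult_integrable[OF A this] show ?thesis by (simp add: integrable_iff_bounded)
qed

text \<open>F varies at scale m while the kernel lives at the smaller scale r. Within distance m of
  y the scale-invariant L^1 norm of the kernel meets the supremum bound on F; beyond it the kernel
  is replaced by its majorant at scale m and the integral bound applies.\<close>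

lemma convolution_le_maximal_fun:
  fixes K :: "real ^ 'n::finite \<Rightarrow> complex"
  assumes K: "decays \<sigma> K" and s: "0 < s" "s < 1" and sigma: "\<sigma> * s > real CARD('n)"
  shows "\<exists>E>0. \<forall>r>0. \<forall>m\<ge>r. \<forall>x y. \<forall>F \<in> borel_measurable borel. \<forall>g \<in> borel_measurable lebesgue.
     dist x y < m \<longrightarrow> (\<forall>v z. dist z v < m \<longrightarrow> ennreal (norm (F v)) \<le> g z) \<longrightarrow>
     ennreal (norm (convolution (dilate r K) F y)) \<le> ennreal E * ennreal_powr (maximal_fun (\<lambda>z. ennreal_powr (g z) s) x) (1 / s)"
proof -
  have sigma0: "\<sigma> > 0" using sigma s by (meson le_less_trans of_nat_0_le_iff zero_less_mult_pos2)
  then have "\<sigma> * s \<le> \<sigma>" using s by simp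
  with sigma have sigman: "\<sigma> > real CARD('n)" by linarith
  from K obtain c where Km [measurable]: "K \<in> borel_measurable borel" and c: "c \<ge> 0"
    "\<And>x. norm (K x) \<le> c * (1 + norm x) powr (- \<sigma>)" unfolding decays_def by blast
  obtain I where I: "(\<integral>\<^sup>+v. ennreal (norm (K v)) \<partial>lborel) = ennreal I" "I \<ge> 0"
    using decays_nn_integral_finite[OF K sigman] by (cases "\<integral>\<^sup>+v. ennreal (norm (K v)) \<partial>lborel") auto
  from kernel_average_le_maximal_fun[OF s sigma]
  obtain D where D: "D > 0" and Dle: "\<forall>m>0. \<forall>(x :: real ^ 'n) y. \<forall>F :: real ^ 'n \<Rightarrow> complex. \<forall>g \<in> borel_measurable lebesgue.
     dist x y < m \<longrightarrow> (\<forall>v z. dist z v < m \<longrightarrow> ennreal (norm (F v)) \<le> g z) \<longrightarrow>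
     (\<forall>v. ennreal ((1 + dist y v / m) powr (- \<sigma>) * norm (F v)) \<le> ennreal D * ennreal_powr (maximal_fun (\<lambda>z. ennreal_powr (g z) s) x) (1 / s)) \<and>
     (\<integral>\<^sup>+v. ennreal ((1 + dist y v / m) powr (- \<sigma>) * norm (F v)) \<partial>lebesgue)
        \<le> ennreal (D * m ^ CARD('n)) * ennreal_powr (maximal_fun (\<lambda>z. ennreal_powr (g z) s) x) (1 / s)"
    by (elim exE conjE)
  define E where "E = 2 powr \<sigma> * (c + I) * D + 1"
  have E: "E > 0" "2 powr \<sigma> * (c + I) * D \<le> E" using c(1) I(2) D by (auto simp: E_def add_nonneg_pos)
  have "ennreal (norm (convolution (dilate r K) F y)) \<le> ennreal E * ennreal_powr (maximal_fun (\<lambda>z. ennreal_powr (g z) s) x) (1 / s)"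
    if r: "r > 0" "r \<le> m" and Fm [measurable]: "F \<in> borel_measurable borel" and g: "g \<in> borel_measurable lebesgue"
      and xy: "dist x y < m" and F: "\<And>v z. dist z v < m \<Longrightarrow> ennreal (norm (F v)) \<le> g z" for r m x y F g
  proof -
    define X where "X = ennreal_powr (maximal_fun (\<lambda>z. ennreal_powr (g z) s) x) (1 / s)"
    have m: "m > 0" using r by simp
    have [measurable]: "dilate r K \<in> borel_measurable borel" by (rule dilate_measurable) measurable
    have sup: "ennreal ((1 + dist y v / m) powr (- \<sigma>) * norm (F v)) \<le> ennreal D * X" for v
      unfolding X_def using Dle[rule_format, OF m g xy F, THEN conjunct1] by (rule spec)
    have "(\<integral>\<^sup>+v. ennreal ((1 + dist y v / m) powr (- \<sigma>) * norm (F v)) \<partial>lebesgue) \<le> ennreal (D * m ^ CARD('n)) * X"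
      unfolding X_def by (rule Dle[rule_format, OF m g xy F, THEN conjunct2])
    then have int: "(\<integral>\<^sup>+v. ennreal ((1 + dist y v / m) powr (- \<sigma>) * norm (F v)) \<partial>lborel) \<le> ennreal (D * m ^ CARD('n)) * X"
      by (subst (asm) nn_integral_completion) auto
    have pt: "ennreal (norm (dilate r K (y - v) * F v)) \<le>
        ennreal (c * 2 powr \<sigma> / m ^ CARD('n)) * ennreal ((1 + dist y v / m) powr (- \<sigma>) * norm (F v)) +
        ennreal (norm (dilate r K (y - v))) * (ennreal (2 powr \<sigma> * D) * X)" for v
    proof (cases "norm (y - v) > m")
      case True
      from mult_right_mono[OF dilate_far_bound[OF c less_imp_le[OF sigman] r True] norm_ge_zero]
      have "norm (dilate r K (y - v)) * norm (F v) \<le> c * 2 powr \<sigma> / m ^ CARD('n) * ((1 + dist y v / m) powr (- \<sigma>) * norm (F v))"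
        unfolding dist_norm mult.assoc[of _ "(1 + _) powr _"] .
      then have "ennreal (norm (dilate r K (y - v) * F v)) \<le> ennreal (c * 2 powr \<sigma> / m ^ CARD('n) * ((1 + dist y v / m) powr (- \<sigma>) * norm (F v)))"
        unfolding norm_mult by (rule ennreal_leI)
      also have "\<dots> = ennreal (c * 2 powr \<sigma> / m ^ CARD('n)) * ennreal ((1 + dist y v / m) powr (- \<sigma>) * norm (F v))"
        using c(1) m by (intro ennreal_mult) auto
      finally show ?thesis by (rule order_trans) simp
    next
      case False
      then have "dist y v / m \<le> 1" using m by (simp add: dist_norm)
      then have "(1 + dist y v / m) powr \<sigma> \<le> 2 powr \<sigma>" using sigma0 m by (intro powr_mono2) (auto simp: add_nonneg_nonneg)
      moreover have "(1 + dist y v / m) powr \<sigma> * (1 + dist y v / m) powr (- \<sigma>) = 1"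
      proof -
        have "1 + dist y v / m > 0" using m by (simp add: add_pos_nonneg)
        then show ?thesis by (simp add: powr_minus)
      qed
      ultimately have "norm (F v) \<le> 2 powr \<sigma> * ((1 + dist y v / m) powr (- \<sigma>) * norm (F v))"
        using mult_right_mono[of "(1 + dist y v / m) powr \<sigma>" "2 powr \<sigma>" "(1 + dist y v / m) powr (- \<sigma>) * norm (F v)"]
        by (simp add: mult.assoc[symmetric])
      then have "ennreal (norm (F v)) \<le> ennreal (2 powr \<sigma>) * ennreal ((1 + dist y v / m) powr (- \<sigma>) * norm (F v))"
        by (simp add: ennreal_mult[symmetric] ennreal_leI)
      also have "\<dots> \<le> ennreal (2 powr \<sigma>) * (ennreal D * X)" by (rule mult_left_mono[OF sup]) simp
      also have "\<dots> = ennreal (2 powr \<sigma> * D) * X" using D by (simp add: ennreal_mult mult.assoc)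
      finally have "ennreal (norm (dilate r K (y - v))) * ennreal (norm (F v)) \<le> ennreal (norm (dilate r K (y - v))) * (ennreal (2 powr \<sigma> * D) * X)"
        by (rule mult_left_mono) simp
      then show ?thesis by (simp add: norm_mult ennreal_mult add_increasing)
    qed
    have "ennreal (norm (convolution (dilate r K) F y)) \<le> (\<integral>\<^sup>+v. ennreal (norm (dilate r K (y - v) * F v)) \<partial>lborel)"
      unfolding convolution_def by (rule norm_integral_le_nn_integral)
    also have "\<dots> \<le> (\<integral>\<^sup>+v. ennreal (c * 2 powr \<sigma> / m ^ CARD('n)) * ennreal ((1 + dist y v / m) powr (- \<sigma>) * norm (F v)) +
        ennreal (norm (dilate r K (y - v))) * (ennreal (2 powr \<sigma> * D) * X) \<partial>lborel)"
      by (rule nn_integral_mono[OF pt])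
    also have "\<dots> = ennreal (c * 2 powr \<sigma> / m ^ CARD('n)) * (\<integral>\<^sup>+v. ennreal ((1 + dist y v / m) powr (- \<sigma>) * norm (F v)) \<partial>lborel)
        + (\<integral>\<^sup>+v. ennreal (norm (dilate r K (y - v))) \<partial>lborel) * (ennreal (2 powr \<sigma> * D) * X)"
      by (subst nn_integral_add) (simp_all add: nn_integral_cmult nn_integral_multc)
    also have "\<dots> \<le> ennreal (c * 2 powr \<sigma> / m ^ CARD('n)) * (ennreal (D * m ^ CARD('n)) * X) + ennreal I * (ennreal (2 powr \<sigma> * D) * X)"
      unfolding nn_integral_dilate_reflect[OF Km r(1)] I(1) by (intro add_mono mult_left_mono int) auto
    also have "\<dots> = ennreal (c * 2 powr \<sigma> / m ^ CARD('n) * (D * m ^ CARD('n)) + I * (2 powr \<sigma> * D)) * X"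
      using c(1) I(2) D m by (simp add: ennreal_mult[symmetric] mult.assoc[symmetric] distrib_right[symmetric] ennreal_plus[symmetric] del: ennreal_plus)
    also have "c * 2 powr \<sigma> / m ^ CARD('n) * (D * m ^ CARD('n)) + I * (2 powr \<sigma> * D) = 2 powr \<sigma> * (c + I) * D"
      using m by (simp add: field_simps)
    also have "ennreal (2 powr \<sigma> * (c + I) * D) * X \<le> ennreal E * X"
      by (intro mult_right_mono ennreal_leI E) simp
    finally show ?thesis by (simp add: X_def)
  qed
  with E(1) show ?thesis by blast
qed

section \<open>Weak norms and finiteness of the maximal function\<close>

text \<open>The condition \<open>norm (y - x) < t\<close> is open in x, so superlevel sets are
  unions of balls; this settles measurability in spite of the uncountable suprema.\<close>

lemma grand_maximal_measurable:
  fixes f :: "(real ^ 'n::finite \<Rightarrow> complex) \<Rightarrow> complex"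
  shows "grand_maximal N f \<in> borel_measurable borel"
proof (rule borel_measurableI_greater)
  fix a
  have "{x \<in> space borel. a < grand_maximal N f x} =
     (\<Union>\<phi>\<in>test_class N. \<Union>(y, t)\<in>{(y, t). a < ennreal (norm (conv_distr (dilate t \<phi>) f y))}. ball y t)"
    by (auto simp: grand_maximal_def less_SUP_iff dist_norm) blast+
  moreover have "open (\<Union>\<phi>\<in>test_class N. \<Union>(y, t)\<in>{(y, t). a < ennreal (norm (conv_distr (dilate t \<phi>) f y))}. ball y t)"
    by (intro open_UN ballI) auto
  ultimately show "{x \<in> space borel. a < grand_maximal N f x} \<in> sets borel" by simp
qed

lemma weak_L_norm_leD:
  assumes A: "weak_L_norm p w g \<le> ennreal A" "A \<ge> 0" and p: "p > 0" and t: "t > 0"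
  shows "weighted_measure w {x. g x > ennreal t} \<le> ennreal ((A / t) powr p)"
proof -
  let ?\<mu> = "weighted_measure w {x. g x > ennreal t}"
  have le: "ennreal t * ennreal_powr ?\<mu> (1 / p) \<le> ennreal A"
    using A(1) t unfolding weak_L_norm_def SUP_le_iff by auto
  show ?thesis
  proof (cases ?\<mu>)
    case (real r)
    then have "t * r powr (1 / p) \<le> A" using le t A(2) by (simp add: ennreal_mult[symmetric])
    then have "r powr (1 / p) \<le> A / t" using t by (simp add: field_simps)
    then have "(r powr (1 / p)) powr p \<le> (A / t) powr p" using p by (intro powr_mono2) auto
    then show ?thesis using real p by (simp add: powr_powr ennreal_leI)
  next
    case top
    then show ?thesis using le t by (simp add: ennreal_mult_top top_unique)
  qed
qed

lemma weak_L_norm_leI: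
  assumes "\<And>t. t > 0 \<Longrightarrow> weighted_measure w {x. g x > ennreal t} \<le> ennreal ((A / t) powr p)" "A \<ge> 0" "p > 0"
  shows "weak_L_norm p w g \<le> ennreal A"
  unfolding weak_L_norm_def
proof (rule SUP_least)
  fix t :: real assume "t \<in> {0<..}"
  then have t: "t > 0" by simp
  have "ennreal_powr (weighted_measure w {x. g x > ennreal t}) (1 / p) \<le> ennreal_powr (ennreal ((A / t) powr p)) (1 / p)"
    using assms(3) by (intro ennreal_powr_mono assms(1) t) simp
  also have "\<dots> = ennreal (A / t)" using assms(2,3) t by (simp add: powr_powr)
  finally have "ennreal t * ennreal_powr (weighted_measure w {x. g x > ennreal t}) (1 / p) \<le> ennreal t * ennreal (A / t)"
    by (rule mult_left_mono) simp
  also have "\<dots> = ennreal A" using t assms(2) by (simp add: ennreal_mult[symmetric])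
  finally show "ennreal t * ennreal_powr (weighted_measure w {x. ennreal t < g x}) (1 / p) \<le> ennreal A" .
qed

lemma weighted_measure_UNIV_pos:
  fixes w :: "real ^ 'n::finite \<Rightarrow> real"
  assumes "weight w"
  shows "weighted_measure w UNIV > 0"
proof (rule ccontr)
  have [measurable]: "w \<in> borel_measurable lebesgue" by (rule weight_measurable[OF assms])
  assume "\<not> weighted_measure w UNIV > 0"
  then have "(\<integral>\<^sup>+x. ennreal (w x) \<partial>lebesgue) = 0" by (simp add: weighted_measure_def)
  then have "AE x in lebesgue. ennreal (w x) = 0" by (subst (asm) nn_integral_0_iff_AE) auto
  moreover have "AE x in lebesgue. 0 < w x" using assms by (simp add: weight_def)
  ultimately have "AE x in (lebesgue :: (real ^ 'n) measure). False"
    by eventually_elim (auto simp: ennreal_eq_0_iff)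
  then have "AE x in (lborel :: (real ^ 'n) measure). False" by (simp add: AE_completion_iff)
  then have "{x \<in> space (lborel :: (real ^ 'n) measure). \<not> False} \<in> null_sets lborel"
    by (subst (asm) AE_iff_null) simp_all
  then show False by (auto dest: null_setsD1)
qed

text \<open>If h were infinite everywhere, the whole space would have weighted measure at most D *
  (A / t)^p for every t, hence measure 0, against the positivity of the weight.\<close>

lemma ex_finite_maximal_fun:
  fixes w :: "real ^ 'n::finite \<Rightarrow> real"
  assumes w: "weight w" and A: "A \<ge> 0" and D: "D > 0" and p: "p > 0"
    and le: "\<And>t. t > 0 \<Longrightarrow> weighted_measure w {x. h x > ennreal (t powr s)} \<le> ennreal (D * (A / t) powr p)"
  shows "\<exists>x. h x < top"
proof (rule ccontr)
  assume "\<not> (\<exists>x. h x < top)"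
  then have "h x = top" for x by (metis top.not_eq_extremum)
  then have U: "weighted_measure w UNIV \<le> ennreal (D * (A / t) powr p)" if "t > 0" for t
    using le[OF that] by simp
  then have "weighted_measure w UNIV \<noteq> top" using U[of 1] by (auto simp: top_unique)
  then obtain r where r: "weighted_measure w UNIV = ennreal r" "r \<ge> 0" by (cases "weighted_measure w UNIV") auto
  with weighted_measure_UNIV_pos[OF w] have "r > 0" by (simp add: ennreal_less_zero_iff)
  have rle: "r \<le> D * (A / t) powr p" if "t > 0" for t
    using U[OF that] r D by (simp add: ennreal_le_iff)
  show False
  proof (cases "A = 0")
    case True
    with rle[of 1] \<open>r > 0\<close> show False by simp
  next
    case False
    with A have "A > 0" by simp
    \<comment> \<open>The value of t at which the bound equals r / 2.\<close>
    let ?t = "A / (r / (2 * D)) powr (1 / p)"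
    have "?t > 0" using \<open>A > 0\<close> \<open>r > 0\<close> D by simp
    moreover have "(A / ?t) powr p = r / (2 * D)" using \<open>A > 0\<close> \<open>r > 0\<close> D p by (simp add: powr_powr)
    ultimately have "r \<le> r / 2" using rle[of ?t] D by simp
    with \<open>r > 0\<close> show False by simp
  qed
qed

lemma ennreal_divide_leI:
  assumes "ennreal a \<le> ennreal c * X" "a \<ge> 0" "c > 0"
  shows "ennreal (a / c) \<le> X"
proof -
  have "ennreal (a / c) = ennreal a * ennreal (1 / c)" using assms by (simp add: ennreal_mult[symmetric])
  also have "\<dots> \<le> ennreal c * X * ennreal (1 / c)" by (rule mult_right_mono[OF assms(1)]) simp
  also have "\<dots> = ennreal (c * (1 / c)) * X" using assms(3) by (subst ennreal_mult) (auto simp: mult_ac)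
  finally show ?thesis using assms(3) by simp
qed

text \<open>The integral estimate for kernels at scale 1, centred at a point where the maximal
  function is finite, gives weighted integrability of the smoothed distribution, after division by a
  constant that makes it locally dominated by the grand maximal function.\<close>

lemma conv_distr_tame:
  fixes f :: "(real ^ 'n::finite \<Rightarrow> complex) \<Rightarrow> complex"
  assumes f: "f \<in> tempered_distributions" and s: "0 < s" "s < 1" and sigma: "\<sigma> * s > real CARD('n)"
    and x0: "maximal_fun (\<lambda>z. ennreal_powr (grand_maximal N f z) s) x0 < top" and \<psi>: "\<psi> \<in> schwartz"
  shows "tame \<sigma> (conv_distr \<psi> f)"
proof -
  have s0: "\<sigma> \<ge> 0" using sigma s by (meson le_less_trans less_imp_le of_nat_0_le_iff zero_less_mult_pos2)
  let ?L = "N + CARD('n) + 1"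
  obtain B where B: "B \<ge> 0" "\<And>is x. length is \<le> N + 1 \<Longrightarrow> (1 + norm x) ^ ?L * norm (iter_deriv is \<psi> x) \<le> B"
    using schwartz_bound_uniform[OF \<psi>] by blast
  define C where "C = B + 1"
  have C: "C > 0" using B(1) by (simp add: C_def)
  have Cle: "(1 + norm x) ^ ?L * norm (iter_deriv is \<psi> x) \<le> C" if "length is \<le> N + 1" for "is" x
    using B(2)[OF that, of x] by (simp add: C_def)
  have m [measurable]: "conv_distr \<psi> f \<in> borel_measurable borel"
    by (intro borel_measurable_continuous_onI conv_distr_continuous[OF f \<psi>])
  define F where "F v = conv_distr \<psi> f v / of_real C" for v
  have [measurable]: "F \<in> borel_measurable borel" unfolding F_def[abs_def] by measurable
  have F: "ennreal (norm (F v)) \<le> grand_maximal N f z" if "dist z v < 1" for v z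
    using conv_distr_le_grand_maximal[OF f \<psi> C Cle that] C
    by (auto simp: F_def norm_divide intro!: ennreal_divide_leI)
  have g: "grand_maximal N f \<in> borel_measurable lebesgue"
    using grand_maximal_measurable[of N f] by (intro measurable_completion) simp
  obtain D where D: "D > 0" and Dle: "\<forall>m>0. \<forall>(x :: real ^ 'n) y. \<forall>F :: real ^ 'n \<Rightarrow> complex. \<forall>g \<in> borel_measurable lebesgue.
     dist x y < m \<longrightarrow> (\<forall>v z. dist z v < m \<longrightarrow> ennreal (norm (F v)) \<le> g z) \<longrightarrow>
     (\<forall>v. ennreal ((1 + dist y v / m) powr (- \<sigma>) * norm (F v)) \<le> ennreal D * ennreal_powr (maximal_fun (\<lambda>z. ennreal_powr (g z) s) x) (1 / s)) \<and>
     (\<integral>\<^sup>+v. ennreal ((1 + dist y v / m) powr (- \<sigma>) * norm (F v)) \<partial>lebesgue)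
        \<le> ennreal (D * m ^ CARD('n)) * ennreal_powr (maximal_fun (\<lambda>z. ennreal_powr (g z) s) x) (1 / s)"
    using kernel_average_le_maximal_fun[OF s sigma] by (elim exE conjE)
  have "(\<integral>\<^sup>+v. ennreal ((1 + dist x0 v / 1) powr (- \<sigma>) * norm (F v)) \<partial>lebesgue)
        \<le> ennreal (D * 1 ^ CARD('n)) * ennreal_powr (maximal_fun (\<lambda>z. ennreal_powr (grand_maximal N f z) s) x0) (1 / s)"
    by (rule Dle[rule_format, THEN conjunct2, OF _ g _ F]) auto
  also have "\<dots> < top" using x0 by (auto simp: ennreal_powr_def ennreal_mult_less_top)
  finally have "(\<integral>\<^sup>+v. ennreal ((1 + dist x0 v / 1) powr (- \<sigma>) * norm (F v)) \<partial>lborel) < top"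
    by (subst (asm) nn_integral_completion) auto
  then have int: "integrable lborel (\<lambda>v. (1 + dist x0 v) powr (- \<sigma>) * norm (F v))"
    by (intro integrableI_bounded) (auto simp: abs_mult)
  \<comment> \<open>Peetre's inequality moves the centre of the weight from \<open>x0\<close> to the
    origin.\<close>
  have "integrable lborel (\<lambda>v. (1 + norm v) powr (- \<sigma>) * norm (F v))"
  proof (rule Bochner_Integration.integrable_bound)
    show "integrable lborel (\<lambda>v. (1 + norm x0) powr \<sigma> * ((1 + dist x0 v) powr (- \<sigma>) * norm (F v)))"
      using int by (rule integrable_mult_right)
    have "norm ((1 + norm v) powr (- \<sigma>) * norm (F v)) \<le> norm ((1 + norm x0) powr \<sigma> * ((1 + dist x0 v) powr (- \<sigma>) * norm (F v)))" for v
    proof -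
      have "(1 + norm v) powr (- \<sigma>) \<le> (1 + dist x0 v) powr (- \<sigma>) * (1 + \<bar>norm v - dist x0 v\<bar>) powr \<sigma>"
        using s0 by (intro powr_neg_add_le) auto
      also have "\<dots> \<le> (1 + dist x0 v) powr (- \<sigma>) * (1 + norm x0) powr \<sigma>"
      proof -
        have "\<bar>norm v - dist x0 v\<bar> \<le> norm x0"
          using norm_triangle_ineq3[of v "v - x0"] by (simp add: dist_norm norm_minus_commute)
        then show ?thesis using s0 by (intro mult_left_mono powr_mono2) auto
      qed
      finally have "(1 + norm v) powr (- \<sigma>) * norm (F v) \<le> (1 + dist x0 v) powr (- \<sigma>) * (1 + norm x0) powr \<sigma> * norm (F v)"
        by (rule mult_right_mono) simp
      then show ?thesis by (simp add: abs_mult mult_ac)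
    qed
    then show "AE v in lborel. norm ((1 + norm v) powr (- \<sigma>) * norm (F v)) \<le> norm ((1 + norm x0) powr \<sigma> * ((1 + dist x0 v) powr (- \<sigma>) * norm (F v)))" by simp
  qed measurable
  then have "integrable lborel (\<lambda>v. C * ((1 + norm v) powr (- \<sigma>) * norm (F v)))" by (rule integrable_mult_right)
  then show ?thesis using C m by (simp add: tame_def F_def norm_divide)
qed

text \<open>
  Both \<open>\<psi>\<close> and a fixed dilated cutoff reproduce the kernel, so that the operator does not depend on
  \<open>\<psi>\<close>. After commuting convolutions, the test function and the fixed cutoff combine to a test function
  at the scale \<open>max t (1 / R)\<close>.
\<close>

lemma grand_maximal_bochner_riesz_le:
  fixes \<psi>0 :: "real ^ 'n::finite \<Rightarrow> complex"
  assumes \<delta>: "\<delta> > 0" and \<sigma>: "\<sigma> = \<delta> + (real CARD('n) + 1) / 2"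
    and s: "0 < s" "s < 1" and sigma: "\<sigma> * s > real CARD('n)" and \<psi>0: "spectral_cutoff 1 \<psi>0"
  shows "\<exists>E>0. \<forall>f \<in> (tempered_distributions :: ((real ^ 'n \<Rightarrow> complex) \<Rightarrow> complex) set). \<forall>R>0. \<forall>\<psi>. spectral_cutoff R \<psi> \<longrightarrow>
     (\<exists>x0. maximal_fun (\<lambda>z. ennreal_powr (grand_maximal N f z) s) x0 < top) \<longrightarrow>
     (\<forall>x. integrable lborel (br_integrand \<delta> R \<psi> f x)) \<and> tame \<sigma> (bochner_riesz \<delta> R \<psi> f) \<and>
     (\<forall>x. grand_maximal N (distr_of (bochner_riesz \<delta> R \<psi> f)) x
        \<le> ennreal E * ennreal_powr (maximal_fun (\<lambda>z. ennreal_powr (grand_maximal N f z) s) x) (1 / s))"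
proof -
  let ?K = "br_kernel \<delta> :: real ^ 'n \<Rightarrow> complex"
  have K: "decays \<sigma> ?K" unfolding \<sigma> by (rule br_kernel_decays[OF \<delta>])
  have s0: "\<sigma> > 0" using \<delta> by (simp add: \<sigma> add_pos_nonneg)
  then have "\<sigma> * s \<le> \<sigma>" using s by simp
  with sigma have sigman: "\<sigma> > real CARD('n)" by linarith
  have S0: "\<psi>0 \<in> schwartz" using \<psi>0 by (simp add: spectral_cutoff_def)
  obtain C where C: "C > 0" and C_test: "\<forall>\<phi>\<in>test_class N. \<forall>t>0. \<forall>r>0. \<exists>\<Phi>\<in>schwartz.
     convolution (dilate t \<phi>) (dilate r \<psi>0) = dilate (max t r) \<Phi> \<and>
     (\<forall>is x. length is \<le> N + 1 \<longrightarrow> (1 + norm x) ^ (N + CARD('n) + 1) * norm (iter_deriv is \<Phi> x) \<le> C)"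
    using convolution_dilate_test_class[OF S0, of N] by (elim exE conjE)
  obtain E where E: "E > 0" and E_le: "\<forall>r>0. \<forall>m\<ge>r. \<forall>x y. \<forall>F \<in> borel_measurable borel. \<forall>g \<in> borel_measurable lebesgue.
     dist x y < m \<longrightarrow> (\<forall>v z. dist z v < m \<longrightarrow> ennreal (norm (F v)) \<le> g z) \<longrightarrow>
     ennreal (norm (convolution (dilate r ?K) F y)) \<le> ennreal E * ennreal_powr (maximal_fun (\<lambda>z. ennreal_powr (g z) s) x) (1 / s)"
    using convolution_le_maximal_fun[OF K s sigma] by (elim exE conjE)
  have "(\<forall>x. integrable lborel (br_integrand \<delta> R \<psi> f x)) \<and> tame \<sigma> (bochner_riesz \<delta> R \<psi> f) \<and>
     (\<forall>x. grand_maximal N (distr_of (bochner_riesz \<delta> R \<psi> f)) x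
        \<le> ennreal (C * E) * ennreal_powr (maximal_fun (\<lambda>z. ennreal_powr (grand_maximal N f z) s) x) (1 / s))"
    if f: "f \<in> tempered_distributions" and R: "R > 0" and \<psi>: "spectral_cutoff R \<psi>"
      and x0: "maximal_fun (\<lambda>z. ennreal_powr (grand_maximal N f z) s) x0 < top"
    for f :: "(real ^ 'n \<Rightarrow> complex) \<Rightarrow> complex" and R \<psi> x0
  proof -
    define r where "r = 1 / R"
    have r: "r > 0" using R by (simp add: r_def)
    let ?k = "dilate r ?K"
    \<comment> \<open>Adapted to the scale of the kernel but otherwise fixed. The given \<psi> is an
      arbitrary cutoff whose seminorms are not controlled, so constants may depend only on
      \<open>\<psi>0\<close>.\<close>
    define \<psi>r where "\<psi>r = dilate r \<psi>0"
    have cut_r: "spectral_cutoff R \<psi>r" using spectral_cutoff_dilate[OF \<psi>0 r] by (simp add: \<psi>r_def r_def)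
    have Sr: "\<psi>r \<in> schwartz" using cut_r by (simp add: spectral_cutoff_def)
    have S: "\<psi> \<in> schwartz" using \<psi> by (simp add: spectral_cutoff_def)
    have k: "decays \<sigma> ?k" using s0 by (intro dilate_decays K r) simp
    have rep: "convolution ?k \<psi> = ?k" "convolution ?k \<psi>r = ?k"
      using br_kernel_convolution_cutoff[OF \<delta> R \<psi>] br_kernel_convolution_cutoff[OF \<delta> R cut_r] by (simp_all add: r_def)
    note tm = conv_distr_tame[OF f s sigma x0]
    have T: "bochner_riesz \<delta> R \<psi> f = convolution ?k (conv_distr \<psi> f)"
      by (simp add: fun_eq_iff bochner_riesz_def br_integrand_def convolution_def r_def)
    have int: "integrable lborel (br_integrand \<delta> R \<psi> f x)" for x
      unfolding br_integrand_def[abs_def] r_def[symmetric]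
      using s0 by (intro decays_mult_integrable[OF decays_reflect[OF k] tm[OF S]]) simp
    have tame: "tame \<sigma> (bochner_riesz \<delta> R \<psi> f)"
      unfolding T by (rule convolution_tame[OF k tm[OF S] sigman])
    \<comment> \<open>\<open>\<psi>r\<close> is inserted through the kernel it reproduces, exchanged
      with \<psi> inside the smoothing of f, and then \<psi> is absorbed by the kernel.\<close>
    have T': "bochner_riesz \<delta> R \<psi> f = convolution ?k (conv_distr \<psi>r f)"
    proof -
      have "convolution ?k (conv_distr \<psi> f) = convolution (convolution ?k \<psi>r) (conv_distr \<psi> f)"
        by (simp only: rep)
      also have "\<dots> = convolution ?k (convolution \<psi>r (conv_distr \<psi> f))"
        by (rule convolution_assoc[OF k schwartz_decays[OF Sr] tm[OF S] sigman, symmetric])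
      also have "convolution \<psi>r (conv_distr \<psi> f) = convolution \<psi> (conv_distr \<psi>r f)"
        unfolding conv_distr_convolution[OF f Sr S, symmetric] conv_distr_convolution[OF f S Sr, symmetric]
        by (simp only: convolution_commute[of \<psi>])
      also have "convolution ?k (convolution \<psi> (conv_distr \<psi>r f)) = convolution (convolution ?k \<psi>) (conv_distr \<psi>r f)"
        by (rule convolution_assoc[OF k schwartz_decays[OF S] tm[OF Sr] sigman])
      finally show ?thesis by (simp only: rep T)
    qed
    have g: "grand_maximal N f \<in> borel_measurable lebesgue"
      using grand_maximal_measurable[of N f] by (intro measurable_completion) simp
    have "grand_maximal N (distr_of (bochner_riesz \<delta> R \<psi> f)) x
        \<le> ennreal (C * E) * ennreal_powr (maximal_fun (\<lambda>z. ennreal_powr (grand_maximal N f z) s) x) (1 / s)" for x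
      unfolding grand_maximal_def[of N "distr_of _"]
    proof (intro SUP_least, clarify)
      fix \<phi> :: "real ^ 'n \<Rightarrow> complex" and y t assume \<phi>: "\<phi> \<in> test_class N" and yt: "norm (y - x) < t"
      have t: "t > 0" using yt norm_ge_zero[of "y - x"] by linarith
      have S\<phi>: "dilate t \<phi> \<in> schwartz" by (intro dilate_schwartz test_class_schwartz[OF \<phi>] t)
      obtain \<Phi> where \<Phi>: "\<Phi> \<in> schwartz" "convolution (dilate t \<phi>) \<psi>r = dilate (max t r) \<Phi>"
        and \<Phi>_le: "\<And>is x. length is \<le> N + 1 \<Longrightarrow> (1 + norm x) ^ (N + CARD('n) + 1) * norm (iter_deriv is \<Phi> x) \<le> C"
        using C_test[rule_format, OF \<phi> t r] unfolding \<psi>r_def by blast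
      let ?m = "max t r"
      have m: "?m > 0" using t by simp
      let ?F = "conv_distr (dilate ?m \<Phi>) f"
      \<comment> \<open>Smoothing the distribution of a function is ordinary convolution, so from
        here on only convolutions of functions are rearranged.\<close>
      have "conv_distr (dilate t \<phi>) (distr_of (bochner_riesz \<delta> R \<psi> f)) y = convolution (dilate t \<phi>) (bochner_riesz \<delta> R \<psi> f) y"
        by (simp add: conv_distr_def distr_of_def convolution_def mult.commute)
      also have "convolution (dilate t \<phi>) (bochner_riesz \<delta> R \<psi> f) = convolution (convolution (dilate t \<phi>) ?k) (conv_distr \<psi>r f)"
        unfolding T' by (rule convolution_assoc[OF schwartz_decays[OF S\<phi>] k tm[OF Sr] sigman])
      \<comment> \<open>The kernel is moved to the outside so that the test function meets the
        cutoff and the two merge into one function at scale \<open>?m\<close>.\<close>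
      also have "\<dots> = convolution (convolution ?k (dilate t \<phi>)) (conv_distr \<psi>r f)"
        by (simp only: convolution_commute[of "dilate t \<phi>"])
      also have "\<dots> = convolution ?k (convolution (dilate t \<phi>) (conv_distr \<psi>r f))"
        by (rule convolution_assoc[OF k schwartz_decays[OF S\<phi>] tm[OF Sr] sigman, symmetric])
      also have "convolution (dilate t \<phi>) (conv_distr \<psi>r f) = ?F"
        by (simp only: conv_distr_convolution[OF f S\<phi> Sr, symmetric] \<Phi>(2))
      finally have eq: "conv_distr (dilate t \<phi>) (distr_of (bochner_riesz \<delta> R \<psi> f)) y = convolution ?k ?F y" .
      \<comment> \<open>Divided by C so that the grand maximal function itself, and not a multiple
        of it, dominates locally.\<close>
      define G where "G v = ?F v / of_real C" for v
      have "?F \<in> borel_measurable borel"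
        by (intro borel_measurable_continuous_onI conv_distr_continuous[OF f] dilate_schwartz \<Phi>(1) m)
      then have Gm: "G \<in> borel_measurable borel" unfolding G_def[abs_def] by measurable
      have Gle: "ennreal (norm (G v)) \<le> grand_maximal N f z" if "dist z v < ?m" for v z
        using conv_distr_le_grand_maximal[OF f \<Phi>(1) C \<Phi>_le that] C
        by (auto simp: G_def norm_divide intro!: ennreal_divide_leI)
      have "convolution ?k ?F y = of_real C * convolution ?k G y"
        using C by (simp add: convolution_def G_def)
      then have "ennreal (norm (convolution ?k ?F y)) = ennreal C * ennreal (norm (convolution ?k G y))"
        using C by (simp add: norm_mult ennreal_mult)
      also have "\<dots> \<le> ennreal C * (ennreal E * ennreal_powr (maximal_fun (\<lambda>z. ennreal_powr (grand_maximal N f z) s) x) (1 / s))"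
      proof (rule mult_left_mono)
        have "dist x y < ?m" using yt by (simp add: dist_norm norm_minus_commute)
        then show "ennreal (norm (convolution ?k G y)) \<le> ennreal E * ennreal_powr (maximal_fun (\<lambda>z. ennreal_powr (grand_maximal N f z) s) x) (1 / s)"
          by (intro E_le[rule_format, OF r _ Gm g _ Gle]) auto
      qed simp
      also have "\<dots> = ennreal (C * E) * ennreal_powr (maximal_fun (\<lambda>z. ennreal_powr (grand_maximal N f z) s) x) (1 / s)"
        using C E by (simp add: ennreal_mult mult.assoc)
      finally show "ennreal (norm (conv_distr (dilate t \<phi>) (distr_of (bochner_riesz \<delta> R \<psi> f)) y))
         \<le> ennreal (C * E) * ennreal_powr (maximal_fun (\<lambda>z. ennreal_powr (grand_maximal N f z) s) x) (1 / s)"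
        unfolding eq .
    qed
    with int tame show ?thesis by blast
  qed
  moreover have "C * E > 0" using C E by simp
  ultimately show ?thesis by blast
qed

theorem theorem1p2:
  fixes w :: "real ^ 'n::finite \<Rightarrow> real" and p \<delta> :: real and N :: nat
  assumes "0 < p" and "p \<le> 1"
    and "\<delta> > real CARD('n) / p - (real CARD('n) + 1) / 2"
    and "w \<in> A1_class"
    and "\<not> (\<exists>m::nat. m > 0 \<and> \<delta> - (real CARD('n) - 1) / 2 = real m)"
    and "int N \<ge> \<lfloor>real CARD('n) * (critical_index w / p - 1)\<rfloor>"
  shows "\<exists>C::real. C > 0 \<and>
    (\<forall>f \<in> weak_H N p w. \<forall>R>0. \<forall>\<psi>. spectral_cutoff R \<psi> \<longrightarrow>
       (\<forall>x. integrable lborel (br_integrand \<delta> R \<psi> f x)) \<and>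
       (\<forall>\<eta>\<in>schwartz. integrable lborel (\<lambda>x. bochner_riesz \<delta> R \<psi> f x * \<eta> x)) \<and>
       distr_of (bochner_riesz \<delta> R \<psi> f) \<in> weak_H N p w \<and>
       weak_H_norm N p w (distr_of (bochner_riesz \<delta> R \<psi> f)) \<le> ennreal C * weak_H_norm N p w f)"
proof (cases "\<exists>\<psi>0 :: real ^ 'n \<Rightarrow> complex. spectral_cutoff 1 \<psi>0")
  \<comment> \<open>A cutoff for radius R rescales to one for radius 1, so without the latter the
    claim is vacuous.\<close>
  case False
  have "\<not> spectral_cutoff R \<psi>" if "R > 0" for R and \<psi> :: "real ^ 'n \<Rightarrow> complex"
    using False spectral_cutoff_dilate[of R \<psi> R] that by auto
  then show ?thesis by (intro exI[of _ 1]) simp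
next
  case True
  then obtain \<psi>0 :: "real ^ 'n \<Rightarrow> complex" where \<psi>0: "spectral_cutoff 1 \<psi>0" by blast
  have p: "0 < p" "p \<le> 1" and w: "w \<in> A1_class" by fact+
  define n where "n = real CARD('n)"
  define \<sigma> where "\<sigma> = \<delta> + (n + 1) / 2"
  have n: "n \<ge> 1"
  proof -
    have "1 \<le> CARD('n)" by (simp add: Suc_le_eq)
    then show ?thesis unfolding n_def by linarith
  qed
  have np: "n / p \<ge> n" using p n by (simp add: pos_le_divide_eq)
  have sig: "\<sigma> > n / p" using assms(3) by (simp add: \<sigma>_def n_def)
  have \<delta>: "\<delta> > 0" using assms(3)[folded n_def] np n unfolding add_divide_distrib by linarith
  have sigma0: "\<sigma> > 0" using sig np n by linarith
  have nsig: "n / \<sigma> < p" using sig p sigma0 by (simp add: field_simps)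
  have "0 < n / \<sigma>" using n sigma0 by simp
  \<comment> \<open>The lower bound makes the s-th power of the kernel integrable, the upper bound
    makes p / s exceed 1; since p \<le> 1, also s < 1.\<close>
  moreover obtain s where "n / \<sigma> < s" "s < p" using dense[OF nsig] by blast
  ultimately have s: "0 < s" "s < p" "n / \<sigma> < s" by simp_all
  have s1: "s < 1" using s p by linarith
  have sigs: "\<sigma> * s > real CARD('n)" using s(3) sigma0 by (simp add: n_def field_simps)
  have ww: "weight w" using w by (simp add: A1_class_def)
  obtain D where D: "D > 0" and D_le: "\<forall>g \<in> borel_measurable lebesgue. \<forall>A\<ge>0.
     (\<forall>t>0. weighted_measure w {x. g x > ennreal t} \<le> ennreal ((A / t) powr p)) \<longrightarrow>
     (\<forall>t>0. weighted_measure w {x. maximal_fun (\<lambda>y. ennreal_powr (g y) s) x > ennreal (t powr s)} \<le> ennreal (D * (A / t) powr p))"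
    using maximal_fun_weak_type[OF w s(1,2)] by (elim exE conjE)
  obtain E where E: "E > 0" and E_le: "\<forall>f \<in> tempered_distributions. \<forall>R>0. \<forall>\<psi> :: real ^ 'n \<Rightarrow> complex. spectral_cutoff R \<psi> \<longrightarrow>
     (\<exists>x0. maximal_fun (\<lambda>z. ennreal_powr (grand_maximal N f z) s) x0 < top) \<longrightarrow>
     (\<forall>x. integrable lborel (br_integrand \<delta> R \<psi> f x)) \<and> tame \<sigma> (bochner_riesz \<delta> R \<psi> f) \<and>
     (\<forall>x. grand_maximal N (distr_of (bochner_riesz \<delta> R \<psi> f)) x
        \<le> ennreal E * ennreal_powr (maximal_fun (\<lambda>z. ennreal_powr (grand_maximal N f z) s) x) (1 / s))"
    using grand_maximal_bochner_riesz_le[OF \<delta> \<sigma>_def[unfolded n_def] s(1) s1 sigs \<psi>0, of N] by (elim exE conjE)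
  \<comment> \<open>The factor D bounds a measure, so it enters the norm through its p-th root; E
    comes from the pointwise bound.\<close>
  define C where "C = D powr (1 / p) * E"
  have C: "C > 0" using D E by (simp add: C_def)
  have "(\<forall>x. integrable lborel (br_integrand \<delta> R \<psi> f x)) \<and>
       (\<forall>\<eta>\<in>schwartz. integrable lborel (\<lambda>x. bochner_riesz \<delta> R \<psi> f x * \<eta> x)) \<and>
       distr_of (bochner_riesz \<delta> R \<psi> f) \<in> weak_H N p w \<and>
       weak_H_norm N p w (distr_of (bochner_riesz \<delta> R \<psi> f)) \<le> ennreal C * weak_H_norm N p w f"
    if f: "f \<in> weak_H N p w" and R: "R > 0" and \<psi>: "spectral_cutoff R \<psi>" for f R \<psi>
  proof -
    let ?g = "grand_maximal N f"
    let ?h = "maximal_fun (\<lambda>y. ennreal_powr (?g y) s)"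
    let ?T = "bochner_riesz \<delta> R \<psi> f"
    have ft: "f \<in> tempered_distributions" and fin: "weak_L_norm p w ?g < top" and g: "?g \<in> borel_measurable lebesgue"
      using f by (auto simp: weak_H_def weak_L_def)
    obtain A where A: "weak_L_norm p w ?g = ennreal A" "A \<ge> 0"
      using fin by (cases "weak_L_norm p w ?g") auto
    have g_le: "weighted_measure w {x. ?g x > ennreal t} \<le> ennreal ((A / t) powr p)" if "t > 0" for t
      using A p that by (intro weak_L_norm_leD) auto
    have h_le: "weighted_measure w {x. ?h x > ennreal (t powr s)} \<le> ennreal (D * (A / t) powr p)" if "t > 0" for t
      using D_le[rule_format, OF g A(2) g_le that] .
    \<comment> \<open>Membership of f in the weak Hardy space is used here for more than the norm
      bound: it is what makes the convolution integral converge.\<close>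
    have ex: "\<exists>x0. ?h x0 < top"
      by (rule ex_finite_maximal_fun[OF ww A(2) D p(1) h_le])
    note E' = E_le[rule_format, OF ft R \<psi> ex]
    have tame: "tame \<sigma> ?T" using E' by blast
    have "weak_L_norm p w (grand_maximal N (distr_of ?T)) \<le> ennreal (C * A)"
    proof (rule weak_L_norm_leI)
      fix t :: real assume t: "t > 0"
      have "{x. grand_maximal N (distr_of ?T) x > ennreal t} \<subseteq> {x. ?h x > ennreal ((t / E) powr s)}"
      proof clarify
        fix x assume x: "grand_maximal N (distr_of ?T) x > ennreal t"
        show "?h x > ennreal ((t / E) powr s)"
        proof (rule ccontr)
          assume "\<not> ?h x > ennreal ((t / E) powr s)"
          then have "ennreal_powr (?h x) (1 / s) \<le> ennreal_powr (ennreal ((t / E) powr s)) (1 / s)"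
            using s by (intro ennreal_powr_mono) auto
          also have "\<dots> = ennreal (t / E)" using s t E by (simp add: powr_powr)
          finally have "ennreal E * ennreal_powr (?h x) (1 / s) \<le> ennreal E * ennreal (t / E)"
            by (rule mult_left_mono) simp
          also have "\<dots> = ennreal t" using t E by (simp add: ennreal_mult[symmetric])
          finally have "ennreal E * ennreal_powr (?h x) (1 / s) \<le> ennreal t" .
          moreover have "grand_maximal N (distr_of ?T) x \<le> ennreal E * ennreal_powr (?h x) (1 / s)" using E' by blast
          ultimately have "grand_maximal N (distr_of ?T) x \<le> ennreal t" by (rule order_trans[rotated])
          with x show False by (simp add: not_less[symmetric])
        qed
      qed
      then have "weighted_measure w {x. grand_maximal N (distr_of ?T) x > ennreal t} \<le> weighted_measure w {x. ?h x > ennreal ((t / E) powr s)}"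
        by (rule weighted_measure_mono)
      also have "\<dots> \<le> ennreal (D * (A / (t / E)) powr p)" using t E by (intro h_le) simp
      also have "D * (A / (t / E)) powr p = (C * A / t) powr p"
      proof -
        have "(C * A / t) powr p = (D powr (1 / p) * (A / (t / E))) powr p" by (simp add: C_def mult_ac)
        also have "\<dots> = (D powr (1 / p)) powr p * (A / (t / E)) powr p" using A(2) t E by (intro powr_mult)
        also have "(D powr (1 / p)) powr p = D" using D p by (simp add: powr_powr)
        finally show ?thesis by simp
      qed
      finally show "weighted_measure w {x. grand_maximal N (distr_of ?T) x > ennreal t} \<le> ennreal ((C * A / t) powr p)" .
    qed (use A C p in auto)
    also have "ennreal (C * A) = ennreal C * weak_L_norm p w ?g" using C A by (simp add: ennreal_mult)
    finally have le: "weak_H_norm N p w (distr_of ?T) \<le> ennreal C * weak_H_norm N p w f"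
      by (simp add: weak_H_norm_def)
    have "distr_of ?T \<in> weak_H N p w"
      unfolding weak_H_def weak_L_def
    proof (intro CollectI conjI)
      show "distr_of ?T \<in> tempered_distributions" by (rule distr_of_tame_tempered(1)[OF tame])
      show "grand_maximal N (distr_of ?T) \<in> borel_measurable lebesgue"
        using grand_maximal_measurable[of N "distr_of ?T"] by (intro measurable_completion) simp
      show "weak_L_norm p w (grand_maximal N (distr_of ?T)) < top"
        using le fin by (auto simp: weak_H_norm_def ennreal_mult_less_top intro: le_less_trans)
    qed
    moreover have "\<forall>\<eta>\<in>schwartz. integrable lborel (\<lambda>x. ?T x * \<eta> x)"
      using distr_of_tame_tempered(2)[OF tame] by blast
    ultimately show ?thesis using E' le by blast
  qed
  with C show ?thesis by blast
qed

end
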